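(* There exists $\rho_0>0$ such that, for every $s$ with $\frac23\le s<1$ and every $r<\rho_0$, there is no mapping $u\in W^{1+s,\frac2s}_{loc}(B^1,\mathbb{R}^3)$ of the open unit disk $B^1\subset\mathbb{R}^2$ which satisfies $(\nabla u)^T\nabla u=\mathrm{Id}$ a.e. in $B^1$ and whose image is contained in a three-dimensional Euclidean ball of radius $r$.
   Context: For $0<s<1$, $1\le p<\infty$ and $\Omega\subset\mathbb{R}^n$ open, $[f]_{W^{s,p}(\Omega)}=\big(\int_\Omega\int_\Omega\frac{|f(x)-f(y)|^p}{|x-y|^{n+sp}}\,dx\,dy\big)^{1/p}$, and $W^{1+s,p}(\Omega)$ is the space of $f\in W^{1,p}(\Omega)$ with $[Df]_{W^{s,p}(\Omega)}<\infty$; the subscript $loc$ has the usual meaning. Mappings $u$ are identified with their continuous representatives. *)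

theory Defs
  imports "HOL-Analysis.Analysis"
begin

primrec C_k :: "nat \<Rightarrow> ('a::euclidean_space \<Rightarrow> real) \<Rightarrow> bool" where
  "C_k 0 \<phi> \<longleftrightarrow> continuous_on UNIV \<phi>"
| "C_k (Suc k) \<phi> \<longleftrightarrow>
     (\<forall>x. \<phi> differentiable (at x)) \<and> (\<forall>v. C_k k (\<lambda>x. frechet_derivative \<phi> (at x) v))"

definition test_functions :: "'a::euclidean_space set \<Rightarrow> ('a \<Rightarrow> real) set" where
  "test_functions \<Omega> = {\<phi>. (\<forall>k. C_k k \<phi>) \<and>
     compact (closure {x. \<phi> x \<noteq> 0}) \<and> closure {x. \<phi> x \<noteq> 0} \<subseteq> \<Omega>}"

definition L1_loc :: "'a::euclidean_space set \<Rightarrow> ('a \<Rightarrow> 'b::euclidean_space) \<Rightarrow> bool" where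
  "L1_loc \<Omega> f \<longleftrightarrow> (\<forall>K. compact K \<and> K \<subseteq> \<Omega> \<longrightarrow> set_integrable lebesgue K f)"

definition in_Lp :: "real \<Rightarrow> 'a::euclidean_space set \<Rightarrow> ('a \<Rightarrow> 'b::euclidean_space) \<Rightarrow> bool" where
  "in_Lp p \<Omega> f \<longleftrightarrow> f \<in> borel_measurable (lebesgue_on \<Omega>) \<and>
     integrable (lebesgue_on \<Omega>) (\<lambda>x. norm (f x) powr p)"

text \<open>The gradient is the matrix with entry \<open>G x $ i $ j\<close> equal to the weak partial
  derivative of the \<open>i\<close>-th component in direction \<open>j\<close>; it is determined only up to null sets.\<close>

definition has_weak_gradient ::
  "(real^'n \<Rightarrow> real^'m) \<Rightarrow> (real^'n \<Rightarrow> real^'n^'m) \<Rightarrow> (real^'n) set \<Rightarrow> bool" where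
  "has_weak_gradient f G \<Omega> \<longleftrightarrow> L1_loc \<Omega> f \<and> L1_loc \<Omega> G \<and>
     (\<forall>\<phi>\<in>test_functions \<Omega>. \<forall>i j.
        (LINT x|lebesgue_on \<Omega>. f x $ i * frechet_derivative \<phi> (at x) (axis j 1))
        = - (LINT x|lebesgue_on \<Omega>. G x $ i $ j * \<phi> x))"

definition W1 :: "real \<Rightarrow> (real^'n) set \<Rightarrow> (real^'n \<Rightarrow> real^'m) set" where
  "W1 p \<Omega> = {f. in_Lp p \<Omega> f \<and> (\<exists>G. has_weak_gradient f G \<Omega> \<and> in_Lp p \<Omega> G)}"

definition gagliardo_seminorm ::
  "real \<Rightarrow> real \<Rightarrow> 'a::euclidean_space set \<Rightarrow> ('a \<Rightarrow> 'b::euclidean_space) \<Rightarrow> ennreal" where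
  "gagliardo_seminorm s p \<Omega> f =
     (let I = (\<integral>\<^sup>+ y. \<integral>\<^sup>+ x. ennreal (norm (f x - f y) powr p / norm (x - y) powr (real DIM('a) + s * p))
                \<partial>lebesgue_on \<Omega> \<partial>lebesgue_on \<Omega>)
      in if I = \<infinity> then \<infinity> else ennreal (enn2real I powr (1 / p)))"

text \<open>The space \<open>W\<^sup>1\<^sup>+\<^sup>s\<^sup>,\<^sup>p(\<Omega>)\<close>, meaningful for \<open>0 < s < 1\<close>, \<open>1 \<le> p\<close> and \<open>\<Omega>\<close> open. Finiteness
  of the seminorm does not depend on the choice of the weak gradient \<open>G\<close>.\<close>

definition W1s :: "real \<Rightarrow> real \<Rightarrow> (real^'n) set \<Rightarrow> (real^'n \<Rightarrow> real^'m) set" where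
  "W1s s p \<Omega> = {f \<in> W1 p \<Omega>. \<exists>G. has_weak_gradient f G \<Omega> \<and> gagliardo_seminorm s p \<Omega> G < \<infinity>}"

definition W1s_loc :: "real \<Rightarrow> real \<Rightarrow> (real^'n) set \<Rightarrow> (real^'n \<Rightarrow> real^'m) set" where
  "W1s_loc s p \<Omega> =
     {f. \<forall>\<Omega>'. open \<Omega>' \<and> compact (closure \<Omega>') \<and> closure \<Omega>' \<subseteq> \<Omega> \<longrightarrow> f \<in> W1s s p \<Omega>'}"

end

theory Submission
  imports Defs
begin

text \<open>After a translation the image lies in the ball of radius \<open>r\<close> about the origin. For a smooth isometric
  immersion \<open>u\<close> the function \<open>\<eta> = \<bar>u\<bar>\<^sup>2 / 2\<close> satisfies \<open>D\<^sup>2\<eta> - I = (u \<bullet> \<nu>) A\<close> with \<open>A\<close> the second fundamental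
  form, and \<open>det A = 0\<close> by Gauss, so that \<open>1 = \<Delta>\<eta> - det D\<^sup>2\<eta>\<close>. The right-hand side is in divergence form and
  \<open>\<bar>D\<eta>\<bar>\<close> is at most of order \<open>r\<close>; testing with a fixed bump of integral \<open>1\<close> gives \<open>1 \<le> C r\<close>, hence a lower
  bound for \<open>r\<close>.

  For \<open>u\<close> in \<open>W\<^sup>1\<^sup>+\<^sup>s\<^sup>,\<^sup>2\<^sup>/\<^sup>s\<close> this is applied to the mollifications of \<open>u\<close> at scale \<open>\<epsilon>\<close>. Their induced metric is the
  identity up to a term quadratic in the oscillation of \<open>Du\<close>, and every error in the computation above is at most
  \<open>\<epsilon>\<^sup>-\<^sup>2\<close> times the mean over an \<open>\<epsilon>\<close>-square of \<open>\<bar>Du(y) - Du(x)\<bar>\<^sup>3\<close>, up to \<open>O(\<epsilon>)\<close>. As \<open>Du\<close> is bounded and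
  \<open>2/s \<le> 3\<close>, the integral of these errors is controlled by the part of the Gagliardo integral
  with \<open>\<bar>x - y\<bar> \<le> \<epsilon>\<close>, which tends to \<open>0\<close>.\<close>

subsection \<open>Smooth bump functions\<close>

text \<open>The threshold is uniform in s because s enters only through the finiteness of one
  integral: the weight |x - y|^(2 + s * (2/s)) is |x - y|^4 for every s. The cube has a simple
  origin. Let m_j be the mean of the j-th power of the oscillation of Du on the \<epsilon>-square.
  Second derivatives of the mollified map have size m_1/\<epsilon>, their tangential components only
  m_2/\<epsilon>, and the metric defect is of order m_2. The leading errors are multiples of m_1
  m_2/\<epsilon>^2, and m_1 m_2 <= m_3; a lone m_2/\<epsilon> is at most m_3/\<epsilon>^2 +
  \<epsilon>. The mollified map is not isometric, so the integral identity is stated for arbitrary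
  smooth maps, with every failure of isometry collected in \<open>curvature_error\<close>. Its
  second derivatives need not stay bounded, so the remaining terms are integrated by parts until
  only first derivatives of \<eta> occur. One kernel \<open>K\<close> serves both as mollifier and
  as test bump; a bound \<open>C\<close> on its derivatives up to order two is the only constant in
  \<open>1 \<le> C * r\<close>.\<close>

definition flat_exp :: "nat \<Rightarrow> real \<Rightarrow> real" where
  "flat_exp n y = (if y > 0 then inverse y ^ n * exp (- inverse y) else 0)"

text \<open>This is the difference quotient at the gluing point 0; under t = 1/h the right-hand
  limit is that of t^(n+1) / exp t at infinity.\<close>

lemma flat_exp_quotient_tendsto_0: "((\<lambda>h. flat_exp n h / h) \<longlongrightarrow> 0) (at 0)"
proof -
  have "((\<lambda>t::real. t ^ Suc n / exp t) \<longlongrightarrow> 0) at_top"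
    by (rule tendsto_power_div_exp_0)
  then have "((\<lambda>h::real. inverse h ^ Suc n / exp (inverse h)) \<longlongrightarrow> 0) (at_right 0)"
    by (rule filterlim_compose[OF _ filterlim_inverse_at_top_right])
  then have R: "((\<lambda>h. flat_exp n h / h) \<longlongrightarrow> 0) (at_right 0)"
    by (rule Lim_transform_eventually)
      (auto simp: eventually_at_right_field flat_exp_def exp_minus field_simps intro!: exI[of _ 1])
  have L: "((\<lambda>h. flat_exp n h / h) \<longlongrightarrow> 0) (at_left 0)"
    by (rule Lim_transform_eventually[OF tendsto_const])
      (auto simp: eventually_at_left_field flat_exp_def intro!: exI[of _ "-1"])
  show ?thesis
    using L R by (simp add: filterlim_split_at)
qed

text \<open>Differentiating exp(-1/y) produces powers of 1/y, so all the functions y^(-n) exp(-1/y)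
  are treated at once. At the gluing point the right-hand side is 0 by definition, which is the
  preceding limit.\<close>

lemma flat_exp_has_real_derivative:
  "(flat_exp n has_real_derivative flat_exp (n + 2) y - n * flat_exp (n + 1) y) (at y)"
proof -
  consider "y > 0" | "y < 0" | "y = 0" by linarith
  then show ?thesis
  proof cases
    case 1
    have "((\<lambda>y. inverse y ^ n * exp (- inverse y)) has_real_derivative
        flat_exp (n + 2) y - n * flat_exp (n + 1) y) (at y)"
    proof (cases n)
      case 0
      then show ?thesis
        using 1 by (auto intro!: derivative_eq_intros simp: flat_exp_def power2_eq_square)
    next
      case (Suc k)
      show ?thesis
        unfolding Suc using 1
        by (auto intro!: derivative_eq_intros simp: flat_exp_def algebra_simps) (cases k; simp)
    qed
    moreover have "eventually (\<lambda>z. inverse z ^ n * exp (- inverse z) = flat_exp n z) (nhds y)"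
      using 1 by (auto intro!: eventually_nhds_in_open[of "{0<..}" y, THEN eventually_mono] simp: flat_exp_def)
    ultimately show ?thesis
      using DERIV_cong_ev[OF refl, of "\<lambda>z. inverse z ^ n * exp (- inverse z)" "flat_exp n" y] by blast
  next
    case 2
    have "((\<lambda>y. 0) has_real_derivative flat_exp (n + 2) y - n * flat_exp (n + 1) y) (at y)"
      using 2 by (auto simp: flat_exp_def)
    moreover have "eventually (\<lambda>z. 0 = flat_exp n z) (nhds y)"
      using 2 by (auto intro!: eventually_nhds_in_open[of "{..<0}" y, THEN eventually_mono] simp: flat_exp_def)
    ultimately show ?thesis
      using DERIV_cong_ev[OF refl, of "\<lambda>z. 0" "flat_exp n" y] by blast
  next
    case 3
    then show ?thesis
      using flat_exp_quotient_tendsto_0[of n] by (simp add: DERIV_def flat_exp_def)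
  qed
qed

text \<open>A class that contains the bumps and is closed under differentiation; derivatives of all
  orders then exist without any of them being computed.\<close>

inductive_set flat_exp_algebra :: "(real \<Rightarrow> real) set" where
  base: "(\<lambda>x. flat_exp n (c + d * x)) \<in> flat_exp_algebra"
| add: "f \<in> flat_exp_algebra \<Longrightarrow> g \<in> flat_exp_algebra \<Longrightarrow> (\<lambda>x. f x + g x) \<in> flat_exp_algebra"
| mult: "f \<in> flat_exp_algebra \<Longrightarrow> g \<in> flat_exp_algebra \<Longrightarrow> (\<lambda>x. f x * g x) \<in> flat_exp_algebra"
| cmult: "f \<in> flat_exp_algebra \<Longrightarrow> (\<lambda>x. c * f x) \<in> flat_exp_algebra"

lemma flat_exp_algebra_derivative:
  "f \<in> flat_exp_algebra \<Longrightarrow> \<exists>g\<in>flat_exp_algebra. \<forall>x. (f has_real_derivative g x) (at x)"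
proof (induction rule: flat_exp_algebra.induct)
  case (base n c d)
  let ?g = "\<lambda>x. d * (flat_exp (n + 2) (c + d * x) + (- real n) * flat_exp (n + 1) (c + d * x))"
  have "?g \<in> flat_exp_algebra"
    by (intro flat_exp_algebra.intros)
  moreover have "((\<lambda>x. flat_exp n (c + d * x)) has_real_derivative ?g x) (at x)" for x
    by (rule DERIV_cong[OF DERIV_chain'[OF _ flat_exp_has_real_derivative]])
      (auto intro!: derivative_eq_intros)
  ultimately show ?case by (intro bexI[of _ ?g]) auto
next
  case (add f g)
  then obtain f' g' where "f' \<in> flat_exp_algebra" "g' \<in> flat_exp_algebra"
    "\<forall>x. (f has_real_derivative f' x) (at x)" "\<forall>x. (g has_real_derivative g' x) (at x)" by blast
  then show ?case
    by (intro bexI[of _ "\<lambda>x. f' x + g' x"]) (auto intro: flat_exp_algebra.add DERIV_add)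
next
  case (mult f g)
  then obtain f' g' where *: "f' \<in> flat_exp_algebra" "g' \<in> flat_exp_algebra"
    "\<forall>x. (f has_real_derivative f' x) (at x)" "\<forall>x. (g has_real_derivative g' x) (at x)" by blast
  have "(\<lambda>x. f x * g' x + f' x * g x) \<in> flat_exp_algebra"
    by (intro flat_exp_algebra.intros mult * )
  moreover have "((\<lambda>x. f x * g x) has_real_derivative (f x * g' x + f' x * g x)) (at x)" for x
    using * by (auto intro!: derivative_eq_intros)
  ultimately show ?case by (intro bexI[of _ "\<lambda>x. f x * g' x + f' x * g x"]) auto
next
  case (cmult f c)
  then obtain f' where "f' \<in> flat_exp_algebra" "\<forall>x. (f has_real_derivative f' x) (at x)" by blast
  then show ?case
    by (intro bexI[of _ "\<lambda>x. c * f' x"]) (auto intro: flat_exp_algebra.cmult DERIV_cmult)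
qed

text \<open>Smoothness of \<open>B 0\<close> is carried by the sequence of its derivatives, so that
  higher derivatives are named functions that can be combined into products later.\<close>

definition derivative_sequence :: "(nat \<Rightarrow> real \<Rightarrow> real) \<Rightarrow> bool" where
  "derivative_sequence B \<longleftrightarrow> (\<forall>n x. (B n has_real_derivative B (Suc n) x) (at x))"

lemma flat_exp_algebra_derivative_sequence:
  assumes "f \<in> flat_exp_algebra"
  obtains B where "B 0 = f" "derivative_sequence B"
proof -
  obtain D where D: "\<And>f. f \<in> flat_exp_algebra \<Longrightarrow> D f \<in> flat_exp_algebra"
    "\<And>f x. f \<in> flat_exp_algebra \<Longrightarrow> (f has_real_derivative D f x) (at x)"
    using flat_exp_algebra_derivative by metis
  have "(D ^^ n) f \<in> flat_exp_algebra" for n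
    by (induction n) (auto intro: assms D)
  then have "derivative_sequence (\<lambda>n. (D ^^ n) f)"
    by (auto simp: derivative_sequence_def intro: D)
  then show thesis
    by (intro that[of "\<lambda>n. (D ^^ n) f"]) auto
qed

text \<open>The complement of a closed set is open, so each derivative vanishes there together with
  the preceding one.\<close>

lemma derivative_sequence_support:
  assumes B: "derivative_sequence B" and S: "closed S" and 0: "\<And>x. x \<notin> S \<Longrightarrow> B 0 x = 0"
  shows "x \<notin> S \<Longrightarrow> B n x = 0"
proof (induction n arbitrary: x)
  case 0
  then show ?case using assms(3) by simp
next
  case (Suc n)
  have "eventually (\<lambda>z. B n z = 0) (nhds x)"
    using Suc S by (intro eventually_nhds_in_open[of "- S" x, THEN eventually_mono]) auto
  moreover have "(B n has_real_derivative B (Suc n) x) (at x)"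
    using B by (simp add: derivative_sequence_def)
  ultimately have "((\<lambda>z. 0) has_real_derivative B (Suc n) x) (at x)"
    using DERIV_cong_ev[OF refl, of "B n" "\<lambda>z. 0" x] by blast
  then show ?case
    using DERIV_unique DERIV_const by blast
qed

text \<open>The factor \<open>m\<close> sharpens the edges: as it grows, the bump tends pointwise to
  the indicator of the open interval. For b <= a and positive \<open>m\<close> it vanishes
  identically, which covers degenerate boxes.\<close>

definition interval_bump :: "real \<Rightarrow> real \<Rightarrow> real \<Rightarrow> real \<Rightarrow> real" where
  "interval_bump m a b x = flat_exp 0 (m * (x - a)) * flat_exp 0 (m * (b - x))"

lemma interval_bump_pos: "m > 0 \<Longrightarrow> a < x \<Longrightarrow> x < b \<Longrightarrow> interval_bump m a b x > 0"
  by (simp add: interval_bump_def flat_exp_def)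

lemma interval_bump_eq_0: "m > 0 \<Longrightarrow> x \<notin> {a<..<b} \<Longrightarrow> interval_bump m a b x = 0"
  by (auto simp: interval_bump_def flat_exp_def zero_less_mult_iff)

lemma flat_exp_0_bounds: "0 \<le> flat_exp 0 y" "flat_exp 0 y \<le> 1"
  by (auto simp: flat_exp_def)

lemma interval_bump_bounds: "0 \<le> interval_bump m a b x" "interval_bump m a b x \<le> 1"
  by (auto simp: interval_bump_def flat_exp_0_bounds intro!: mult_le_one)

lemma interval_bump_tendsto:
  "(\<lambda>m. interval_bump (real (Suc m)) a b x) \<longlonglongrightarrow> indicator {a<..<b} x"
proof (cases "x \<in> {a<..<b}")
  case True
  have *: "(\<lambda>m. flat_exp 0 (real (Suc m) * d)) \<longlonglongrightarrow> 1" if "d > 0" for d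
  proof -
    have "(\<lambda>m. exp (- inverse (real (Suc m)) * (1 / d))) \<longlonglongrightarrow> exp (- 0 * (1 / d))"
      by (intro tendsto_intros LIMSEQ_inverse_real_of_nat)
    moreover have "flat_exp 0 (real (Suc m) * d) = exp (- inverse (real (Suc m)) * (1 / d))" for m
      using that by (simp add: flat_exp_def inverse_eq_divide del: of_nat_Suc)
    ultimately show ?thesis by simp
  qed
  show ?thesis
    using tendsto_mult[OF *[of "x - a"] *[of "b - x"]] True
    by (simp add: interval_bump_def)
next
  case False
  then show ?thesis by (simp add: interval_bump_eq_0 del: of_nat_Suc)
qed

lemma interval_bump_derivative_sequence:
  assumes "m > 0"
  obtains B where "B 0 = interval_bump m a b" "derivative_sequence B"
    "\<And>n x. x \<notin> {a..b} \<Longrightarrow> B n x = 0"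
proof -
  have "(\<lambda>x. flat_exp 0 (- m * a + m * x) * flat_exp 0 (m * b + (- m) * x)) \<in> flat_exp_algebra"
    by (intro flat_exp_algebra.intros)
  also have "(\<lambda>x. flat_exp 0 (- m * a + m * x) * flat_exp 0 (m * b + (- m) * x)) = interval_bump m a b"
    by (simp add: interval_bump_def fun_eq_iff algebra_simps)
  finally obtain B where B: "B 0 = interval_bump m a b" "derivative_sequence B"
    by (rule flat_exp_algebra_derivative_sequence)
  moreover have "B n x = 0" if "x \<notin> {a..b}" for n x
    by (rule derivative_sequence_support[OF B(2) closed_atLeastAtMost _ that])
      (use assms in \<open>auto simp: B(1) interval_bump_eq_0\<close>)
  ultimately show thesis by (rule that)
qed

subsection \<open>Smooth families and integration by parts\<close>

lemma C_k_linear_combination: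
  "C_k k f \<Longrightarrow> C_k k g \<Longrightarrow> C_k k (\<lambda>x. \<alpha> * f x + \<beta> * g x)"
proof (induction k arbitrary: f g)
  case 0
  then show ?case by (auto intro!: continuous_intros)
next
  case (Suc k)
  have f: "(f has_derivative frechet_derivative f (at x)) (at x)"
    and g: "(g has_derivative frechet_derivative g (at x)) (at x)" for x
    using Suc.prems by (auto simp: frechet_derivative_works)
  have D: "((\<lambda>x. \<alpha> * f x + \<beta> * g x) has_derivative
      (\<lambda>v. \<alpha> * frechet_derivative f (at x) v + \<beta> * frechet_derivative g (at x) v)) (at x)" for x
    by (auto intro!: derivative_eq_intros f g)
  then show ?case
    using Suc by (auto simp: frechet_derivative_at[OF D, symmetric] differentiable_def)
qed

text \<open>\<open>K a b\<close> plays the role of \<open>\<partial>\<^sub>1\<^sup>a \<partial>\<^sub>2\<^sup>b (K 0 0)\<close>; the double index makes mixed partial derivatives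
  commute by construction.\<close>

definition smooth_family :: "(nat \<Rightarrow> nat \<Rightarrow> real^2 \<Rightarrow> real) \<Rightarrow> bool" where
  "smooth_family K \<longleftrightarrow>
     (\<forall>a b x. (K a b has_derivative (\<lambda>d. d $ 1 * K (Suc a) b x + d $ 2 * K a (Suc b) x)) (at x))"

lemma smooth_familyD:
  "smooth_family K \<Longrightarrow> (K a b has_derivative (\<lambda>d. d $ 1 * K (Suc a) b x + d $ 2 * K a (Suc b) x)) (at x)"
  by (simp add: smooth_family_def)

lemma smooth_family_continuous_on:
  assumes "smooth_family K" "continuous_on S f"
  shows "continuous_on S (\<lambda>x. K a b (f x))"
proof -
  have "continuous_on UNIV (K a b)"
    using has_derivative_continuous[OF smooth_familyD[OF assms(1)]]
    by (simp add: continuous_on_eq_continuous_at)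
  then show ?thesis
    by (rule continuous_on_compose2[OF _ assms(2)]) auto
qed

lemma smooth_family_frechet_derivative:
  "smooth_family K \<Longrightarrow>
     frechet_derivative (K a b) (at x) d = d $ 1 * K (Suc a) b x + d $ 2 * K a (Suc b) x"
  using frechet_derivative_at[OF smooth_familyD, of K a b x] by metis

text \<open>A directional derivative of a member is a linear combination of two members, so the
  induction on \<open>k\<close> runs over all indices simultaneously.\<close>

lemma smooth_family_C_k: "smooth_family K \<Longrightarrow> C_k k (K a b)"
proof (induction k arbitrary: a b)
  case 0
  then show ?case using smooth_family_continuous_on[OF _ continuous_on_id] by simp
next
  case (Suc k)
  have "K a b differentiable (at x)" for x
    using smooth_familyD[OF Suc.prems] by (rule differentiableI)
  moreover have "C_k k (\<lambda>x. frechet_derivative (K a b) (at x) d)" for d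
    using Suc by (simp add: smooth_family_frechet_derivative C_k_linear_combination)
  ultimately show ?case by simp
qed

lemma smooth_family_test_function:
  assumes K: "smooth_family K" and S: "compact S" "S \<subseteq> \<Omega>" and 0: "\<And>x. x \<notin> S \<Longrightarrow> K a b x = 0"
  shows "K a b \<in> test_functions \<Omega>"
proof -
  have *: "closure {x. K a b x \<noteq> 0} \<subseteq> S"
    using 0 S by (intro closure_minimal) (auto simp: compact_imp_closed)
  have "compact (closure {x. K a b x \<noteq> 0})"
    using compact_Int_closed[OF S(1) closed_closure, of "{x. K a b x \<noteq> 0}"] *
    by (simp add: Int_absorb1)
  then show ?thesis
    using * S smooth_family_C_k[OF K] by (auto simp: test_functions_def)
qed

lemma smooth_family_tensor:
  assumes "derivative_sequence A" "derivative_sequence B"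
  shows "smooth_family (\<lambda>a b x. A a (x $ 1) * B b (x $ 2))"
proof -
  have "((\<lambda>x::real^2. A a (x $ i)) has_derivative (\<lambda>d. d $ i * A (Suc a) (x $ i))) (at x)"
    if "derivative_sequence A" for A a i x
  proof -
    have "(A a has_derivative (\<lambda>t. t * A (Suc a) (x $ i))) (at (x $ i))"
      using that unfolding derivative_sequence_def has_field_derivative_def
      by (metis (no_types, lifting) ext mult.commute)
    then show ?thesis
      by (rule has_derivative_compose[rotated])
        (intro bounded_linear_imp_has_derivative bounded_linear_vec_nth)
  qed
  from has_derivative_mult[OF this[OF assms(1), of _ 1] this[OF assms(2), of _ 2]]
  show ?thesis
    unfolding smooth_family_def
    by (auto elim!: has_derivative_eq_rhs simp: algebra_simps)
qed

text \<open>One chain rule for two purposes: a positive \<delta> rescales the kernel, a negative one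
  also reflects it in the convolution variable.\<close>

lemma smooth_family_affine:
  assumes "smooth_family K"
  shows "smooth_family (\<lambda>a b x. c * \<delta> ^ (a + b) * K a b (z + \<delta> *\<^sub>R x))"
  unfolding smooth_family_def
proof (intro allI)
  fix a b and x :: "real^2"
  have "((\<lambda>x. z + \<delta> *\<^sub>R x) has_derivative (\<lambda>d. \<delta> *\<^sub>R d)) (at x)"
    by (auto intro!: derivative_eq_intros)
  from has_derivative_compose[OF this smooth_familyD[OF assms, of a b]]
  have "((\<lambda>x. K a b (z + \<delta> *\<^sub>R x)) has_derivative
      (\<lambda>d. \<delta> * (d $ 1 * K (Suc a) b (z + \<delta> *\<^sub>R x) + d $ 2 * K a (Suc b) (z + \<delta> *\<^sub>R x)))) (at x)"
    by (simp add: algebra_simps)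
  from has_derivative_mult_right[OF this, of "c * \<delta> ^ (a + b)"]
  show "((\<lambda>x. c * \<delta> ^ (a + b) * K a b (z + \<delta> *\<^sub>R x)) has_derivative
      (\<lambda>d. d $ 1 * (c * \<delta> ^ (Suc a + b) * K (Suc a) b (z + \<delta> *\<^sub>R x)) +
           d $ 2 * (c * \<delta> ^ (a + Suc b) * K a (Suc b) (z + \<delta> *\<^sub>R x)))) (at x)"
    by (simp add: algebra_simps)
qed

text \<open>Only derivatives along coordinate lines are recorded. This is what integration by parts
  uses, and it treats real functions and vector-valued maps alike.\<close>

definition has_partial :: "2 \<Rightarrow> (real^2 \<Rightarrow> 'b::real_normed_vector) \<Rightarrow> (real^2 \<Rightarrow> 'b) \<Rightarrow> bool" where
  "has_partial i f g \<longleftrightarrow> (\<forall>x. ((\<lambda>t. f (x + t *\<^sub>R axis i 1)) has_vector_derivative g x) (at 0))"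

lemma has_partial_line:
  assumes "has_partial i f g"
  shows "((\<lambda>t. f (x + t *\<^sub>R axis i 1)) has_vector_derivative g (x + s *\<^sub>R axis i 1)) (at s)"
proof -
  have "((\<lambda>t. f ((x + s *\<^sub>R axis i 1) + t *\<^sub>R axis i 1)) has_vector_derivative
      g (x + s *\<^sub>R axis i 1)) (at (s - s))"
    using assms by (simp add: has_partial_def)
  from vector_diff_chain_at[of "\<lambda>t. t - s" 1 s, OF _ this]
  have "((\<lambda>t. f (x + s *\<^sub>R axis i 1 + (t - s) *\<^sub>R axis i 1)) has_vector_derivative
      g (x + s *\<^sub>R axis i 1)) (at s)"
    by (simp add: o_def has_vector_derivative_diff_const)
  then show ?thesis
    by (simp add: algebra_simps)
qed

lemma smooth_family_has_partial:
  assumes "smooth_family K"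
  shows "has_partial 1 (K a b) (K (Suc a) b)" "has_partial 2 (K a b) (K a (Suc b))"
proof -
  have "((\<lambda>t. K a b (x + t *\<^sub>R axis i 1)) has_vector_derivative
      axis i 1 $ 1 * K (Suc a) b x + axis i 1 $ 2 * K a (Suc b) x) (at 0)" for i :: 2 and x
  proof -
    have "((\<lambda>t. x + t *\<^sub>R axis i (1::real)) has_derivative (\<lambda>t. t *\<^sub>R axis i 1)) (at 0)"
      by (auto intro!: derivative_eq_intros)
    moreover have "(K a b has_derivative (\<lambda>d. d $ 1 * K (Suc a) b x + d $ 2 * K a (Suc b) x))
        (at (x + 0 *\<^sub>R axis i 1))"
      using smooth_familyD[OF assms] by simp
    ultimately show ?thesis
      unfolding has_vector_derivative_def
      by (rule has_derivative_eq_rhs[OF has_derivative_compose]) (auto simp: algebra_simps)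
  qed
  from this[of _ 1] this[of _ 2]
  show "has_partial 1 (K a b) (K (Suc a) b)" "has_partial 2 (K a b) (K a (Suc b))"
    by (auto simp: has_partial_def axis_def)
qed

section \<open>Integrals of compactly supported functions and of their partial derivatives\<close>

lemma integrable_lborel_compact_support:
  fixes f :: "'a::euclidean_space \<Rightarrow> 'b::{banach, second_countable_topology}"
  assumes "continuous_on UNIV f" "\<And>x. x \<notin> cbox p q \<Longrightarrow> f x = 0"
  shows "integrable lborel f"
proof -
  have "set_integrable lborel (cbox p q) f"
    unfolding set_integrable_def
    by (intro borel_integrable_compact compact_cbox continuous_on_subset[OF assms(1)]) auto
  moreover have "indicator (cbox p q) x *\<^sub>R f x = f x" for x
    using assms(2) by (auto simp: indicator_def)
  ultimately show ?thesis
    by (simp add: set_integrable_def)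
qed

lemma continuous_compact_support_bounded:
  fixes f :: "'a::euclidean_space \<Rightarrow> 'b::real_normed_vector"
  assumes "continuous_on UNIV f" "\<And>x. x \<notin> cbox p q \<Longrightarrow> f x = 0"
  obtains C where "C \<ge> 0" "\<And>x. norm (f x) \<le> C"
proof -
  have "compact (f ` cbox p q)"
    by (intro compact_continuous_image continuous_on_subset[OF assms(1)]) auto
  then obtain C where "\<And>x. x \<in> cbox p q \<Longrightarrow> norm (f x) \<le> C"
    by (meson compact_imp_bounded bounded_iff imageI)
  then have "norm (f x) \<le> max C 0" for x
    by (cases "x \<in> cbox p q") (auto simp: assms(2) intro: max.coboundedI1)
  then show thesis by (intro that[of "max C 0"]) auto
qed

lemma integral_lborel_translation:
  fixes f :: "'a::euclidean_space \<Rightarrow> 'b::{banach, second_countable_topology}"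
  assumes "f \<in> borel_measurable borel"
  shows "(LINT x|lborel. f (c + x)) = (LINT x|lborel. f x)"
proof -
  have "(LINT x|lborel. f x) = (LINT x|distr lborel borel ((+) c). f x)"
    by (simp add: lborel_distr_plus)
  also have "\<dots> = (LINT x|lborel. f (c + x))"
    using assms by (intro integral_distr) auto
  finally show ?thesis by simp
qed

lemma integrable_lborel_translation:
  fixes f :: "'a::euclidean_space \<Rightarrow> 'b::{banach, second_countable_topology}"
  assumes "integrable lborel f"
  shows "integrable lborel (\<lambda>x. f (c + x))"
proof -
  have "integrable (distr lborel borel ((+) c)) f"
    using assms by (simp add: lborel_distr_plus)
  then show ?thesis
    using assms by (subst (asm) integrable_distr_eq) auto
qed

text \<open>Translation invariance makes the integral of every difference quotient zero; the
  quotients are bounded by the mean value theorem, and dominated convergence passes to the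
  derivative.\<close>

lemma integral_partial_eq_0:
  fixes f :: "real^2 \<Rightarrow> real"
  assumes f: "has_partial i f g" and cont: "continuous_on UNIV f" "continuous_on UNIV g"
    and f0: "\<And>x. x \<notin> cbox p q \<Longrightarrow> f x = 0"
  shows "(LINT x|lborel. g x) = 0"
proof -
  define e where "e = (axis i 1 :: real^2)"
  have [simp]: "norm e = 1" by (simp add: e_def norm_axis_1)
  \<comment> \<open>Outside the closed box \<open>f\<close> vanishes in a whole neighbourhood, so
    its directional derivative vanishes too.\<close>
  have g0: "g x = 0" if "x \<notin> cbox p q" for x
  proof -
    have "eventually (\<lambda>t. x + t *\<^sub>R e \<in> - cbox p q) (nhds 0)"
    proof (rule topological_tendstoD)
      show "((\<lambda>t. x + t *\<^sub>R e) \<longlongrightarrow> x + 0 *\<^sub>R e) (nhds 0)"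
        by (intro tendsto_intros filterlim_ident)
    qed (use that in auto)
    then have "eventually (\<lambda>t. f (x + t *\<^sub>R e) = 0) (nhds 0)"
      by eventually_elim (auto intro: f0)
    moreover have "((\<lambda>t. f (x + t *\<^sub>R e)) has_real_derivative g x) (at 0)"
      using f by (simp add: has_partial_def e_def has_real_derivative_iff_has_vector_derivative)
    ultimately have "((\<lambda>t. 0) has_real_derivative g x) (at 0)"
      using DERIV_cong_ev[OF refl, of "\<lambda>t. f (x + t *\<^sub>R e)" "\<lambda>t. 0" 0] by blast
    then show ?thesis using DERIV_unique DERIV_const by blast
  qed
  obtain C where C: "C \<ge> 0" "\<And>x. norm (g x) \<le> C"
    using continuous_compact_support_bounded[OF cont(2) g0] by metis
  define d where "d n = inverse (real (Suc n))" for n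
  have d: "0 < d n" "d n \<le> 1" for n
    by (auto simp: d_def inverse_le_1_iff)
  have lip: "\<bar>f (x + t *\<^sub>R e) - f x\<bar> \<le> C * t" if "t > 0" for x t
  proof -
    have "\<exists>z. 0 < z \<and> z < t \<and> f (x + t *\<^sub>R e) - f (x + 0 *\<^sub>R e) = (t - 0) * g (x + z *\<^sub>R e)"
      using has_partial_line[OF f] that
      by (intro MVT2) (auto simp: e_def has_real_derivative_iff_has_vector_derivative)
    then obtain z where "f (x + t *\<^sub>R e) - f x = t * g (x + z *\<^sub>R e)" by auto
    then show ?thesis
      using C(2)[of "x + z *\<^sub>R e"] that by (simp add: abs_mult mult.commute)
  qed
  have f_int: "integrable lborel f" 
    by (rule integrable_lborel_compact_support[OF cont(1) f0])
  have f_meas: "f \<in> borel_measurable borel"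
    using cont(1) by (rule borel_measurable_continuous_onI)
  have zero: "(LINT x|lborel. (f (x + d n *\<^sub>R e) - f x) / d n) = 0" for n
  proof -
    have "integrable lborel (\<lambda>x. f (x + d n *\<^sub>R e))"
      using integrable_lborel_translation[OF f_int, of "d n *\<^sub>R e"] by (simp add: add.commute)
    then have "(LINT x|lborel. (f (x + d n *\<^sub>R e) - f x) / d n)
        = ((LINT x|lborel. f (x + d n *\<^sub>R e)) - (LINT x|lborel. f x)) / d n"
      using f_int by simp
    also have "(LINT x|lborel. f (x + d n *\<^sub>R e)) = (LINT x|lborel. f x)"
      using integral_lborel_translation[OF f_meas, of "d n *\<^sub>R e"] by (simp add: add.commute)
    finally show ?thesis by simp
  qed
  \<comment> \<open>Difference quotients with step at most 1 live on the box enlarged by 1 in every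
    direction; the dominating function is supported there.\<close>
  define P where "P = p - One" 
  define Q where "Q = q + One"
  have PQ: "x \<in> cbox P Q" if "x + t *\<^sub>R e \<in> cbox p q" "0 \<le> t" "t \<le> 1" for x t
  proof -
    have "\<bar>(t *\<^sub>R e) \<bullet> b\<bar> \<le> 1" if "b \<in> Basis" for b
      using that \<open>0 \<le> t\<close> \<open>t \<le> 1\<close> Basis_le_norm[OF that, of e]
      by (simp add: abs_mult mult_le_one)
    then show ?thesis
      using that unfolding mem_box P_def Q_def
      by (fastforce simp: inner_add_left inner_diff_left abs_le_iff)
  qed
  have "(\<lambda>n. LINT x|lborel. (f (x + d n *\<^sub>R e) - f x) / d n) \<longlonglongrightarrow> (LINT x|lborel. g x)"
  proof (rule integral_dominated_convergence[where w="\<lambda>x. indicator (cbox P Q) x * C"])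
    show "integrable lborel (\<lambda>x. indicator (cbox P Q) x * C)"
      by (intro integrable_mult_left integrable_real_indicator) (auto simp: emeasure_lborel_cbox_eq)
    have "(\<lambda>n. (f (x + d n *\<^sub>R e) - f x) / d n) \<longlonglongrightarrow> g x" for x
    proof -
      have "((\<lambda>h. (f (x + h *\<^sub>R e) - f x) / h) \<longlongrightarrow> g x) (at 0)"
        using f by (simp add: has_partial_def e_def DERIV_def
            flip: has_real_derivative_iff_has_vector_derivative)
      moreover have "filterlim d (at 0) sequentially"
        using d LIMSEQ_inverse_real_of_nat unfolding d_def
        by (auto simp: filterlim_at intro!: always_eventually)
      ultimately show ?thesis by (rule filterlim_compose)
    qed
    then show "AE x in lborel. (\<lambda>n. (f (x + d n *\<^sub>R e) - f x) / d n) \<longlonglongrightarrow> g x" by simp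
    have "norm ((f (x + d n *\<^sub>R e) - f x) / d n) \<le> indicator (cbox P Q) x * C" for x n
    proof (cases "x \<in> cbox P Q")
      case True
      then show ?thesis
        using lip[of "d n" x] d[of n] by (simp add: divide_le_eq)
    next
      case False
      then have "x + d n *\<^sub>R e \<notin> cbox p q" "x + 0 *\<^sub>R e \<notin> cbox p q"
        using PQ[of x "d n"] PQ[of x 0] d[of n] by auto
      then show ?thesis using f0 False by simp
    qed
    then show "AE x in lborel. norm ((f (x + d n *\<^sub>R e) - f x) / d n) \<le> indicator (cbox P Q) x * C" for n
      by simp
  next
    show "g \<in> borel_measurable lborel"
      using borel_measurable_continuous_onI[OF cont(2)] by simp
    show "(\<lambda>x. (f (x + d n *\<^sub>R e) - f x) / d n) \<in> borel_measurable lborel" for n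
      using f_meas by simp
  qed
  then show ?thesis
    unfolding zero by (simp add: LIMSEQ_const_iff)
qed

subsection \<open>Vectors almost normal to an orthonormal pair\<close>

text \<open>Expansion of an inner product in the frame e, f, e x f, multiplied by the Gram
  determinant of e and f to clear denominators. It is exact for all vectors and becomes Parseval's
  identity when e and f are orthonormal.\<close>

lemma gram_identity_R3:
  fixes x a e f :: "real^3"
  defines "\<nu> \<equiv> cross3 e f"
  shows "((e \<bullet> e) * (f \<bullet> f) - (e \<bullet> f)\<^sup>2) * (x \<bullet> a) =
    (x \<bullet> \<nu>) * (a \<bullet> \<nu>) + (f \<bullet> f) * ((x \<bullet> e) * (a \<bullet> e)) + (e \<bullet> e) * ((x \<bullet> f) * (a \<bullet> f))
      - (e \<bullet> f) * ((x \<bullet> e) * (a \<bullet> f) + (x \<bullet> f) * (a \<bullet> e))"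
  by (simp add: \<nu>_def cross3_simps power2_eq_square)

text \<open>In \<open>gram_identity_R3\<close> the Gram determinant differs from 1 by at most 3
  \<delta>, and four further coefficients differ from their orthonormal values by at most \<delta>
  each; hence the factor 7.\<close>

lemma inner_almost_orthonormal:
  fixes x a e f :: "real^3"
  assumes e: "norm e \<le> 1" and f: "norm f \<le> 1"
    and \<delta>: "\<bar>e \<bullet> e - 1\<bar> \<le> \<delta>" "\<bar>f \<bullet> f - 1\<bar> \<le> \<delta>" "\<bar>e \<bullet> f\<bar> \<le> \<delta>"
  shows "\<bar>x \<bullet> a - (x \<bullet> (cross3 e f)) * (a \<bullet> (cross3 e f)) - (x \<bullet> e) * (a \<bullet> e) - (x \<bullet> f) * (a \<bullet> f)\<bar>
    \<le> 7 * \<delta> * (norm x * norm a)"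
proof -
  define N where "N = norm x * norm a"
  have N: "N \<ge> 0" by (simp add: N_def)
  have "\<delta> \<ge> 0" using \<delta>(1) by linarith
  have b: "\<bar>(x \<bullet> g) * (a \<bullet> h)\<bar> \<le> N" if "norm g \<le> 1" "norm h \<le> 1" for g h
  proof -
    have "\<bar>x \<bullet> g\<bar> \<le> norm x" "\<bar>a \<bullet> h\<bar> \<le> norm a"
      using Cauchy_Schwarz_ineq2[of x g] Cauchy_Schwarz_ineq2[of a h] that
      by (meson mult_left_le norm_ge_zero order_trans)+
    then show ?thesis by (simp add: abs_mult N_def mult_mono)
  qed
  have xa: "\<bar>x \<bullet> a\<bar> \<le> N" using Cauchy_Schwarz_ineq2 by (simp add: N_def)
  have ee: "0 \<le> e \<bullet> e" "e \<bullet> e \<le> 1"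
    using e by (auto simp: power2_norm_eq_inner[symmetric] power_le_one)
  have ef1: "\<bar>e \<bullet> f\<bar> \<le> 1"
    using Cauchy_Schwarz_ineq2[of e f] e f mult_le_one[of "norm e" "norm f"] by simp
  have det: "\<bar>1 - ((e \<bullet> e) * (f \<bullet> f) - (e \<bullet> f)\<^sup>2)\<bar> \<le> 3 * \<delta>"
  proof -
    have "1 - ((e \<bullet> e) * (f \<bullet> f) - (e \<bullet> f)\<^sup>2) = - (e \<bullet> e) * (f \<bullet> f - 1) - (e \<bullet> e - 1) + (e \<bullet> f) * (e \<bullet> f)"
      by (simp add: algebra_simps power2_eq_square)
    moreover have "\<bar>(e \<bullet> e) * (f \<bullet> f - 1)\<bar> \<le> 1 * \<delta>"
      unfolding abs_mult using ee \<delta> by (intro mult_mono) auto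
    moreover have "\<bar>(e \<bullet> f) * (e \<bullet> f)\<bar> \<le> 1 * \<delta>"
      unfolding abs_mult using ef1 \<delta> by (intro mult_mono) auto
    ultimately show ?thesis using \<delta>(1) by linarith
  qed
  have "x \<bullet> a - (x \<bullet> (cross3 e f)) * (a \<bullet> (cross3 e f)) - (x \<bullet> e) * (a \<bullet> e) - (x \<bullet> f) * (a \<bullet> f)
     = (1 - ((e \<bullet> e) * (f \<bullet> f) - (e \<bullet> f)\<^sup>2)) * (x \<bullet> a) + (f \<bullet> f - 1) * ((x \<bullet> e) * (a \<bullet> e))
       + (e \<bullet> e - 1) * ((x \<bullet> f) * (a \<bullet> f))
       - (e \<bullet> f) * ((x \<bullet> e) * (a \<bullet> f)) - (e \<bullet> f) * ((x \<bullet> f) * (a \<bullet> e))"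
    using gram_identity_R3[of e f x a] by (simp add: algebra_simps)
  moreover have "\<bar>(1 - ((e \<bullet> e) * (f \<bullet> f) - (e \<bullet> f)\<^sup>2)) * (x \<bullet> a)\<bar> \<le> 3 * \<delta> * N"
    unfolding abs_mult using det xa \<open>\<delta> \<ge> 0\<close> by (intro mult_mono) auto
  moreover have "\<bar>(f \<bullet> f - 1) * ((x \<bullet> e) * (a \<bullet> e))\<bar> \<le> \<delta> * N"
    using b[OF e e] \<delta> \<open>\<delta> \<ge> 0\<close> unfolding abs_mult[of "f \<bullet> f - 1"] by (intro mult_mono) auto
  moreover have "\<bar>(e \<bullet> e - 1) * ((x \<bullet> f) * (a \<bullet> f))\<bar> \<le> \<delta> * N"
    using b[OF f f] \<delta> \<open>\<delta> \<ge> 0\<close> unfolding abs_mult[of "e \<bullet> e - 1"] by (intro mult_mono) auto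
  moreover have "\<bar>(e \<bullet> f) * ((x \<bullet> e) * (a \<bullet> f))\<bar> \<le> \<delta> * N"
    using b[OF e f] \<delta> \<open>\<delta> \<ge> 0\<close> unfolding abs_mult[of "e \<bullet> f"] by (intro mult_mono) auto
  moreover have "\<bar>(e \<bullet> f) * ((x \<bullet> f) * (a \<bullet> e))\<bar> \<le> \<delta> * N"
    using b[OF f e] \<delta> \<open>\<delta> \<ge> 0\<close> unfolding abs_mult[of "e \<bullet> f"] by (intro mult_mono) auto
  ultimately show ?thesis
    unfolding N_def[symmetric] by (simp add: algebra_simps)
qed

lemma abs_mult_diff_le:
  fixes p q p' q' :: real
  assumes "\<bar>p - p'\<bar> \<le> \<epsilon>1" "\<bar>q - q'\<bar> \<le> \<epsilon>2" "\<bar>q\<bar> \<le> M" "\<bar>p'\<bar> \<le> M'"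
  shows "\<bar>p * q - p' * q'\<bar> \<le> \<epsilon>1 * M + M' * \<epsilon>2"
proof -
  have "p * q - p' * q' = (p - p') * q + p' * (q - q')" by (simp add: algebra_simps)
  moreover have "\<bar>(p - p') * q\<bar> \<le> \<epsilon>1 * M" "\<bar>p' * (q - q')\<bar> \<le> M' * \<epsilon>2"
    unfolding abs_mult using assms by (intro mult_mono; linarith)+
  ultimately show ?thesis by linarith
qed

text \<open>If the three vectors \<open>a, b, c\<close> were exactly normal to an orthonormal pair \<open>e, f\<close>, both sides
  would be the square of the normal component of \<open>v\<close> times the same determinant.\<close>

lemma normal_determinant_estimate:
  fixes v e f a b c :: "real^3"
  assumes v: "norm v \<le> 1" and e: "norm e \<le> 1" and f: "norm f \<le> 1"
    and \<delta>: "\<bar>e \<bullet> e - 1\<bar> \<le> \<delta>" "\<bar>f \<bullet> f - 1\<bar> \<le> \<delta>" "\<bar>e \<bullet> f\<bar> \<le> \<delta>"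
    and L: "norm a \<le> L" "norm b \<le> L" "norm c \<le> L" and \<kappa>L: "\<kappa> \<le> L"
    and \<kappa>: "\<bar>a \<bullet> e\<bar> \<le> \<kappa>" "\<bar>a \<bullet> f\<bar> \<le> \<kappa>" "\<bar>b \<bullet> e\<bar> \<le> \<kappa>" "\<bar>b \<bullet> f\<bar> \<le> \<kappa>"
      "\<bar>c \<bullet> e\<bar> \<le> \<kappa>" "\<bar>c \<bullet> f\<bar> \<le> \<kappa>"
  shows "\<bar>((v \<bullet> a) * (v \<bullet> b) - (v \<bullet> c)\<^sup>2)
      - (v \<bullet> v - (v \<bullet> e)\<^sup>2 - (v \<bullet> f)\<^sup>2) * (a \<bullet> b - c \<bullet> c)\<bar> \<le> 12 * L * \<kappa> + 56 * \<delta> * L\<^sup>2"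
proof -
  define \<nu> where "\<nu> = cross3 e f"
  \<comment> \<open>The error in replacing \<open>v \<bullet> z\<close>, for z among a, b, c, by the
    product of the normal components: two tangential products, and the defect of the frame. For two
    of the vectors a, b, c it is \<open>L * p\<close>.\<close>
  define p where "p = 2 * \<kappa> + 7 * \<delta> * L"
  have L0: "L \<ge> 0" "\<kappa> \<ge> 0" "\<delta> \<ge> 0"
    using L(1) \<kappa>(1) \<delta>(1) norm_ge_zero[of a] by linarith+
  then have p0: "p \<ge> 0" by (simp add: p_def)
  have \<nu>: "norm \<nu> \<le> 1"
  proof -
    have "(norm \<nu>)\<^sup>2 \<le> (norm e * norm f)\<^sup>2"
      using norm_cross_dot[of e f] zero_le_power2[of "e \<bullet> f"] unfolding \<nu>_def by linarith
    also have "\<dots> \<le> 1"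
      using e f by (simp add: mult_le_one power_le_one)
    finally show ?thesis by (simp add: power_le_one_iff)
  qed
  have inner_le: "\<bar>x \<bullet> y\<bar> \<le> X * Y" if "norm x \<le> X" "norm y \<le> Y" for x y :: "real^3" and X Y
    using Cauchy_Schwarz_ineq2[of x y] that
    by (meson mult_mono norm_ge_zero order_trans)
  have \<kappa>2: "\<bar>s * t\<bar> \<le> X * \<kappa>" if "\<bar>s\<bar> \<le> X" "\<bar>t\<bar> \<le> \<kappa>" for s t X
    unfolding abs_mult using that by (intro mult_mono) auto
  have vz: "\<bar>v \<bullet> z - (v \<bullet> \<nu>) * (z \<bullet> \<nu>)\<bar> \<le> p"
    if "norm z \<le> L" "\<bar>z \<bullet> e\<bar> \<le> \<kappa>" "\<bar>z \<bullet> f\<bar> \<le> \<kappa>" for z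
  proof -
    have "7 * \<delta> * (norm v * norm z) \<le> 7 * \<delta> * (1 * L)"
      using v that L0 by (intro mult_left_mono mult_mono) auto
    moreover have "\<bar>(v \<bullet> e) * (z \<bullet> e)\<bar> \<le> 1 * \<kappa>" "\<bar>(v \<bullet> f) * (z \<bullet> f)\<bar> \<le> 1 * \<kappa>"
      using inner_le[OF v e] inner_le[OF v f] that by (intro \<kappa>2; simp)+
    ultimately show ?thesis
      using inner_almost_orthonormal[OF e f \<delta>, of v z] unfolding \<nu>_def p_def by linarith
  qed
  have yz: "\<bar>y \<bullet> z - (y \<bullet> \<nu>) * (z \<bullet> \<nu>)\<bar> \<le> L * p"
    if "norm z \<le> L" "\<bar>z \<bullet> e\<bar> \<le> \<kappa>" "\<bar>z \<bullet> f\<bar> \<le> \<kappa>"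
       "norm y \<le> L" "\<bar>y \<bullet> e\<bar> \<le> \<kappa>" "\<bar>y \<bullet> f\<bar> \<le> \<kappa>" for y z
  proof -
    have "7 * \<delta> * (norm y * norm z) \<le> 7 * \<delta> * (L * L)"
      using that L0 by (intro mult_left_mono mult_mono) auto
    moreover have "\<bar>(y \<bullet> e) * (z \<bullet> e)\<bar> \<le> L * \<kappa>" "\<bar>(y \<bullet> f) * (z \<bullet> f)\<bar> \<le> L * \<kappa>"
      using that \<kappa>L by (intro \<kappa>2; linarith)+
    moreover have "L * p = 2 * (L * \<kappa>) + 7 * \<delta> * (L * L)" by (simp add: p_def algebra_simps)
    ultimately show ?thesis
      using inner_almost_orthonormal[OF e f \<delta>, of y z] unfolding \<nu>_def by linarith
  qed
  have vn: "\<bar>v \<bullet> \<nu>\<bar> \<le> 1" using inner_le[OF v \<nu>] by simp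
  have zn: "\<bar>z \<bullet> \<nu>\<bar> \<le> L" if "norm z \<le> L" for z using inner_le[OF that \<nu>] by simp
  have vzL: "\<bar>v \<bullet> z\<bar> \<le> L" if "norm z \<le> L" for z using inner_le[OF v that] by simp
  have vnzn: "\<bar>(v \<bullet> \<nu>) * (z \<bullet> \<nu>)\<bar> \<le> L" if "norm z \<le> L" for z
    using mult_mono[OF vn zn[OF that]] by (simp add: abs_mult)
  have P: "\<bar>(v \<bullet> y) * (v \<bullet> z) - ((v \<bullet> \<nu>) * (y \<bullet> \<nu>)) * ((v \<bullet> \<nu>) * (z \<bullet> \<nu>))\<bar> \<le> p * L + L * p"
    if "norm z \<le> L" "\<bar>z \<bullet> e\<bar> \<le> \<kappa>" "\<bar>z \<bullet> f\<bar> \<le> \<kappa>"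
       "norm y \<le> L" "\<bar>y \<bullet> e\<bar> \<le> \<kappa>" "\<bar>y \<bullet> f\<bar> \<le> \<kappa>" for y z
    using that by (intro abs_mult_diff_le vz vzL vnzn)
  define \<Delta> where "\<Delta> = (a \<bullet> \<nu>) * (b \<bullet> \<nu>) - (c \<bullet> \<nu>) * (c \<bullet> \<nu>)"
  define D where "D = a \<bullet> b - c \<bullet> c"
  define \<zeta> where "\<zeta> = v \<bullet> v - (v \<bullet> e)\<^sup>2 - (v \<bullet> f)\<^sup>2"
  have "\<bar>((v \<bullet> a) * (v \<bullet> b) - (v \<bullet> c)\<^sup>2) - (v \<bullet> \<nu>)\<^sup>2 * \<Delta>\<bar> \<le> 4 * L * p"
  proof -
    have "(v \<bullet> \<nu>)\<^sup>2 * \<Delta> = ((v \<bullet> \<nu>) * (a \<bullet> \<nu>)) * ((v \<bullet> \<nu>) * (b \<bullet> \<nu>)) - ((v \<bullet> \<nu>) * (c \<bullet> \<nu>)) * ((v \<bullet> \<nu>) * (c \<bullet> \<nu>))"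
      by (simp add: \<Delta>_def algebra_simps power2_eq_square)
    then show ?thesis
      using P[of b a] P[of c c] \<kappa> L by (simp add: power2_eq_square[of "v \<bullet> c"] algebra_simps)
  qed
  moreover have "\<bar>\<zeta> * D - (v \<bullet> \<nu>)\<^sup>2 * \<Delta>\<bar> \<le> 7 * \<delta> * (2 * L\<^sup>2) + 1 * (2 * L * p)"
  proof (rule abs_mult_diff_le)
    have "7 * \<delta> * (norm v * norm v) \<le> 7 * \<delta> * 1"
      using v L0 by (intro mult_left_mono mult_le_one) auto
    then show "\<bar>\<zeta> - (v \<bullet> \<nu>)\<^sup>2\<bar> \<le> 7 * \<delta>"
      using inner_almost_orthonormal[OF e f \<delta>, of v v]
      unfolding \<zeta>_def \<nu>_def power2_eq_square by linarith
    show "\<bar>D - \<Delta>\<bar> \<le> 2 * L * p"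
      using yz[of b a] yz[of c c] \<kappa> L unfolding D_def \<Delta>_def by linarith
    have "\<bar>a \<bullet> b\<bar> \<le> L * L" "\<bar>c \<bullet> c\<bar> \<le> L * L"
      using L by (intro inner_le; simp)+
    then show "\<bar>D\<bar> \<le> 2 * L\<^sup>2" unfolding D_def power2_eq_square by linarith
    show "\<bar>(v \<bullet> \<nu>)\<^sup>2\<bar> \<le> 1" using vn by (simp add: abs_square_le_1)
  qed
  \<comment> \<open>Six copies of \<open>L * p\<close> give 12 L \<kappa> and 42 \<delta> L^2;
    exchanging \<zeta> for the squared normal component gives the other 14 \<delta> L^2.\<close>
  moreover have "4 * L * p + (7 * \<delta> * (2 * L\<^sup>2) + 1 * (2 * L * p)) = 12 * L * \<kappa> + 56 * \<delta> * L\<^sup>2"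
    by (simp add: p_def algebra_simps power2_eq_square)
  ultimately show ?thesis
    unfolding \<zeta>_def D_def by linarith
qed

subsection \<open>Averages of an orthonormal frame\<close>

text \<open>Used in two ways: with \<open>s\<close> the oscillation and \<open>t\<close> a fixed
  scale it trades a mean square for a mean cube; with \<open>s\<close> a fixed mean and
  \<open>t\<close> the oscillation it is the tangent line inequality behind Jensen's inequality for
  cubes.\<close>

lemma cubic_moment_inequality:
  fixes s t :: real
  assumes "s \<ge> 0" "t \<ge> 0"
  shows "3 * t * s\<^sup>2 \<le> 2 * s ^ 3 + t ^ 3"
proof -
  have "2 * s ^ 3 + t ^ 3 - 3 * t * s\<^sup>2 = (s - t)\<^sup>2 * (2 * s + t)"
    by (simp add: algebra_simps power2_eq_square power3_eq_cube)
  then show ?thesis using assms by (smt (verit) zero_le_power2 mult_nonneg_nonneg)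
qed

definition moment :: "'a::euclidean_space set \<Rightarrow> ('a \<Rightarrow> real) \<Rightarrow> nat \<Rightarrow> real" where
  "moment S f j = (LINT y|lborel. indicator S y * f y ^ j) / measure lborel S"

locale bounded_density =
  fixes S :: "'a::euclidean_space set" and f :: "'a \<Rightarrow> real" and M :: real
  assumes S_meas: "S \<in> sets borel" and S_pos: "measure lborel S > 0"
    and f_meas: "f \<in> borel_measurable borel" and f_nonneg: "\<And>y. 0 \<le> f y" and f_le: "\<And>y. f y \<le> M"
begin

lemma S_finite: "emeasure lborel S < \<infinity>"
  using S_pos by (metis enn2real_top infinity_ennreal_def less_irrefl measure_def top.not_eq_extremum)

lemma M_nonneg: "0 \<le> M"
  using f_nonneg f_le order_trans by blast

lemma integrable_power: "integrable lborel (\<lambda>y. indicator S y * f y ^ j)"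
proof (rule integrableI_bounded_set[where A=S and B="M ^ j"])
  show "S \<in> sets lborel" using S_meas by simp
  show "(\<lambda>y. indicator S y * f y ^ j) \<in> borel_measurable lborel"
    using S_meas f_meas by simp
  show "emeasure lborel S < \<infinity>" by (rule S_finite)
  have "norm (indicator S y * f y ^ j) \<le> M ^ j" for y
    using power_mono[OF f_le f_nonneg, of y j] f_nonneg[of y] M_nonneg by (auto simp: indicator_def)
  then show "AE y in lborel. y \<in> S \<longrightarrow> norm (indicator S y * f y ^ j) \<le> M ^ j"
    by (intro always_eventually) blast
qed auto

lemma moment_nonneg: "0 \<le> moment S f j"
  using f_nonneg by (auto simp: moment_def intro!: divide_nonneg_nonneg integral_nonneg)

text \<open>The moment inequalities below are averages of pointwise inequalities between powers of
  \<open>f\<close>; the coefficients may themselves be moments.\<close>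

lemma moment_bound:
  assumes "\<And>y. \<alpha> * f y ^ i \<le> \<beta> * f y ^ j + \<gamma>"
  shows "\<alpha> * moment S f i \<le> \<beta> * moment S f j + \<gamma>"
proof -
  let ?V = "measure lborel S"
  have ind: "integrable lborel (\<lambda>y. indicator S y * \<gamma>)"
    using S_meas S_finite by (intro integrable_mult_left integrable_real_indicator) auto
  have "\<alpha> * (LINT y|lborel. indicator S y * f y ^ i) = (LINT y|lborel. indicator S y * (\<alpha> * f y ^ i))"
    by (subst integral_mult_right_zero[symmetric]) (simp add: mult_ac)
  also have "\<dots> \<le> (LINT y|lborel. \<beta> * (indicator S y * f y ^ j) + indicator S y * \<gamma>)"
  proof (rule integral_mono)
    have "integrable lborel (\<lambda>y. \<alpha> * (indicator S y * f y ^ i))"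
      by (intro integrable_mult_right integrable_power)
    then show "integrable lborel (\<lambda>y. indicator S y * (\<alpha> * f y ^ i))" by (simp add: mult_ac)
    show "integrable lborel (\<lambda>y. \<beta> * (indicator S y * f y ^ j) + indicator S y * \<gamma>)"
      by (intro Bochner_Integration.integrable_add integrable_mult_right integrable_power ind)
    show "indicator S y * (\<alpha> * f y ^ i) \<le> \<beta> * (indicator S y * f y ^ j) + indicator S y * \<gamma>" for y
      using assms[of y] by (auto simp: indicator_def)
  qed
  also have "\<dots> = \<beta> * (LINT y|lborel. indicator S y * f y ^ j) + \<gamma> * ?V"
    using ind integrable_power S_meas S_finite by (simp add: mult.commute)
  finally show ?thesis
    using S_pos by (simp add: moment_def field_simps)
qed

lemma moment_1_le: "moment S f 1 \<le> M"
  using moment_bound[of 1 1 0 1 M] f_le by simp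

lemma moment_2_le: "moment S f 2 \<le> M * moment S f 1"
  using moment_bound[of 1 2 M 1 0] mult_right_mono[OF f_le f_nonneg] by (simp add: power2_eq_square)

lemma moment_1_square_le: "(moment S f 1)\<^sup>2 \<le> moment S f 2"
proof -
  let ?A = "moment S f 1"
  have "(2 * ?A) * f y ^ 1 \<le> 1 * f y ^ 2 + ?A\<^sup>2" for y
    using zero_le_power2[of "f y - ?A"] by (simp add: power2_eq_square algebra_simps)
  from moment_bound[OF this] show ?thesis by (simp add: power2_eq_square)
qed

lemma moment_scale: "t \<ge> 0 \<Longrightarrow> 3 * t * moment S f 2 \<le> 2 * moment S f 3 + t ^ 3"
  by (rule moment_bound) (use cubic_moment_inequality f_nonneg in auto)

text \<open>With A the first moment, the tangent line inequality at A gives A^3 <= m_3, and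
  \<open>moment_scale\<close> at t = A gives 3 A m_2 <= 2 m_3 + A^3.\<close>

lemma moment_12_le: "moment S f 1 * moment S f 2 \<le> moment S f 3"
proof -
  let ?A = "moment S f 1"
  have A: "?A \<ge> 0" by (rule moment_nonneg)
  have "(3 * ?A\<^sup>2) * f y ^ 1 \<le> 1 * f y ^ 3 + 2 * ?A ^ 3" for y
    using cubic_moment_inequality[OF A f_nonneg[of y]] by (simp add: mult_ac)
  from moment_bound[OF this] have "?A ^ 3 \<le> moment S f 3"
    by (simp add: power2_eq_square power3_eq_cube algebra_simps)
  with moment_scale[OF A] show ?thesis by simp
qed

lemma weighted_bounds:
  fixes g :: "'a \<Rightarrow> 'b::{banach, second_countable_topology}"
  assumes q: "q \<in> borel_measurable borel" "\<And>y. \<bar>q y\<bar> \<le> B * indicator S y"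
    and g: "g \<in> borel_measurable borel" "\<And>y. norm (g y) \<le> A * f y ^ j"
  shows "integrable lborel (\<lambda>y. q y *\<^sub>R g y)"
    and "norm (LINT y|lborel. q y *\<^sub>R g y) \<le> A * B * measure lborel S * moment S f j"
proof -
  have int: "integrable lborel (\<lambda>y. (A * B) * (indicator S y * f y ^ j))"
    by (intro integrable_mult_right integrable_power)
  have bd: "norm (q y *\<^sub>R g y) \<le> A * B * (indicator S y * f y ^ j)" for y
  proof -
    have "norm (q y *\<^sub>R g y) \<le> (B * indicator S y) * (A * f y ^ j)"
      unfolding norm_scaleR by (intro mult_mono q g) (use q(2)[of y] in auto)
    then show ?thesis by (simp add: mult_ac)
  qed
  show int': "integrable lborel (\<lambda>y. q y *\<^sub>R g y)"
  proof (rule Bochner_Integration.integrable_bound[OF int])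
    show "(\<lambda>y. q y *\<^sub>R g y) \<in> borel_measurable lborel" using q g by simp
  qed (intro always_eventually allI order_trans[OF bd], simp)
  have "norm (LINT y|lborel. q y *\<^sub>R g y) \<le> (LINT y|lborel. (A * B) * (indicator S y * f y ^ j))"
    by (intro order_trans[OF integral_norm_bound] integral_mono integrable_norm int int' bd)
  also have "\<dots> = A * B * measure lborel S * moment S f j"
    using S_pos by (simp add: moment_def)
  finally show "norm (LINT y|lborel. q y *\<^sub>R g y) \<le> A * B * measure lborel S * moment S f j" .
qed

end

text \<open>The Constantin--E--Titi commutator trick: for an orthonormal frame \<open>H1, H2\<close> the averages of
  \<open>(H i - H i x) \<bullet> H j x + (H j - H j x) \<bullet> H i x = - (H i - H i x) \<bullet> (H j - H j x)\<close> are quadratic in the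
  oscillation.\<close>

locale frame_average =
  fixes H1 H2 :: "'a::euclidean_space \<Rightarrow> 'b::euclidean_space" and S :: "'a set" and x :: 'a
    and \<epsilon> C :: real and q0 q1 q2 :: "'a \<Rightarrow> real"
  assumes H_meas: "H1 \<in> borel_measurable borel" "H2 \<in> borel_measurable borel"
    and H_frame: "\<And>y. H1 y \<bullet> H1 y = 1" "\<And>y. H2 y \<bullet> H2 y = 1" "\<And>y. H1 y \<bullet> H2 y = 0"
    and S: "S \<in> sets borel" "measure lborel S = \<epsilon>\<^sup>2" and eps: "0 < \<epsilon>" "\<epsilon> \<le> 1" and C: "1 \<le> C"
    and q_meas: "q0 \<in> borel_measurable borel" "q1 \<in> borel_measurable borel" "q2 \<in> borel_measurable borel"
    and q_le: "\<And>y. \<bar>q0 y\<bar> \<le> C / \<epsilon>\<^sup>2 * indicator S y" "\<And>y. \<bar>q1 y\<bar> \<le> C / \<epsilon> ^ 3 * indicator S y"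
      "\<And>y. \<bar>q2 y\<bar> \<le> C / \<epsilon> ^ 3 * indicator S y"
    and q0_nonneg: "\<And>y. 0 \<le> q0 y"
    and q_int: "(LINT y|lborel. q0 y) = 1" "(LINT y|lborel. q1 y) = 0" "(LINT y|lborel. q2 y) = 0"
begin

definition osc :: "'a \<Rightarrow> real" where
  "osc y = norm (H1 y - H1 x) + norm (H2 y - H2 x)"

lemma norm_H: "norm (H1 y) = 1" "norm (H2 y) = 1"
  by (simp_all add: norm_eq_sqrt_inner H_frame)

sublocale bounded_density S osc 4
proof
  show "osc y \<le> 4" for y
    using norm_triangle_ineq4[of "H1 y" "H1 x"] norm_triangle_ineq4[of "H2 y" "H2 x"]
    by (simp add: osc_def norm_H)
qed (use S eps H_meas in \<open>auto simp: osc_def[abs_def]\<close>)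

abbreviation "m \<equiv> moment S osc"

text \<open>The Boolean index lets each estimate be proved once for all index pairs.\<close>

definition H :: "bool \<Rightarrow> 'a \<Rightarrow> 'b" where "H i = (if i then H1 else H2)"

lemma H_meas' [measurable]: "H i \<in> borel_measurable borel"
  using H_meas by (simp add: H_def)

lemma H_inner: "H i y \<bullet> H j y = (if i = j then 1 else 0)"
  using H_frame by (auto simp: H_def inner_commute)

lemma H_diff_le: "norm (H i y - H i x) \<le> osc y"
  by (auto simp: H_def osc_def)

definition avg :: "('a \<Rightarrow> real) \<Rightarrow> bool \<Rightarrow> 'b" where
  "avg q i = (LINT y|lborel. q y *\<^sub>R H i y)"

definition dev :: "('a \<Rightarrow> real) \<Rightarrow> bool \<Rightarrow> 'b" where
  "dev q i = (LINT y|lborel. q y *\<^sub>R (H i y - H i x))"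

text \<open>The constant \<open>B\<close> covers both the mollifier, with B = C, and its first
  derivatives, with B = C / \<epsilon>. A deviation is of first order in the oscillation; only the
  symmetrized combination is of second order.\<close>

lemma
  assumes q: "q \<in> borel_measurable borel" "\<And>y. \<bar>q y\<bar> \<le> B / \<epsilon>\<^sup>2 * indicator S y"
  shows norm_dev_le: "norm (dev q i) \<le> B * m 1"
    and avg_eq: "avg q i = (LINT y|lborel. q y) *\<^sub>R H i x + dev q i"
    and dev_symmetrized: "\<bar>H j x \<bullet> dev q i + H i x \<bullet> dev q j\<bar> \<le> B * m 2"
proof -
  have int: "integrable lborel (\<lambda>y. q y *\<^sub>R (H i y - H i x))" for i
    by (rule weighted_bounds[where A=1 and j=1, OF q]) (use H_diff_le in auto)
  show "norm (dev q i) \<le> B * m 1"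
    using weighted_bounds(2)[where A=1 and j=1, OF q, of "\<lambda>y. H i y - H i x"] H_diff_le eps
    by (auto simp: dev_def S)
  have "integrable lborel (\<lambda>y. q y *\<^sub>R (1::real))"
    by (rule weighted_bounds[where A=1 and j=0, OF q]) auto
  then have q_int: "integrable lborel q" by simp
  have "avg q i = (LINT y|lborel. q y *\<^sub>R H i x + q y *\<^sub>R (H i y - H i x))"
    by (simp add: avg_def algebra_simps)
  also have "\<dots> = (LINT y|lborel. q y) *\<^sub>R H i x + dev q i"
    unfolding dev_def using int q_int by (subst Bochner_Integration.integral_add) auto
  finally show "avg q i = (LINT y|lborel. q y) *\<^sub>R H i x + dev q i" .
  have "H j x \<bullet> dev q i + H i x \<bullet> dev q j
      = (LINT y|lborel. H j x \<bullet> (q y *\<^sub>R (H i y - H i x)) + H i x \<bullet> (q y *\<^sub>R (H j y - H j x)))"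
    unfolding dev_def using int by (simp del: inner_scaleR_right)
  also have "\<dots> = (LINT y|lborel. q y *\<^sub>R (- ((H i y - H i x) \<bullet> (H j y - H j x))))"
    by (intro Bochner_Integration.integral_cong refl)
      (auto simp: H_inner inner_commute algebra_simps)
  also have "\<bar>\<dots>\<bar> \<le> B * m 2"
  proof -
    have "norm (- ((H i y - H i x) \<bullet> (H j y - H j x))) \<le> 1 * osc y ^ 2" for y
      using Cauchy_Schwarz_ineq2[of "H i y - H i x" "H j y - H j x"] H_diff_le[of i y] H_diff_le[of j y]
        mult_mono[OF H_diff_le[of i y] H_diff_le[of j y]] f_nonneg[of y]
      by (simp add: power2_eq_square)
    from weighted_bounds(2)[OF q _ this] show ?thesis
      using eps by (simp add: S)
  qed
  finally show "\<bar>H j x \<bullet> dev q i + H i x \<bullet> dev q j\<bar> \<le> B * m 2" .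
qed

lemma dev_product_le:
  fixes p p' :: 'b
  assumes "norm p \<le> A * m 1" "norm p' \<le> B * m 1" "0 \<le> A" "0 \<le> B"
  shows "\<bar>p \<bullet> p'\<bar> \<le> A * B * m 2"
proof -
  have "\<bar>p \<bullet> p'\<bar> \<le> norm p * norm p'" by (rule Cauchy_Schwarz_ineq2)
  also have "\<dots> \<le> (A * m 1) * (B * m 1)"
    by (intro mult_mono assms mult_nonneg_nonneg moment_nonneg norm_ge_zero)
  also have "\<dots> = A * B * (m 1)\<^sup>2" by (simp add: power2_eq_square)
  also have "\<dots> \<le> A * B * m 2"
    using assms by (intro mult_left_mono moment_1_square_le) auto
  finally show ?thesis .
qed

lemma norm_avg_q0_le: "norm (avg q0 i) \<le> 1"
proof -
  have "integrable lborel (\<lambda>y. q0 y *\<^sub>R (1::real))"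
    by (rule weighted_bounds[where A=1 and j=0, OF q_meas(1) q_le(1)]) auto
  then have "norm (avg q0 i) \<le> (LINT y|lborel. q0 y)"
    unfolding avg_def using q0_nonneg norm_H
    by (intro order_trans[OF integral_norm_bound]) (auto simp: H_def)
  then show ?thesis by (simp add: q_int)
qed

lemma C_le_square: "C \<le> C * C"
  using mult_left_mono[of 1 C C] C by linarith

text \<open>Expanded around \<open>x\<close>, the linear terms of the product form exactly the
  symmetrized combination, so the metric defect is quadratic although each deviation is only
  linear.\<close>

lemma avg_metric: "\<bar>avg q0 i \<bullet> avg q0 j - (if i = j then 1 else 0)\<bar> \<le> 2 * C\<^sup>2 * m 2"
proof -
  note q = q_meas(1) q_le(1)
  have P: "\<bar>dev q0 i \<bullet> dev q0 j\<bar> \<le> C * C * m 2"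
    by (rule dev_product_le[OF norm_dev_le[OF q] norm_dev_le[OF q]]) (use C in auto)
  have eq: "avg q0 i \<bullet> avg q0 j - (if i = j then 1 else 0)
      = (H j x \<bullet> dev q0 i + H i x \<bullet> dev q0 j) + dev q0 i \<bullet> dev q0 j"
    unfolding avg_eq[OF q] q_int by (simp add: algebra_simps H_inner inner_commute)
  have "\<bar>(H j x \<bullet> dev q0 i + H i x \<bullet> dev q0 j) + dev q0 i \<bullet> dev q0 j\<bar> \<le> C * m 2 + C * C * m 2"
    using dev_symmetrized[OF q, of j i] P by linarith
  also have "\<dots> \<le> C * C * m 2 + C * C * m 2"
    using mult_right_mono[OF C_le_square moment_nonneg[of 2]] by linarith
  finally show ?thesis unfolding eq by (simp add: power2_eq_square)
qed

context
  fixes q assumes q: "q \<in> borel_measurable borel" "\<And>y. \<bar>q y\<bar> \<le> C / \<epsilon> ^ 3 * indicator S y"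
    "(LINT y|lborel. q y) = 0"
begin

lemma q_le': "\<bar>q y\<bar> \<le> (C / \<epsilon>) / \<epsilon>\<^sup>2 * indicator S y"
  using q(2)[of y] by (simp add: power2_eq_square power3_eq_cube)

text \<open>A kernel of integral zero annihilates the constant \<open>H i x\<close>, so only the
  deviation survives.\<close>

lemma avg_eq_dev: "avg q i = dev q i"
  using avg_eq[OF q(1) q_le'] q(3) by simp

lemma norm_avg_le: "norm (avg q i) \<le> C / \<epsilon> * m 1"
  using norm_dev_le[OF q(1) q_le'] by (simp add: avg_eq_dev)

text \<open>When \<open>q\<close> is a partial derivative of the mollifier, the left-hand side is
  that partial derivative of an entry of the mollified metric: still quadratic in the oscillation,
  at the cost of one factor 1/\<epsilon>.\<close>

lemma avg_symmetrized: "\<bar>avg q i \<bullet> avg q0 j + avg q j \<bullet> avg q0 i\<bar> \<le> 3 * C\<^sup>2 * m 2 / \<epsilon>"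
proof -
  note q0 = q_meas(1) q_le(1)
  have P: "\<bar>dev q i \<bullet> dev q0 j\<bar> \<le> (C / \<epsilon>) * C * m 2" for i j
    by (rule dev_product_le[OF norm_dev_le[OF q(1) q_le'] norm_dev_le[OF q0]]) (use C eps in auto)
  have eq: "avg q i \<bullet> avg q0 j + avg q j \<bullet> avg q0 i
     = (H j x \<bullet> dev q i + H i x \<bullet> dev q j) + dev q i \<bullet> dev q0 j + dev q j \<bullet> dev q0 i"
    unfolding avg_eq_dev avg_eq[OF q0] q_int by (simp add: algebra_simps inner_commute)
  have "\<bar>(H j x \<bullet> dev q i + H i x \<bullet> dev q j) + dev q i \<bullet> dev q0 j + dev q j \<bullet> dev q0 i\<bar>
      \<le> C / \<epsilon> * m 2 + (C / \<epsilon>) * C * m 2 + (C / \<epsilon>) * C * m 2"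
    using dev_symmetrized[OF q(1) q_le', of j i] P[of i j] P[of j i] by linarith
  also have "\<dots> \<le> (C / \<epsilon>) * C * m 2 + (C / \<epsilon>) * C * m 2 + (C / \<epsilon>) * C * m 2"
  proof -
    have "C / \<epsilon> \<le> C / \<epsilon> * C"
      using C_le_square eps by (simp add: divide_right_mono)
    from mult_right_mono[OF this moment_nonneg[of 2]] show ?thesis by linarith
  qed
  finally show ?thesis unfolding eq by (simp add: power2_eq_square)
qed

lemma avg_diagonal: "\<bar>avg q i \<bullet> avg q0 i\<bar> \<le> 3 * C\<^sup>2 * m 2 / \<epsilon>"
  using avg_symmetrized[of i i] by linarith

end

end

subsection \<open>The curvature error\<close>

text \<open>With \<eta> = |v|^2 / 2, the local names are the squared normal component \<zeta> of v,
  the Hessian \<open>n11\<close>, \<open>n12\<close>, \<open>n22\<close> of \<eta>, and the gradient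
  of \<zeta>. For an isometric immersion every summand vanishes: second derivatives are normal to
  the surface, and the last bracket compares det(D^2 \<eta> - I) with \<zeta> times the Gauss
  curvature. The first two summands are left over when that curvature is integrated by parts against
  \<phi> \<zeta>.\<close>

definition curvature_error ::
  "real \<Rightarrow> real \<Rightarrow> real \<Rightarrow> 'b::real_inner \<Rightarrow> 'b \<Rightarrow> 'b \<Rightarrow> 'b \<Rightarrow> 'b \<Rightarrow> 'b \<Rightarrow> real" where
  "curvature_error \<phi> \<phi>1 \<phi>2 v v1 v2 v11 v12 v22 =
    (let \<zeta> = v \<bullet> v - (v \<bullet> v1)\<^sup>2 - (v \<bullet> v2)\<^sup>2;
         n11 = v1 \<bullet> v1 + v \<bullet> v11; n12 = v1 \<bullet> v2 + v \<bullet> v12; n22 = v2 \<bullet> v2 + v \<bullet> v22;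
         \<zeta>1 = 2 * (v \<bullet> v1) - 2 * (v \<bullet> v1) * n11 - 2 * (v \<bullet> v2) * n12;
         \<zeta>2 = 2 * (v \<bullet> v2) - 2 * (v \<bullet> v1) * n12 - 2 * (v \<bullet> v2) * n22
     in (\<phi>1 * \<zeta> + \<phi> * \<zeta>1) * (v12 \<bullet> v2) - (\<phi>2 * \<zeta> + \<phi> * \<zeta>2) * (v11 \<bullet> v2)
        + \<phi> * (((n11 - 1) * (n22 - 1) - n12\<^sup>2) - \<zeta> * (v11 \<bullet> v22 - v12 \<bullet> v12)))"

lemma abs_mult_le:
  fixes s t :: real
  shows "\<bar>s\<bar> \<le> A \<Longrightarrow> \<bar>t\<bar> \<le> B \<Longrightarrow> \<bar>s * t\<bar> \<le> A * B"
  unfolding abs_mult by (intro mult_mono) auto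

lemma abs_inner_le:
  fixes x y :: "'b::real_inner"
  shows "norm x \<le> X \<Longrightarrow> norm y \<le> Y \<Longrightarrow> \<bar>x \<bullet> y\<bar> \<le> X * Y"
  using Cauchy_Schwarz_ineq2[of x y] by (meson mult_mono norm_ge_zero order_trans)

text \<open>The vectors \<open>a\<close>, \<open>c\<close>, \<open>b\<close> stand for v11, v12,
  v22; \<delta> measures the metric defect, \<kappa> the tangential components of the second
  derivatives and \<open>L\<close> their full size. No term of the bound is a power of
  \<open>L\<close> alone: each carries a factor \<kappa> or \<delta>.\<close>

lemma curvature_error_le:
  fixes v e f a b c :: "real^3"
  assumes v: "norm v \<le> 1" and e: "norm e \<le> 1" and f: "norm f \<le> 1"
    and \<delta>: "\<bar>e \<bullet> e - 1\<bar> \<le> \<delta>" "\<bar>f \<bullet> f - 1\<bar> \<le> \<delta>" "\<bar>e \<bullet> f\<bar> \<le> \<delta>"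
    and L: "norm a \<le> L" "norm b \<le> L" "norm c \<le> L" and \<kappa>L: "\<kappa> \<le> L"
    and \<kappa>: "\<bar>a \<bullet> e\<bar> \<le> \<kappa>" "\<bar>a \<bullet> f\<bar> \<le> \<kappa>" "\<bar>b \<bullet> e\<bar> \<le> \<kappa>" "\<bar>b \<bullet> f\<bar> \<le> \<kappa>"
      "\<bar>c \<bullet> e\<bar> \<le> \<kappa>" "\<bar>c \<bullet> f\<bar> \<le> \<kappa>"
    and \<phi>: "\<bar>\<phi>\<bar> \<le> \<Phi>" "\<bar>\<phi>1\<bar> \<le> \<Phi>" "\<bar>\<phi>2\<bar> \<le> \<Phi>"
  shows "\<bar>curvature_error \<phi> \<phi>1 \<phi>2 v e f a c b\<bar>
    \<le> \<Phi> * (18 * \<kappa> + 20 * (L * \<kappa>) + 56 * (\<delta> * L\<^sup>2) + 4 * (\<delta> * L) + 2 * \<delta>)"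
proof -
  define \<zeta> where "\<zeta> = v \<bullet> v - (v \<bullet> e)\<^sup>2 - (v \<bullet> f)\<^sup>2"
  define n11 where "n11 = e \<bullet> e + v \<bullet> a"
  define n12 where "n12 = e \<bullet> f + v \<bullet> c"
  define n22 where "n22 = f \<bullet> f + v \<bullet> b"
  define \<zeta>1 where "\<zeta>1 = 2 * (v \<bullet> e) - 2 * (v \<bullet> e) * n11 - 2 * (v \<bullet> f) * n12"
  define \<zeta>2 where "\<zeta>2 = 2 * (v \<bullet> f) - 2 * (v \<bullet> e) * n12 - 2 * (v \<bullet> f) * n22"
  have pos: "L \<ge> 0" "\<kappa> \<ge> 0" "\<delta> \<ge> 0" "\<Phi> \<ge> 0"
    using L(1) \<kappa>(1) \<delta>(1) \<phi>(1) norm_ge_zero[of a] by linarith+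
  have one: "\<bar>v \<bullet> v\<bar> \<le> 1" "\<bar>v \<bullet> e\<bar> \<le> 1" "\<bar>v \<bullet> f\<bar> \<le> 1" "\<bar>e \<bullet> e\<bar> \<le> 1" "\<bar>e \<bullet> f\<bar> \<le> 1" "\<bar>f \<bullet> f\<bar> \<le> 1"
    using abs_inner_le[OF v v] abs_inner_le[OF v e] abs_inner_le[OF v f]
      abs_inner_le[OF e e] abs_inner_le[OF e f] abs_inner_le[OF f f] by auto
  have s: "\<bar>v \<bullet> a\<bar> \<le> L" "\<bar>v \<bullet> b\<bar> \<le> L" "\<bar>v \<bullet> c\<bar> \<le> L"
    using abs_inner_le[OF v L(1)] abs_inner_le[OF v L(2)] abs_inner_le[OF v L(3)] by auto
  have n: "\<bar>n11\<bar> \<le> 1 + L" "\<bar>n12\<bar> \<le> 1 + L" "\<bar>n22\<bar> \<le> 1 + L"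
    unfolding n11_def n12_def n22_def using one s by linarith+
  have \<zeta>3: "\<bar>\<zeta>\<bar> \<le> 3"
    using one(1) abs_mult_le[OF one(2) one(2)] abs_mult_le[OF one(3) one(3)]
    unfolding \<zeta>_def power2_eq_square by linarith
  have tri: "\<bar>2 * a - 2 * b - 2 * c\<bar> \<le> 6 + 4 * L" if "\<bar>a\<bar> \<le> 1" "\<bar>b\<bar> \<le> 1 * (1 + L)" "\<bar>c\<bar> \<le> 1 * (1 + L)"
    for a b c :: real
    using that by simp
  have z1: "\<bar>\<zeta>1\<bar> \<le> 6 + 4 * L"
    unfolding \<zeta>1_def mult.assoc by (intro tri abs_mult_le one n)
  have z2: "\<bar>\<zeta>2\<bar> \<le> 6 + 4 * L"
    unfolding \<zeta>2_def mult.assoc by (intro tri abs_mult_le one n)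
  have w1: "\<bar>\<phi>1 * \<zeta> + \<phi> * \<zeta>1\<bar> \<le> \<Phi> * (9 + 4 * L)"
    using abs_mult_le[OF \<phi>(2) \<zeta>3] abs_mult_le[OF \<phi>(1) z1] by (simp add: algebra_simps)
  have w2: "\<bar>\<phi>2 * \<zeta> + \<phi> * \<zeta>2\<bar> \<le> \<Phi> * (9 + 4 * L)"
    using abs_mult_le[OF \<phi>(3) \<zeta>3] abs_mult_le[OF \<phi>(1) z2] by (simp add: algebra_simps)
  have t1: "\<bar>(\<phi>1 * \<zeta> + \<phi> * \<zeta>1) * (c \<bullet> f)\<bar> \<le> \<Phi> * (9 + 4 * L) * \<kappa>"
    by (rule abs_mult_le[OF w1 \<kappa>(6)])
  have t2: "\<bar>(\<phi>2 * \<zeta> + \<phi> * \<zeta>2) * (a \<bullet> f)\<bar> \<le> \<Phi> * (9 + 4 * L) * \<kappa>"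
    by (rule abs_mult_le[OF w2 \<kappa>(2)])
  \<comment> \<open>The two symmetric matrices differ by the metric defect, so the difference of
    their determinants is a sum of products that each contain a factor bounded by \<delta>.\<close>
  have det: "\<bar>((n11 - 1) * (n22 - 1) - n12\<^sup>2) - ((v \<bullet> a) * (v \<bullet> b) - (v \<bullet> c)\<^sup>2)\<bar> \<le> 4 * (\<delta> * L) + 2 * \<delta>"
  proof -
    have gen: "\<bar>p + q + r - 2 * s - t\<bar> \<le> 4 * (\<delta> * L) + 2 * \<delta>"
      if "\<bar>p\<bar> \<le> L * \<delta>" "\<bar>q\<bar> \<le> \<delta> * L" "\<bar>r\<bar> \<le> \<delta> * 1" "\<bar>s\<bar> \<le> L * \<delta>" "\<bar>t\<bar> \<le> \<delta> * 1" for p q r s t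
      using that by (simp add: mult.commute)
    have "((n11 - 1) * (n22 - 1) - n12\<^sup>2) - ((v \<bullet> a) * (v \<bullet> b) - (v \<bullet> c)\<^sup>2)
      = (v \<bullet> a) * (f \<bullet> f - 1) + (e \<bullet> e - 1) * (v \<bullet> b) + (e \<bullet> e - 1) * (f \<bullet> f - 1)
        - 2 * ((v \<bullet> c) * (e \<bullet> f)) - (e \<bullet> f) * (e \<bullet> f)"
      unfolding n11_def n12_def n22_def by (simp add: algebra_simps power2_eq_square)
    moreover have "\<bar>f \<bullet> f - 1\<bar> \<le> 1"
      using one(6) inner_ge_zero[of f] by simp
    ultimately show ?thesis
      by (simp only:) (intro gen abs_mult_le s \<delta> one)
  qed
  have "\<bar>((n11 - 1) * (n22 - 1) - n12\<^sup>2) - \<zeta> * (a \<bullet> b - c \<bullet> c)\<bar>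
      \<le> 12 * L * \<kappa> + 56 * \<delta> * L\<^sup>2 + (4 * (\<delta> * L) + 2 * \<delta>)"
    using normal_determinant_estimate[OF v e f \<delta> L \<kappa>L \<kappa>] det unfolding \<zeta>_def by linarith
  from abs_mult_le[OF \<phi>(1) this]
  have t3: "\<bar>\<phi> * (((n11 - 1) * (n22 - 1) - n12\<^sup>2) - \<zeta> * (a \<bullet> b - c \<bullet> c))\<bar>
      \<le> \<Phi> * (12 * L * \<kappa> + 56 * \<delta> * L\<^sup>2 + (4 * (\<delta> * L) + 2 * \<delta>))" .
  have "curvature_error \<phi> \<phi>1 \<phi>2 v e f a c b
    = (\<phi>1 * \<zeta> + \<phi> * \<zeta>1) * (c \<bullet> f) - (\<phi>2 * \<zeta> + \<phi> * \<zeta>2) * (a \<bullet> f)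
        + \<phi> * (((n11 - 1) * (n22 - 1) - n12\<^sup>2) - \<zeta> * (a \<bullet> b - c \<bullet> c))"
    unfolding curvature_error_def Let_def \<zeta>_def \<zeta>1_def \<zeta>2_def n11_def n12_def n22_def ..
  \<comment> \<open>Here 18 = 2 * 9 and 20 = 2 * 4 + 12: two terms with derivatives of \<phi>
    \<zeta>, and the normal determinant estimate.\<close>
  moreover have "\<Phi> * (9 + 4 * L) * \<kappa> + \<Phi> * (9 + 4 * L) * \<kappa>
      + \<Phi> * (12 * L * \<kappa> + 56 * \<delta> * L\<^sup>2 + (4 * (\<delta> * L) + 2 * \<delta>))
     = \<Phi> * (18 * \<kappa> + 20 * (L * \<kappa>) + 56 * (\<delta> * L\<^sup>2) + 4 * (\<delta> * L) + 2 * \<delta>)"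
    by (simp add: algebra_simps)
  ultimately show ?thesis
    using t1 t2 t3 by linarith
qed

text \<open>Products of \<open>L\<close> and \<kappa> meet m1 m2 <= m3. A lone \<kappa> is
  controlled by the scale inequality at t = \<epsilon>, which is the source of the summand
  \<epsilon> in \<mu>. In \<delta> L^2 the surplus factor m1 is at most 4. The coefficients add up
  to 261232, rounded up.\<close>

lemma error_scales:
  fixes m1 m2 m3 \<epsilon> C :: real
  assumes m: "0 \<le> m1" "0 \<le> m2" "m1 \<le> 4" "m1 * m2 \<le> m3" "3 * \<epsilon> * m2 \<le> 2 * m3 + \<epsilon> ^ 3"
    and \<epsilon>: "0 < \<epsilon>" "\<epsilon> \<le> 1" and C: "1 \<le> C"
  defines "L \<equiv> 24 * C\<^sup>2 * m1 / \<epsilon>" and "\<kappa> \<equiv> 6 * C\<^sup>2 * m2 / \<epsilon>" and "\<delta> \<equiv> 2 * C\<^sup>2 * m2"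
    and "\<mu> \<equiv> m3 / \<epsilon>\<^sup>2 + \<epsilon>"
  shows "18 * \<kappa> + 20 * (L * \<kappa>) + 56 * (\<delta> * L\<^sup>2) + 4 * (\<delta> * L) + 2 * \<delta> \<le> 300000 * C ^ 6 * \<mu>"
proof -
  have m3: "0 \<le> m3" using m mult_nonneg_nonneg[of m1 m2] by linarith
  have \<mu>0: "0 \<le> \<mu>" using m3 \<epsilon> by (simp add: \<mu>_def)
  have k: "m2 / \<epsilon> \<le> \<mu>"
  proof -
    have "m2 / \<epsilon> = (3 * \<epsilon> * m2) / (3 * \<epsilon>\<^sup>2)" using \<epsilon> by (simp add: power2_eq_square)
    also have "\<dots> \<le> (3 * m3 + 3 * \<epsilon> ^ 3) / (3 * \<epsilon>\<^sup>2)"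
      using m m3 \<epsilon> by (intro divide_right_mono) (auto intro: order_trans)
    also have "\<dots> = \<mu>" using \<epsilon> by (simp add: \<mu>_def field_simps power2_eq_square power3_eq_cube)
    finally show ?thesis .
  qed
  have p: "m1 * m2 / \<epsilon>\<^sup>2 \<le> \<mu>"
    using m \<epsilon> unfolding \<mu>_def by (smt (verit) divide_right_mono zero_le_power2)
  have d: "m2 \<le> \<mu>"
    using k \<epsilon> m by (smt (verit) divide_le_eq_1 le_divide_eq mult_left_le)
  have dl: "m1 * m2 / \<epsilon> \<le> \<mu>"
  proof -
    have "m1 * m2 / \<epsilon> \<le> m1 * m2 / \<epsilon>\<^sup>2"
      using m \<epsilon> by (intro divide_left_mono) (auto simp: power2_eq_square mult_left_le)
    with p show ?thesis by linarith
  qed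
  have Cp: "C ^ i \<le> C ^ 6" if "i \<le> 6" for i using C that by (simp add: power_increasing)
  have A: "c * C ^ i * t \<le> c * C ^ 6 * \<mu>" if "i \<le> 6" "t \<le> \<mu>" "0 \<le> c" for c i t
  proof -
    have "c * C ^ i * t \<le> c * C ^ i * \<mu>"
      using that C by (intro mult_left_mono) auto
    also have "\<dots> \<le> c * C ^ 6 * \<mu>"
      using Cp[OF that(1)] that \<mu>0 by (intro mult_right_mono mult_left_mono) auto
    finally show ?thesis .
  qed
  have "18 * \<kappa> = 108 * C ^ 2 * (m2 / \<epsilon>)" by (simp add: \<kappa>_def)
  also have "\<dots> \<le> 108 * C ^ 6 * \<mu>" by (intro A k) auto
  finally have 1: "18 * \<kappa> \<le> 108 * C ^ 6 * \<mu>" .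
  have "20 * (L * \<kappa>) = 2880 * C ^ 4 * (m1 * m2 / \<epsilon>\<^sup>2)"
    by (simp add: L_def \<kappa>_def power2_eq_square power4_eq_xxxx)
  also have "\<dots> \<le> 2880 * C ^ 6 * \<mu>" by (intro A p) auto
  finally have 2: "20 * (L * \<kappa>) \<le> 2880 * C ^ 6 * \<mu>" .
  have "56 * (\<delta> * L\<^sup>2) = 64512 * C ^ 6 * (m1 * (m1 * m2 / \<epsilon>\<^sup>2))"
    by (simp add: L_def \<delta>_def power2_eq_square eval_nat_numeral)
  also have "\<dots> \<le> 64512 * C ^ 6 * (4 * \<mu>)"
    using m p \<epsilon> C by (intro mult_left_mono mult_mono) auto
  finally have 3: "56 * (\<delta> * L\<^sup>2) \<le> 258048 * C ^ 6 * \<mu>" by simp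
  have "4 * (\<delta> * L) = 192 * C ^ 4 * (m1 * m2 / \<epsilon>)"
    by (simp add: L_def \<delta>_def power2_eq_square power4_eq_xxxx)
  also have "\<dots> \<le> 192 * C ^ 6 * \<mu>" by (intro A dl) auto
  finally have 4: "4 * (\<delta> * L) \<le> 192 * C ^ 6 * \<mu>" .
  have "2 * \<delta> = 4 * C ^ 2 * m2" by (simp add: \<delta>_def)
  also have "\<dots> \<le> 4 * C ^ 6 * \<mu>" by (intro A d) auto
  finally have 5: "2 * \<delta> \<le> 4 * C ^ 6 * \<mu>" .
  have "0 \<le> C ^ 6 * \<mu>" using C \<mu>0 by simp
  with 1 2 3 4 5 show ?thesis by linarith
qed

context frame_average
begin

text \<open>The formula for Christoffel symbols: v11 \<bullet> v2 is the first partial derivative of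
  v1 \<bullet> v2 minus half the second partial derivative of v1 \<bullet> v1, by the symmetry
  \<open>compat\<close> of the mixed derivative. Two terms with coefficient 3 give the 6. The 24
  makes the third inequality hold, since m 2 <= 4 m 1.\<close>

lemma avg_bounds:
  assumes compat: "avg q1 False = avg q2 True"
  shows "norm (avg q1 i) \<le> 24 * C\<^sup>2 * m 1 / \<epsilon>" "norm (avg q2 i) \<le> 24 * C\<^sup>2 * m 1 / \<epsilon>"
    "6 * C\<^sup>2 * m 2 / \<epsilon> \<le> 24 * C\<^sup>2 * m 1 / \<epsilon>"
    "\<bar>avg q1 i \<bullet> avg q0 j\<bar> \<le> 6 * C\<^sup>2 * m 2 / \<epsilon>" "\<bar>avg q2 i \<bullet> avg q0 j\<bar> \<le> 6 * C\<^sup>2 * m 2 / \<epsilon>"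
proof -
  note q1 = q_meas(2) q_le(2) q_int(2) and q2 = q_meas(3) q_le(3) q_int(3)
  have "C / \<epsilon> * m 1 \<le> 24 * C\<^sup>2 / \<epsilon> * m 1"
    using C C_le_square eps by (intro mult_right_mono moment_nonneg divide_right_mono) (auto simp: power2_eq_square)
  then show "norm (avg q1 i) \<le> 24 * C\<^sup>2 * m 1 / \<epsilon>" "norm (avg q2 i) \<le> 24 * C\<^sup>2 * m 1 / \<epsilon>"
    using norm_avg_le[OF q1, of i] norm_avg_le[OF q2, of i] by (auto simp: field_simps)
  have "6 * C\<^sup>2 * m 2 / \<epsilon> \<le> 6 * C\<^sup>2 * (4 * m 1) / \<epsilon>"
    using C eps by (intro divide_right_mono mult_left_mono moment_2_le) auto
  then show "6 * C\<^sup>2 * m 2 / \<epsilon> \<le> 24 * C\<^sup>2 * m 1 / \<epsilon>" by simp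
  have p: "0 \<le> 3 * C\<^sup>2 * m 2 / \<epsilon>" using eps moment_nonneg by simp
  have 1: "\<bar>avg q1 True \<bullet> avg q0 False\<bar> \<le> 6 * C\<^sup>2 * m 2 / \<epsilon>"
    using avg_symmetrized[OF q1, of True False] avg_diagonal[OF q2, of True]
    unfolding compat by (simp add: algebra_simps)
  have 2: "\<bar>avg q2 False \<bullet> avg q0 True\<bar> \<le> 6 * C\<^sup>2 * m 2 / \<epsilon>"
    using avg_symmetrized[OF q2, of True False] avg_diagonal[OF q1, of False]
    unfolding compat by (simp add: algebra_simps)
  show "\<bar>avg q1 i \<bullet> avg q0 j\<bar> \<le> 6 * C\<^sup>2 * m 2 / \<epsilon>"
    using 1 avg_diagonal[OF q1, of i] avg_diagonal[OF q2, of True] compat p by (cases i; cases j) auto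
  show "\<bar>avg q2 i \<bullet> avg q0 j\<bar> \<le> 6 * C\<^sup>2 * m 2 / \<epsilon>"
    using 2 avg_diagonal[OF q2, of i] avg_diagonal[OF q1, of False] compat p by (cases i; cases j) auto
qed

end

text \<open>Stated outside the locale because the normal direction is a cross product, which ties
  the target space to \<open>real^3\<close>.\<close>

lemma frame_average_curvature_error_le:
  fixes H1 H2 :: "'a::euclidean_space \<Rightarrow> real^3"
  assumes fa: "frame_average H1 H2 S \<epsilon> C q0 q1 q2"
    and compat: "(LINT y|lborel. q1 y *\<^sub>R H2 y) = (LINT y|lborel. q2 y *\<^sub>R H1 y)"
    and v: "norm v \<le> 1" and \<phi>: "\<bar>\<phi>\<bar> \<le> \<Phi>" "\<bar>\<phi>1\<bar> \<le> \<Phi>" "\<bar>\<phi>2\<bar> \<le> \<Phi>"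
  shows "\<bar>curvature_error \<phi> \<phi>1 \<phi>2 v (LINT y|lborel. q0 y *\<^sub>R H1 y) (LINT y|lborel. q0 y *\<^sub>R H2 y)
       (LINT y|lborel. q1 y *\<^sub>R H1 y) (LINT y|lborel. q1 y *\<^sub>R H2 y) (LINT y|lborel. q2 y *\<^sub>R H2 y)\<bar>
    \<le> \<Phi> * (300000 * C ^ 6 *
        (moment S (\<lambda>y. norm (H1 y - H1 x) + norm (H2 y - H2 x)) 3 / \<epsilon>\<^sup>2 + \<epsilon>))"
proof -
  interpret frame_average H1 H2 S x \<epsilon> C q0 q1 q2 by (rule fa)
  have avgs: "avg q True = (LINT y|lborel. q y *\<^sub>R H1 y)" "avg q False = (LINT y|lborel. q y *\<^sub>R H2 y)" for q
    by (simp_all add: avg_def H_def)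
  have osc: "(\<lambda>y. norm (H1 y - H1 x) + norm (H2 y - H2 x)) = osc"
    by (simp add: osc_def fun_eq_iff)
  have c: "avg q1 False = avg q2 True" using compat by (simp add: avgs)
  note B = avg_bounds[OF c]
  have "\<bar>curvature_error \<phi> \<phi>1 \<phi>2 v (avg q0 True) (avg q0 False) (avg q1 True) (avg q1 False) (avg q2 False)\<bar>
    \<le> \<Phi> * (18 * (6 * C\<^sup>2 * m 2 / \<epsilon>) + 20 * ((24 * C\<^sup>2 * m 1 / \<epsilon>) * (6 * C\<^sup>2 * m 2 / \<epsilon>))
        + 56 * ((2 * C\<^sup>2 * m 2) * (24 * C\<^sup>2 * m 1 / \<epsilon>)\<^sup>2) + 4 * ((2 * C\<^sup>2 * m 2) * (24 * C\<^sup>2 * m 1 / \<epsilon>))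
        + 2 * (2 * C\<^sup>2 * m 2))"
    using avg_metric[of True True] avg_metric[of False False] avg_metric[of True False]
    by (intro curvature_error_le v norm_avg_q0_le B \<phi>) auto
  also have "\<dots> \<le> \<Phi> * (300000 * C ^ 6 * (m 3 / \<epsilon>\<^sup>2 + \<epsilon>))"
    using \<phi>(1) eps C
    by (intro mult_left_mono error_scales moment_nonneg moment_1_le moment_12_le moment_scale) auto
  finally show ?thesis unfolding avgs osc .
qed

subsection \<open>The integral identity\<close>

text \<open>The derivative \<open>h\<close> enters through a pointwise equation, so that the product
  rule applies to formulas that are prescribed in simplified form.\<close>

lemma has_partial_inner:
  assumes "has_partial i f f'" "has_partial i g g'"
    and "\<And>x. h x = f x \<bullet> g' x + f' x \<bullet> g x"
  shows "has_partial i (\<lambda>x. f x \<bullet> g x) h"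
  using assms bounded_bilinear.has_vector_derivative[OF bounded_bilinear_inner]
  unfolding has_partial_def by fastforce

lemma has_partial_mult:
  fixes f g :: "real^2 \<Rightarrow> real"
  assumes "has_partial i f f'" "has_partial i g g'"
    and "\<And>x. h x = f x * g' x + f' x * g x"
  shows "has_partial i (\<lambda>x. f x * g x) h"
  using has_partial_inner[OF assms(1,2)] assms(3) by simp

lemma has_partial_add:
  assumes "has_partial i f f'" "has_partial i g g'" and "\<And>x. h x = f' x + g' x"
  shows "has_partial i (\<lambda>x. f x + g x) h"
  using assms unfolding has_partial_def by (auto intro!: has_vector_derivative_add)

lemma has_partial_diff:
  assumes "has_partial i f f'" "has_partial i g g'" and "\<And>x. h x = f' x - g' x"
  shows "has_partial i (\<lambda>x. f x - g x) h"
  using assms unfolding has_partial_def by (auto intro!: has_vector_derivative_diff)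

text \<open>The terms in the following identity come from \<open>\<eta> = \<bar>v\<bar>\<^sup>2 / 2\<close>:
  \<open>1 = \<Delta>\<eta> - det D\<^sup>2\<eta> + det (D\<^sup>2\<eta> - I)\<close>, where the first two terms are in divergence form and
  \<open>det (D\<^sup>2\<eta> - I)\<close> is, for an isometric immersion, \<open>\<zeta> (v11 \<bullet> v22 - v12 \<bullet> v12)\<close> with \<open>\<zeta>\<close> the squared normal component
  of \<open>v\<close>. The last factor is the Gauss curvature, again a divergence.\<close>

lemma integral_curvature_identity:
  fixes V :: "nat \<Rightarrow> nat \<Rightarrow> real^2 \<Rightarrow> 'b::real_inner" and K :: "nat \<Rightarrow> nat \<Rightarrow> real^2 \<Rightarrow> real"
  assumes V1: "\<And>a b. has_partial 1 (V a b) (V (Suc a) b)" and V2: "\<And>a b. has_partial 2 (V a b) (V a (Suc b))"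
    and V_cont: "\<And>a b. continuous_on UNIV (V a b)"
    and K: "smooth_family K" and K0: "\<And>a b x. x \<notin> cbox p q \<Longrightarrow> K a b x = 0"
  defines "\<eta>1 \<equiv> \<lambda>x. V 0 0 x \<bullet> V 1 0 x" and "\<eta>2 \<equiv> \<lambda>x. V 0 0 x \<bullet> V 0 1 x"
  defines "B \<equiv> \<lambda>x. K 1 0 x * \<eta>1 x + K 0 1 x * \<eta>2 x + K 1 1 x * (\<eta>1 x * \<eta>2 x)
      - K 2 0 x * (\<eta>2 x * \<eta>2 x) / 2 - K 0 2 x * (\<eta>1 x * \<eta>1 x) / 2"
    and "Err \<equiv> \<lambda>x. curvature_error (K 0 0 x) (K 1 0 x) (K 0 1 x)
      (V 0 0 x) (V 1 0 x) (V 0 1 x) (V 2 0 x) (V 1 1 x) (V 0 2 x)"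
  shows "(LINT x|lborel. K 0 0 x) = (LINT x|lborel. Err x - B x)"
    and "integrable lborel (\<lambda>x. Err x - B x)"
    and "x \<notin> cbox p q \<Longrightarrow> Err x - B x = 0"
proof -
  have K1: "has_partial 1 (K a b) (K (Suc a) b)" and K2: "has_partial 2 (K a b) (K a (Suc b))" for a b
    using smooth_family_has_partial[OF K] .
  have K_cont: "continuous_on UNIV (K a b)" for a b
    using smooth_family_continuous_on[OF K continuous_on_id] by simp
  define \<eta>11 where "\<eta>11 = (\<lambda>x. V 1 0 x \<bullet> V 1 0 x + V 0 0 x \<bullet> V 2 0 x)"
  define \<eta>12 where "\<eta>12 = (\<lambda>x. V 1 0 x \<bullet> V 0 1 x + V 0 0 x \<bullet> V 1 1 x)"
  define \<eta>22 where "\<eta>22 = (\<lambda>x. V 0 1 x \<bullet> V 0 1 x + V 0 0 x \<bullet> V 0 2 x)"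
  define \<eta>112 where "\<eta>112 = (\<lambda>x. 2 * (V 1 0 x \<bullet> V 1 1 x) + V 0 1 x \<bullet> V 2 0 x + V 0 0 x \<bullet> V 2 1 x)"
  define \<zeta> where "\<zeta> = (\<lambda>x. V 0 0 x \<bullet> V 0 0 x - \<eta>1 x * \<eta>1 x - \<eta>2 x * \<eta>2 x)"
  define \<zeta>1 where "\<zeta>1 = (\<lambda>x. 2 * \<eta>1 x - 2 * \<eta>1 x * \<eta>11 x - 2 * \<eta>2 x * \<eta>12 x)"
  define \<zeta>2 where "\<zeta>2 = (\<lambda>x. 2 * \<eta>2 x - 2 * \<eta>1 x * \<eta>12 x - 2 * \<eta>2 x * \<eta>22 x)"
  \<comment> \<open>The Gauss curvature expression is a divergence: v11 \<bullet> v22 - v12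
    \<bullet> v12 is the second partial derivative of \<open>s\<close> minus the first partial
    derivative of \<open>t\<close>.\<close>
  define s where "s = (\<lambda>x. V 2 0 x \<bullet> V 0 1 x)"
  define s2 where "s2 = (\<lambda>x. V 2 1 x \<bullet> V 0 1 x + V 2 0 x \<bullet> V 0 2 x)"
  define t where "t = (\<lambda>x. V 1 1 x \<bullet> V 0 1 x)"
  define t1 where "t1 = (\<lambda>x. V 2 1 x \<bullet> V 0 1 x + V 1 1 x \<bullet> V 1 1 x)"
  note V1' = V1[of 0 0] V1[of 1 0] V1[of 0 1] V1[of 1 1]
    and V2' = V2[of 0 0] V2[of 1 0] V2[of 0 1] V2[of 1 1] V2[of 2 0]
  note num = One_nat_def[symmetric] Suc_1
  have d: "has_partial 1 \<eta>1 \<eta>11" "has_partial 2 \<eta>1 \<eta>12" "has_partial 1 \<eta>2 \<eta>12" "has_partial 2 \<eta>2 \<eta>22"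
    "has_partial 2 \<eta>11 \<eta>112" "has_partial 1 \<eta>12 \<eta>112" "has_partial 2 s s2" "has_partial 1 t t1"
    unfolding \<eta>1_def \<eta>2_def \<eta>11_def \<eta>12_def \<eta>22_def \<eta>112_def s_def s2_def t_def t1_def
    by (rule has_partial_inner has_partial_add V1'[unfolded num] V2'[unfolded num] refl |
        simp add: inner_commute algebra_simps)+
  have v: "has_partial 1 (\<lambda>x. V 0 0 x \<bullet> V 0 0 x) (\<lambda>x. 2 * \<eta>1 x)" "has_partial 2 (\<lambda>x. V 0 0 x \<bullet> V 0 0 x) (\<lambda>x. 2 * \<eta>2 x)"
    by (rule has_partial_inner[OF V1[of 0 0] V1[of 0 0]], simp add: \<eta>1_def inner_commute)
       (rule has_partial_inner[OF V2[of 0 0] V2[of 0 0]], simp add: \<eta>2_def inner_commute)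
  have sq: "has_partial i (\<lambda>x. f x * f x) (\<lambda>x. 2 * f x * g x)" if "has_partial i f g" for i and f g :: "real^2 \<Rightarrow> real"
    by (rule has_partial_mult[OF that that]) simp
  have z: "has_partial 1 \<zeta> \<zeta>1" "has_partial 2 \<zeta> \<zeta>2"
    unfolding \<zeta>_def \<zeta>1_def \<zeta>2_def by (rule has_partial_diff v sq d refl)+
  define k where "k = K 0 0"
  define k1 where "k1 = K 1 0"
  define k2 where "k2 = K 0 1"
  define k11 where "k11 = K 2 0"
  define k12 where "k12 = K 1 1"
  define k22 where "k22 = K 0 2"
  note k_defs = k_def k1_def k2_def k11_def k12_def k22_def
  have kp: "has_partial 1 k k1" "has_partial 2 k k2" "has_partial 1 k1 k11" "has_partial 1 k2 k12" "has_partial 2 k2 k22"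
    unfolding k_defs
    by (rule K1[of 0 0, unfolded num] K2[of 0 0, unfolded num] K1[of 1 0, unfolded num]
      K1[of 0 1, unfolded num] K2[of 0 1, unfolded num])+
  \<comment> \<open>The divergence of (X, Y) contains k (\<Delta>\<eta> - det D^2 \<eta>) and k
    \<zeta> times the curvature. The summands with \<open>k1\<close> and \<open>k2\<close> perform a
    second integration by parts: they cancel the terms in which a first derivative of
    \<open>K\<close> multiplies an entry of D^2 \<eta>, so that \<open>B\<close> involves only first
    derivatives of \<eta>.\<close>
  define X where "X = (\<lambda>x. k x * \<eta>1 x + k x * (\<eta>12 x * \<eta>2 x) + k2 x * (\<eta>1 x * \<eta>2 x)
     - k1 x * (\<eta>2 x * \<eta>2 x) / 2 - k x * (\<zeta> x * t x))"
  define X1 where "X1 = (\<lambda>x. (k x * \<eta>11 x + k1 x * \<eta>1 x)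
     + (k x * (\<eta>12 x * \<eta>12 x + \<eta>112 x * \<eta>2 x) + k1 x * (\<eta>12 x * \<eta>2 x))
     + (k2 x * (\<eta>1 x * \<eta>12 x + \<eta>11 x * \<eta>2 x) + k12 x * (\<eta>1 x * \<eta>2 x))
     - (k1 x * (\<eta>2 x * \<eta>12 x + \<eta>12 x * \<eta>2 x) + k11 x * (\<eta>2 x * \<eta>2 x)) / 2
     - (k x * (\<zeta> x * t1 x + \<zeta>1 x * t x) + k1 x * (\<zeta> x * t x)))"
  define Y where "Y = (\<lambda>x. k x * \<eta>2 x - k x * (\<eta>11 x * \<eta>2 x) - k2 x * (\<eta>1 x * \<eta>1 x) / 2
     + k x * (\<zeta> x * s x))"
  define Y2 where "Y2 = (\<lambda>x. (k x * \<eta>22 x + k2 x * \<eta>2 x)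
     - (k x * (\<eta>11 x * \<eta>22 x + \<eta>112 x * \<eta>2 x) + k2 x * (\<eta>11 x * \<eta>2 x))
     - (k2 x * (\<eta>1 x * \<eta>12 x + \<eta>12 x * \<eta>1 x) + k22 x * (\<eta>1 x * \<eta>1 x)) / 2
     + (k x * (\<zeta> x * s2 x + \<zeta>2 x * s x) + k2 x * (\<zeta> x * s x)))"
  have half: "has_partial i f g \<Longrightarrow> has_partial i (\<lambda>x. f x / 2) (\<lambda>x. g x / 2)" for i and f g :: "real^2 \<Rightarrow> real"
    unfolding has_partial_def using has_vector_derivative_divide by blast
  have X: "has_partial 1 X X1"
    unfolding X_def X1_def
    by (rule has_partial_diff has_partial_add half has_partial_mult d z kp refl)+
  have Y: "has_partial 2 Y Y2"
    unfolding Y_def Y2_def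
    by (rule has_partial_diff has_partial_add half has_partial_mult d z kp refl)+
  have c1: "continuous_on UNIV \<eta>1" "continuous_on UNIV \<eta>2" "continuous_on UNIV \<eta>11" "continuous_on UNIV \<eta>12"
    "continuous_on UNIV \<eta>22" "continuous_on UNIV \<eta>112" "continuous_on UNIV s" "continuous_on UNIV s2"
    "continuous_on UNIV t" "continuous_on UNIV t1"
    unfolding \<eta>1_def \<eta>2_def \<eta>11_def \<eta>12_def \<eta>22_def \<eta>112_def s_def s2_def t_def t1_def
    by (intro continuous_intros V_cont)+
  have c2: "continuous_on UNIV \<zeta>" "continuous_on UNIV \<zeta>1" "continuous_on UNIV \<zeta>2"
    unfolding \<zeta>_def \<zeta>1_def \<zeta>2_def by (intro continuous_intros V_cont c1)+
  have c3: "continuous_on UNIV k" "continuous_on UNIV k1" "continuous_on UNIV k2" "continuous_on UNIV k11"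
    "continuous_on UNIV k12" "continuous_on UNIV k22"
    unfolding k_defs by (rule K_cont)+
  have half_cont: "continuous_on UNIV f \<Longrightarrow> continuous_on UNIV (\<lambda>x. f x / 2)" for f :: "real^2 \<Rightarrow> real"
    by (intro continuous_intros) auto
  note cs = continuous_on_add continuous_on_diff continuous_on_mult half_cont c1 c2 c3
  have contX: "continuous_on UNIV X" "continuous_on UNIV X1" "continuous_on UNIV Y" "continuous_on UNIV Y2"
    unfolding X_def X1_def Y_def Y2_def by (rule cs)+
  have supp: "X x = 0" "X1 x = 0" "Y x = 0" "Y2 x = 0" if "x \<notin> cbox p q" for x
    using K0[OF that] by (simp_all add: X_def X1_def Y_def Y2_def k_defs)
  have "(LINT x|lborel. X1 x) = 0" "(LINT x|lborel. Y2 x) = 0"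
    by (rule integral_partial_eq_0[OF X contX(1,2) supp(1)], assumption)
       (rule integral_partial_eq_0[OF Y contX(3,4) supp(3)], assumption)
  moreover have int: "integrable lborel X1" "integrable lborel Y2" "integrable lborel (K 0 0)"
    using integrable_lborel_compact_support[OF contX(2) supp(2)]
      integrable_lborel_compact_support[OF contX(4) supp(4)]
      integrable_lborel_compact_support[OF K_cont[of 0 0] K0] by blast+
  ultimately have "(LINT x|lborel. K 0 0 x) = (LINT x|lborel. K 0 0 x - (X1 x + Y2 x))"
    by simp
  moreover have id: "K 0 0 x - (X1 x + Y2 x) = Err x - B x" for x
  proof -
    \<comment> \<open>\<open>r\<close> is the only product with a third derivative of
      \<open>V\<close>; it occurs in both \<open>s2\<close> and \<open>t1\<close> and
      cancels.\<close>
    define r where "r = V 2 1 x \<bullet> V 0 1 x"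
    define w1 where "w1 = V 2 0 x \<bullet> V 0 2 x"
    define w2 where "w2 = V 1 1 x \<bullet> V 1 1 x"
    have Err: "Err x = (k1 x * \<zeta> x + k x * \<zeta>1 x) * t x - (k2 x * \<zeta> x + k x * \<zeta>2 x) * s x
        + k x * (((\<eta>11 x - 1) * (\<eta>22 x - 1) - \<eta>12 x * \<eta>12 x) - \<zeta> x * (w1 - w2))"
      unfolding Err_def curvature_error_def Let_def power2_eq_square \<zeta>_def \<zeta>1_def \<zeta>2_def
        \<eta>11_def \<eta>12_def \<eta>22_def \<eta>1_def \<eta>2_def s_def t_def w1_def w2_def k_defs ..
    have B: "B x = k1 x * \<eta>1 x + k2 x * \<eta>2 x + k12 x * (\<eta>1 x * \<eta>2 x)
        - k11 x * (\<eta>2 x * \<eta>2 x) / 2 - k22 x * (\<eta>1 x * \<eta>1 x) / 2"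
      unfolding B_def k_defs ..
    have st: "s2 x = r + w1" "t1 x = r + w2"
      unfolding s2_def t1_def r_def w1_def w2_def by simp_all
    show ?thesis
      unfolding Err B X1_def Y2_def st k_def[symmetric] by (simp add: field_simps)
  qed
  ultimately show "(LINT x|lborel. K 0 0 x) = (LINT x|lborel. Err x - B x)" by simp
  have "integrable lborel (\<lambda>x. K 0 0 x - (X1 x + Y2 x))"
    by (intro Bochner_Integration.integrable_diff Bochner_Integration.integrable_add int)
  then show "integrable lborel (\<lambda>x. Err x - B x)" by (simp add: id)
  show "Err x - B x = 0" if "x \<notin> cbox p q"
    using supp[OF that] K0[OF that, of 0 0] id[of x] by simp
qed

subsection \<open>Convolution with a smooth kernel\<close>

definition square :: "real^2 \<Rightarrow> real \<Rightarrow> (real^2) set" where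
  "square x \<rho> = cbox (x - vec \<rho>) (x + vec \<rho>)"

lemma mem_square: "y \<in> square x \<rho> \<longleftrightarrow> \<bar>y $ 1 - x $ 1\<bar> \<le> \<rho> \<and> \<bar>y $ 2 - x $ 2\<bar> \<le> \<rho>"
  by (auto simp: square_def mem_box_cart forall_2 abs_le_iff)

lemma square_borel: "square x \<rho> \<in> sets borel"
  by (simp add: square_def)

lemma measure_square: "0 \<le> \<rho> \<Longrightarrow> measure lborel (square x \<rho>) = (2 * \<rho>)\<^sup>2"
  unfolding square_def by (subst content_cbox_cart) (auto simp: interval_ne_empty_cart power2_eq_square)

lemma emeasure_square: "0 \<le> \<rho> \<Longrightarrow> emeasure lborel (square x \<rho>) = ennreal ((2 * \<rho>)\<^sup>2)"
  using measure_square[of \<rho> x] unfolding square_def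
  by (metis emeasure_eq_ennreal_measure emeasure_lborel_cbox_finite infinity_ennreal_def less_irrefl)

lemma norm_le_square:
  assumes "y \<in> square x (\<epsilon> / 2)" shows "norm (x - y) \<le> \<epsilon>"
proof -
  have "norm (x - y) \<le> \<bar>(x - y) $ 1\<bar> + \<bar>(x - y) $ 2\<bar>"
    using norm_le_l1_cart[of "x - y"] by (simp add: UNIV_2)
  then show ?thesis using assms by (simp add: mem_square abs_minus_commute)
qed

text \<open>A product of two one-dimensional bumps divided by its integral, which is positive
  because the product is positive on a smaller square.\<close>

lemma smooth_kernel_exists:
  obtains K where "smooth_family K" "\<And>a b x. x \<notin> square 0 (1/4) \<Longrightarrow> K a b x = 0"
    "\<And>x. 0 \<le> K 0 0 x" "(LINT x|lborel. K 0 0 x) = 1"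
proof -
  obtain B where B: "B 0 = interval_bump 1 (-1/4) (1/4)" "derivative_sequence B"
    "\<And>n x. x \<notin> {-1/4..1/4} \<Longrightarrow> B n x = 0"
    using interval_bump_derivative_sequence[of 1 "-1/4" "1/4"] by auto
  define T where "T a b x = B a (x $ 1) * B b (x $ 2)" for a b and x :: "real^2"
  have T: "smooth_family T"
    unfolding T_def by (rule smooth_family_tensor) fact+
  have B0: "B n t = 0" if "\<not> \<bar>t\<bar> \<le> 1/4" for n t
    using that by (intro B(3)) auto
  have T0: "T a b x = 0" if "x \<notin> square 0 (1/4)" for a b x
    using that B0[of "x $ 1" a] B0[of "x $ 2" b] unfolding mem_square T_def by auto
  have T_cont: "continuous_on UNIV (T 0 0)"
    using smooth_family_continuous_on[OF T continuous_on_id] by simp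
  have T_nonneg: "0 \<le> T 0 0 x" for x by (simp add: T_def B(1) interval_bump_bounds)
  have T_int: "integrable lborel (T 0 0)"
    by (rule integrable_lborel_compact_support[OF T_cont T0[unfolded square_def]])
  have "(LINT x|lborel. T 0 0 x) \<noteq> 0"
  proof
    assume "(LINT x|lborel. T 0 0 x) = 0"
    then have "AE x in lborel. T 0 0 x = 0"
      using integral_nonneg_eq_0_iff_AE[OF T_int] T_nonneg by simp
    moreover have "T 0 0 x \<noteq> 0" if "x \<in> square 0 (1/8)" for x
    proof -
      have "B 0 t \<noteq> 0" if "\<bar>t\<bar> \<le> 1/8" for t
        unfolding B(1) by (rule less_imp_neq[symmetric], rule interval_bump_pos) (use that in linarith)+
      then show ?thesis using that by (simp add: T_def mem_square)
    qed
    ultimately have "AE x in lborel. x \<notin> square 0 (1/8)" by (auto elim!: eventually_mono)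
    then have "emeasure lborel (square 0 (1/8)) = 0"
      using square_borel[of 0 "1/8"] by (subst (asm) AE_iff_measurable[where N="square 0 (1/8)"]) auto
    then show False by (simp add: emeasure_square)
  qed
  then have c: "0 < (LINT x|lborel. T 0 0 x)"
    using Bochner_Integration.integral_nonneg[of lborel "T 0 0"] T_nonneg by (simp add: less_le)
  define c where "c = (LINT x|lborel. T 0 0 x)"
  \<comment> \<open>The trivial factors give the definition the shape of
    \<open>smooth_family_affine\<close> with z = 0 and \<delta> = 1.\<close>
  define K where "K a b x = 1 / c * 1 ^ (a + b) * T a b (0 + 1 *\<^sub>R x)" for a b x
  show thesis
  proof
    show "smooth_family K" unfolding K_def by (rule smooth_family_affine[OF T])
    show "(LINT x|lborel. K 0 0 x) = 1" using c by (simp add: K_def c_def)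
  qed (use T0 T_nonneg c in \<open>auto simp: K_def c_def\<close>)
qed

text \<open>\<open>scaled_kernel K \<epsilon> a b\<close> is \<open>\<partial>\<^sub>1\<^sup>a \<partial>\<^sub>2\<^sup>b\<close> of \<open>\<epsilon>\<^sup>-\<^sup>2 K 0 0 (\<cdot> / \<epsilon>)\<close>.\<close>

definition scaled_kernel :: "(nat \<Rightarrow> nat \<Rightarrow> real^2 \<Rightarrow> real) \<Rightarrow> real \<Rightarrow> nat \<Rightarrow> nat \<Rightarrow> real^2 \<Rightarrow> real" where
  "scaled_kernel K \<epsilon> a b z = (1 / \<epsilon>)\<^sup>2 * (1 / \<epsilon>) ^ (a + b) * K a b (0 + (1 / \<epsilon>) *\<^sub>R z)"

lemma smooth_family_scaled_kernel: "smooth_family K \<Longrightarrow> smooth_family (scaled_kernel K \<epsilon>)"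
  unfolding scaled_kernel_def by (rule smooth_family_affine)

text \<open>The fixed domain of integration makes this a parameter integral over a compact box,
  hence smooth on the whole plane for a smooth kernel and \<open>u\<close> continuous on the square.
  It is the usual convolution at points around which the translated kernel is supported in the
  square.\<close>

definition convolution :: "(real^2 \<Rightarrow> real) \<Rightarrow> (real^2 \<Rightarrow> 'b::euclidean_space) \<Rightarrow> real^2 \<Rightarrow> 'b" where
  "convolution k u x = integral (square 0 (1/2)) (\<lambda>y. k (x - y) *\<^sub>R u y)"

lemma convolution_integrand_continuous:
  fixes u :: "real^2 \<Rightarrow> 'b::euclidean_space"
  assumes k: "smooth_family k" and u: "continuous_on (square 0 (1/2)) u" and g: "continuous_on A g"
  shows "continuous_on (A \<times> square 0 (1/2)) (\<lambda>(x, y). k a b (g x - y) *\<^sub>R u y)"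
proof -
  have "continuous_on (A \<times> square 0 (1/2)) (\<lambda>p. g (fst p) - snd p)"
    by (intro continuous_on_diff continuous_on_compose2[OF g] continuous_on_fst continuous_on_snd continuous_on_id) auto
  moreover have "continuous_on (A \<times> square 0 (1/2)) (\<lambda>p. u (snd p))"
    by (intro continuous_on_compose2[OF u] continuous_on_snd continuous_on_id) auto
  ultimately show ?thesis
    unfolding case_prod_beta
    by (intro continuous_on_scaleR smooth_family_continuous_on[OF k])
qed

lemma convolution_continuous:
  assumes "smooth_family k" "continuous_on (square 0 (1/2)) u"
  shows "continuous_on UNIV (convolution (k a b) u)"
  unfolding convolution_def square_def
  using convolution_integrand_continuous[OF assms continuous_on_id]
  by (intro integral_continuous_on_param) (simp add: square_def)

lemma convolution_has_partial:
  assumes k: "smooth_family k" and u: "continuous_on (square 0 (1/2)) u"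
  shows "has_partial 1 (convolution (k a b) u) (convolution (k (Suc a) b) u)"
    and "has_partial 2 (convolution (k a b) u) (convolution (k a (Suc b)) u)"
proof -
  have *: "has_partial i (convolution (k a b) u) (convolution (k a' b') u)"
    if "has_partial i (k a b) (k a' b')" for i a' b'
    unfolding has_partial_def
  proof
    fix x :: "real^2"
    have "((\<lambda>t. integral (square 0 (1/2)) (\<lambda>y. k a b ((x + t *\<^sub>R axis i 1) - y) *\<^sub>R u y)) has_vector_derivative
       integral (square 0 (1/2)) (\<lambda>y. k a' b' ((x + 0 *\<^sub>R axis i 1) - y) *\<^sub>R u y)) (at 0 within UNIV)"
      unfolding square_def
    proof (rule leibniz_rule_vector_derivative)
      fix t y
      have "((\<lambda>t. k a b ((x - y) + t *\<^sub>R axis i 1)) has_vector_derivative k a' b' ((x - y) + t *\<^sub>R axis i 1)) (at t)"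
        by (rule has_partial_line[OF that])
      then have "((\<lambda>t. k a b (x + t *\<^sub>R axis i 1 - y)) has_real_derivative k a' b' (x + t *\<^sub>R axis i 1 - y)) (at t)"
        by (simp add: algebra_simps has_real_derivative_iff_has_vector_derivative)
      from has_vector_derivative_scaleR[OF this has_vector_derivative_const[of "u y"]]
      show "((\<lambda>t. k a b (x + t *\<^sub>R axis i 1 - y) *\<^sub>R u y) has_vector_derivative
          k a' b' (x + t *\<^sub>R axis i 1 - y) *\<^sub>R u y) (at t within UNIV)"
        by simp
    next
      fix t
      show "(\<lambda>y. k a b (x + t *\<^sub>R axis i 1 - y) *\<^sub>R u y) integrable_on cbox (0 - vec (1/2)) (0 + vec (1/2))"
        using u unfolding square_def
        by (intro integrable_continuous continuous_on_scaleR smooth_family_continuous_on[OF k]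
            continuous_on_diff continuous_on_const continuous_on_id)
    next
      have "continuous_on UNIV (\<lambda>t. x + t *\<^sub>R axis i (1::real))"
        by (intro continuous_intros)
      from convolution_integrand_continuous[OF k u this, of a' b']
      show "continuous_on (UNIV \<times> cbox (0 - vec (1/2)) (0 + vec (1/2)))
          (\<lambda>(t, y). k a' b' (x + t *\<^sub>R axis i 1 - y) *\<^sub>R u y)"
        by (simp add: square_def)
    qed auto
    then show "((\<lambda>t. convolution (k a b) u (x + t *\<^sub>R axis i 1)) has_vector_derivative
       convolution (k a' b') u x) (at 0)"
      by (simp add: convolution_def)
  qed
  show "has_partial 1 (convolution (k a b) u) (convolution (k (Suc a) b) u)"
    "has_partial 2 (convolution (k a b) u) (convolution (k a (Suc b)) u)"
    by (rule *, rule smooth_family_has_partial[OF k])+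
qed

lemma convolution_eq_lborel:
  assumes k: "smooth_family k" and u: "continuous_on (square 0 (1/2)) u"
    and 0: "\<And>y. y \<notin> square 0 (1/2) \<Longrightarrow> k a b (x - y) = 0"
  shows "convolution (k a b) u x = (LINT y|lborel. k a b (x - y) *\<^sub>R u y)"
proof -
  have "set_integrable lborel (square 0 (1/2)) (\<lambda>y. k a b (x - y) *\<^sub>R u y)"
    using u unfolding set_integrable_def square_def
    by (intro borel_integrable_compact continuous_on_scaleR smooth_family_continuous_on[OF k]
        continuous_on_diff continuous_on_const continuous_on_id) auto
  from set_borel_integral_eq_integral(2)[OF this]
  have "convolution (k a b) u x = (LINT y|lborel. indicator (square 0 (1/2)) y *\<^sub>R (k a b (x - y) *\<^sub>R u y))"
    by (simp add: convolution_def set_lebesgue_integral_def)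
  also have "\<dots> = (LINT y|lborel. k a b (x - y) *\<^sub>R u y)"
  proof (intro Bochner_Integration.integral_cong refl)
    show "indicator (square 0 (1/2)) y *\<^sub>R (k a b (x - y) *\<^sub>R u y) = k a b (x - y) *\<^sub>R u y" for y
      by (cases "y \<in> square 0 (1/2)") (simp_all add: 0)
  qed
  finally show ?thesis .
qed

lemma integral_lborel_affine:
  fixes f :: "'a::euclidean_space \<Rightarrow> real"
  assumes "f \<in> borel_measurable borel" "c \<noteq> 0"
  shows "(LINT x|lborel. f (t + c *\<^sub>R x)) * \<bar>c\<bar> ^ DIM('a) = (LINT x|lborel. f x)"
  using assms
  by (subst (2) lborel_affine[OF assms(2), of t])
    (simp add: integral_density integral_distr)

subsection \<open>Mollified isometric immersions\<close>

text \<open>What the smooth computation sees of the immersion: the translated map \<open>U\<close>,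
  and an everywhere orthonormal Borel frame in place of the columns of Du. Weak derivatives are
  tested with families supported strictly inside the square of half-side 1/2. Since r <= 1, terms
  quadratic in \<open>r\<close> are absorbed by linear ones.\<close>

locale isometric_frame =
  fixes U H1 H2 :: "real^2 \<Rightarrow> real^3" and r :: real
  assumes U_cont: "continuous_on (square 0 (1/2)) U" and U_meas: "U \<in> borel_measurable borel"
    and U_le: "\<And>y. norm (U y) \<le> r" and r_le: "r \<le> 1"
    and H_meas: "H1 \<in> borel_measurable borel" "H2 \<in> borel_measurable borel"
    and H_frame: "\<And>y. H1 y \<bullet> H1 y = 1" "\<And>y. H2 y \<bullet> H2 y = 1" "\<And>y. H1 y \<bullet> H2 y = 0"
    and weak_partial: "\<And>L \<rho> a b. smooth_family L \<Longrightarrow> \<rho> < 1/2 \<Longrightarrow>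
        (\<And>a b y. y \<notin> square 0 \<rho> \<Longrightarrow> L a b y = 0) \<Longrightarrow>
        (LINT y|lborel. L (Suc a) b y *\<^sub>R U y) = - (LINT y|lborel. L a b y *\<^sub>R H1 y) \<and>
        (LINT y|lborel. L a (Suc b) y *\<^sub>R U y) = - (LINT y|lborel. L a b y *\<^sub>R H2 y)"
begin

definition osc_at :: "real^2 \<Rightarrow> real^2 \<Rightarrow> real" where
  "osc_at x y = norm (H1 y - H1 x) + norm (H2 y - H2 x)"

end

text \<open>\<open>K\<close> acts at scale \<epsilon> as mollifier and at scale 1 as test function.
  Its second derivatives are bounded as well because they occur in the divergence terms.\<close>

locale mollified_frame = isometric_frame +
  fixes K :: "nat \<Rightarrow> nat \<Rightarrow> real^2 \<Rightarrow> real" and C \<epsilon> :: real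
  assumes K: "smooth_family K" and K0: "\<And>a b x. x \<notin> square 0 (1/4) \<Longrightarrow> K a b x = 0"
    and K_nonneg: "\<And>x. 0 \<le> K 0 0 x" and K_int: "(LINT x|lborel. K 0 0 x) = 1"
    and K_le: "\<And>a b x. a + b \<le> 2 \<Longrightarrow> \<bar>K a b x\<bar> \<le> C" and C: "1 \<le> C"
    and \<epsilon>: "0 < \<epsilon>" "\<epsilon> < 1/4"
begin

definition "k = scaled_kernel K \<epsilon>"

definition "V a b = convolution (k a b) U"

lemma k_smooth: "smooth_family k"
  unfolding k_def by (rule smooth_family_scaled_kernel[OF K])

lemma k_eq: "k a b z = (1 / \<epsilon>) ^ (2 + a + b) * K a b ((1 / \<epsilon>) *\<^sub>R z)"
  unfolding k_def scaled_kernel_def add.assoc power_add[of _ 2] by simp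

lemma k_support:
  assumes "y \<notin> square x (\<epsilon> / 4)" shows "k a b (x - y) = 0"
proof -
  have "(1 / \<epsilon>) *\<^sub>R (x - y) \<notin> square 0 (1/4)"
    using assms \<epsilon> by (auto simp: mem_square abs_mult divide_le_eq abs_minus_commute field_simps)
  then show ?thesis by (simp add: k_eq K0)
qed

text \<open>The support has half-side \<epsilon>/4; the larger square of half-side \<epsilon>/2 is
  taken because its area is exactly \<epsilon>^2.\<close>

lemma k_le: "a + b \<le> 2 \<Longrightarrow> \<bar>k a b (x - y)\<bar> \<le> C / \<epsilon> ^ (2 + a + b) * indicator (square x (\<epsilon> / 2)) y"
proof (cases "y \<in> square x (\<epsilon> / 2)")
  case True
  assume "a + b \<le> 2"
  then show ?thesis
    using True K_le[of a b] \<epsilon> by (simp add: k_eq abs_mult power_divide divide_right_mono)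
next
  case False
  then have "y \<notin> square x (\<epsilon> / 4)" using \<epsilon> by (auto simp: mem_square)
  then show ?thesis using False by (simp add: k_support)
qed

lemma k_meas: "(\<lambda>y. k a b (x - y)) \<in> borel_measurable borel"
  by (intro borel_measurable_continuous_onI smooth_family_continuous_on[OF k_smooth] continuous_intros)

lemma k_integral: "(LINT y|lborel. k 0 0 (x - y)) = 1"
proof -
  have "K 0 0 \<in> borel_measurable borel"
    using smooth_family_continuous_on[OF K continuous_on_id] by (intro borel_measurable_continuous_onI) simp
  from integral_lborel_affine[OF this, of "- 1 / \<epsilon>" "(1 / \<epsilon>) *\<^sub>R x"]
  have "(LINT y|lborel. K 0 0 ((1 / \<epsilon>) *\<^sub>R x + (- 1 / \<epsilon>) *\<^sub>R y)) * (1 / \<epsilon>)\<^sup>2 = 1"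
    using \<epsilon> K_int by simp
  moreover have "k 0 0 (x - y) = (1 / \<epsilon>)\<^sup>2 * K 0 0 ((1 / \<epsilon>) *\<^sub>R x + (- 1 / \<epsilon>) *\<^sub>R y)" for y
    by (simp add: k_eq power2_eq_square algebra_simps)
  ultimately show ?thesis by (simp add: mult.commute)
qed

text \<open>\<open>reflected x a b\<close> is \<open>\<partial>\<^sub>1\<^sup>a \<partial>\<^sub>2\<^sup>b\<close> of \<open>y \<mapsto> k 0 0 (x - y)\<close>.\<close>

definition "reflected x a b y = (1 / \<epsilon>)\<^sup>2 * (- 1 / \<epsilon>) ^ (a + b) * K a b ((1 / \<epsilon>) *\<^sub>R x + (- 1 / \<epsilon>) *\<^sub>R y)"

lemma reflected_smooth: "smooth_family (reflected x)"
  unfolding reflected_def by (rule smooth_family_affine[OF K])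

lemma k_reflected: "k a b (x - y) = (-1) ^ (a + b) * reflected x a b y"
proof -
  have "(-1) ^ (a + b) * ((- 1 / \<epsilon>) ^ (a + b)) = (1 / \<epsilon>) ^ (a + b)"
    by (simp flip: power_mult_distrib)
  then show ?thesis
    by (simp add: k_eq reflected_def power_add power2_eq_square algebra_simps)
qed

lemma reflected_support: "y \<notin> square x (\<epsilon> / 4) \<Longrightarrow> reflected x a b y = 0"
  using k_support[of y x a b] by (simp add: k_reflected)

lemma k_partial_integral: "(LINT y|lborel. k 1 0 (x - y)) = 0" "(LINT y|lborel. k 0 1 (x - y)) = 0"
proof -
  have cont: "continuous_on UNIV (reflected x a b)" for a b
    using smooth_family_continuous_on[OF reflected_smooth continuous_on_id] by simp
  note * = smooth_family_has_partial[OF reflected_smooth, of x 0 0]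
  have "(LINT y|lborel. reflected x (Suc 0) 0 y) = 0"
    by (rule integral_partial_eq_0[OF *(1) cont cont reflected_support[unfolded square_def]])
  moreover have "(LINT y|lborel. reflected x 0 (Suc 0) y) = 0"
    by (rule integral_partial_eq_0[OF *(2) cont cont reflected_support[unfolded square_def]])
  ultimately show "(LINT y|lborel. k 1 0 (x - y)) = 0" "(LINT y|lborel. k 0 1 (x - y)) = 0"
    by (simp_all add: k_reflected)
qed

context
  fixes x assumes x: "x \<in> square 0 (1/4)"
begin

text \<open>Here 1/4 + 1/16 = 5/16 < 3/8 < 1/2: the translated kernel stays strictly inside the
  square on which the immersion is controlled.\<close>

lemma square_mono: "y \<in> square x (\<epsilon> / 4) \<Longrightarrow> y \<in> square 0 (3/8)"
  using x \<epsilon> unfolding mem_square abs_le_iff by auto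

lemma V_eq: "V a b x = (LINT y|lborel. k a b (x - y) *\<^sub>R U y)"
  unfolding V_def
proof (rule convolution_eq_lborel[OF k_smooth U_cont])
  fix y :: "real^2" assume "y \<notin> square 0 (1/2)"
  then have "y \<notin> square x (\<epsilon> / 4)" using square_mono[of y] by (auto simp: mem_square)
  then show "k a b (x - y) = 0" by (rule k_support)
qed

text \<open>The kernel translated to \<open>x\<close> is a test function of the integration
  variable; the minus sign of the weak derivative cancels the one produced by the
  reflection.\<close>

lemma V_derivative:
  "V (Suc a) b x = (LINT y|lborel. k a b (x - y) *\<^sub>R H1 y)"
  "V a (Suc b) x = (LINT y|lborel. k a b (x - y) *\<^sub>R H2 y)"
proof -
  have "(LINT y|lborel. reflected x (Suc a) b y *\<^sub>R U y) = - (LINT y|lborel. reflected x a b y *\<^sub>R H1 y)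
    \<and> (LINT y|lborel. reflected x a (Suc b) y *\<^sub>R U y) = - (LINT y|lborel. reflected x a b y *\<^sub>R H2 y)"
  proof (rule weak_partial[OF reflected_smooth, where \<rho>="3/8"])
    show "reflected x a b y = 0" if "y \<notin> square 0 (3/8)" for a b y
      using that square_mono reflected_support by blast
  qed simp
  then show "V (Suc a) b x = (LINT y|lborel. k a b (x - y) *\<^sub>R H1 y)"
    "V a (Suc b) x = (LINT y|lborel. k a b (x - y) *\<^sub>R H2 y)"
    unfolding V_eq k_reflected by (simp_all flip: scaleR_scaleR)
qed

lemma frame_average_at:
  "frame_average H1 H2 (square x (\<epsilon> / 2)) \<epsilon> C
    (\<lambda>y. k 0 0 (x - y)) (\<lambda>y. k 1 0 (x - y)) (\<lambda>y. k 0 1 (x - y))"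
proof
  show "measure lborel (square x (\<epsilon> / 2)) = \<epsilon>\<^sup>2"
    using measure_square[of "\<epsilon> / 2" x] \<epsilon> by simp
  show "\<bar>k 0 0 (x - y)\<bar> \<le> C / \<epsilon>\<^sup>2 * indicator (square x (\<epsilon> / 2)) y"
    "\<bar>k 1 0 (x - y)\<bar> \<le> C / \<epsilon> ^ 3 * indicator (square x (\<epsilon> / 2)) y"
    "\<bar>k 0 1 (x - y)\<bar> \<le> C / \<epsilon> ^ 3 * indicator (square x (\<epsilon> / 2)) y" for y
    using k_le[of 0 0 x y] k_le[of 1 0 x y] k_le[of 0 1 x y] by (simp_all add: eval_nat_numeral)
  show "0 \<le> k 0 0 (x - y)" for y using K_nonneg by (simp add: k_eq)
qed (use H_meas H_frame \<epsilon> C square_borel k_meas k_integral k_partial_integral in auto)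

lemma norm_V_le: "norm (V 0 0 x) \<le> r"
proof -
  have int: "integrable lborel (\<lambda>y. k 0 0 (x - y))"
    using k_integral[of x] by (rule_tac ccontr) (simp add: not_integrable_integral_eq)
  have le: "norm (k 0 0 (x - y) *\<^sub>R U y) \<le> r * k 0 0 (x - y)" for y
    using mult_right_mono[OF U_le[of y], of "k 0 0 (x - y)"] K_nonneg by (simp add: k_eq mult.commute)
  have int': "integrable lborel (\<lambda>y. k 0 0 (x - y) *\<^sub>R U y)"
  proof (rule Bochner_Integration.integrable_bound[where f="\<lambda>y. r * k 0 0 (x - y)"])
    show "(\<lambda>y. k 0 0 (x - y) *\<^sub>R U y) \<in> borel_measurable lborel"
      using k_meas U_meas by simp
  qed (use int in simp, intro always_eventually allI order_trans[OF le], simp)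
  have "norm (V 0 0 x) \<le> (LINT y|lborel. r * k 0 0 (x - y))"
    unfolding V_eq
    by (intro order_trans[OF integral_norm_bound] integral_mono integrable_norm int' le
        integrable_mult_right int)
  also have "\<dots> = r" using k_integral[of x] by simp
  finally show ?thesis .
qed

lemma norm_V_derivative_le: "norm (V 1 0 x) \<le> 1" "norm (V 0 1 x) \<le> 1"
proof -
  interpret fa: frame_average H1 H2 "square x (\<epsilon> / 2)" x \<epsilon> C
    "\<lambda>y. k 0 0 (x - y)" "\<lambda>y. k 1 0 (x - y)" "\<lambda>y. k 0 1 (x - y)"
    by (rule frame_average_at)
  show "norm (V 1 0 x) \<le> 1" "norm (V 0 1 x) \<le> 1"
    using fa.norm_avg_q0_le[of True] fa.norm_avg_q0_le[of False] V_derivative[of 0 0]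
    by (simp_all add: fa.avg_def fa.H_def)
qed

text \<open>The mixed derivative \<open>V 1 1\<close> has two representations, one for each frame
  vector; their equality is the compatibility condition of the frame estimate.\<close>

lemma curvature_error_at:
  "\<bar>curvature_error (K 0 0 x) (K 1 0 x) (K 0 1 x)
      (V 0 0 x) (V 1 0 x) (V 0 1 x) (V 2 0 x) (V 1 1 x) (V 0 2 x)\<bar>
    \<le> C * (300000 * C ^ 6 * (moment (square x (\<epsilon> / 2)) (osc_at x) 3 / \<epsilon>\<^sup>2 + \<epsilon>))"
proof -
  have V: "V 1 0 x = (LINT y|lborel. k 0 0 (x - y) *\<^sub>R H1 y)" "V 0 1 x = (LINT y|lborel. k 0 0 (x - y) *\<^sub>R H2 y)"
    "V 2 0 x = (LINT y|lborel. k 1 0 (x - y) *\<^sub>R H1 y)" "V 1 1 x = (LINT y|lborel. k 1 0 (x - y) *\<^sub>R H2 y)"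
    "V 0 2 x = (LINT y|lborel. k 0 1 (x - y) *\<^sub>R H2 y)" "V 1 1 x = (LINT y|lborel. k 0 1 (x - y) *\<^sub>R H1 y)"
    using V_derivative[of 0 0] V_derivative(1)[of 1 0] V_derivative(2)[of 1 0] V_derivative(2)[of 0 1]
      V_derivative(1)[of 0 1]
    by (simp_all add: numeral_2_eq_2)
  have "norm (V 0 0 x) \<le> 1" using norm_V_le r_le by linarith
  from frame_average_curvature_error_le[OF frame_average_at _ this, of "K 0 0 x" C "K 1 0 x" "K 0 1 x" x]
  show ?thesis
    using K_le[of 0 0 x] K_le[of 1 0 x] K_le[of 0 1 x] V(4,6)
    unfolding V(1,2,3,5) osc_at_def[abs_def] by simp
qed

end

end

section \<open>The Gagliardo integral near the diagonal\<close>

context isometric_frame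
begin

text \<open>The Gagliardo integrand with the exponent 3 in place of 2/s; the 4 is 2 + s *
  (2/s).\<close>

definition gagliardo_density :: "real^2 \<Rightarrow> real^2 \<Rightarrow> real" where
  "gagliardo_density x y = indicator (square 0 (1/2)) x * indicator (square 0 (1/2)) y *
     (osc_at x y ^ 3 / norm (x - y) ^ 4)"

definition gagliardo_tail :: "real \<Rightarrow> ennreal" where
  "gagliardo_tail \<delta> = (\<integral>\<^sup>+x. \<integral>\<^sup>+y. ennreal (indicator {..\<delta>} (norm (x - y)) * gagliardo_density x y) \<partial>lborel \<partial>lborel)"

lemma osc_at_nonneg: "0 \<le> osc_at x y"
  by (simp add: osc_at_def)

lemma gagliardo_density_nonneg: "0 \<le> gagliardo_density x y"
  by (simp add: gagliardo_density_def osc_at_nonneg)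

lemma osc_at_measurable [measurable]: "(\<lambda>p. osc_at (fst p) (snd p)) \<in> borel_measurable (borel \<Otimes>\<^sub>M borel)"
  unfolding osc_at_def using H_meas by measurable

lemma gagliardo_density_measurable [measurable]:
  "(\<lambda>p. gagliardo_density (fst p) (snd p)) \<in> borel_measurable (borel \<Otimes>\<^sub>M borel)"
proof -
  have [measurable]: "square 0 (1/2) \<in> sets borel" by (rule square_borel)
  show ?thesis unfolding gagliardo_density_def by measurable
qed

text \<open>Dominated convergence on the product space: off the diagonal the truncated integrand is
  eventually zero, and on the diagonal the oscillation itself vanishes.\<close>

lemma gagliardo_tail_tendsto_0:
  assumes fin: "(\<integral>\<^sup>+x. \<integral>\<^sup>+y. ennreal (gagliardo_density x y) \<partial>lborel \<partial>lborel) < \<infinity>" and d: "d \<longlonglongrightarrow> 0"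
  shows "(\<lambda>n. gagliardo_tail (d n)) \<longlonglongrightarrow> 0"
proof -
  define F where "F = (\<lambda>p. gagliardo_density (fst p) (snd p))"
  define D where "D n p = indicator {..d n} (norm (fst p - snd p)) * F p" for n p
  have mF: "F \<in> borel_measurable (lborel \<Otimes>\<^sub>M lborel)"
    using gagliardo_density_measurable unfolding F_def by simp
  have mD: "D n \<in> borel_measurable (lborel \<Otimes>\<^sub>M lborel)" for n
    unfolding D_def using mF by measurable
  have "(\<lambda>n. \<integral>\<^sup>+p. ennreal (D n p) \<partial>(lborel \<Otimes>\<^sub>M lborel)) \<longlonglongrightarrow>
      (\<integral>\<^sup>+p. 0 \<partial>((lborel :: (real^2) measure) \<Otimes>\<^sub>M (lborel :: (real^2) measure)))"
  proof (rule nn_integral_dominated_convergence[where u'="\<lambda>_. 0" and w="\<lambda>p. ennreal (F p)"])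
    show "(\<integral>\<^sup>+p. ennreal (F p) \<partial>(lborel \<Otimes>\<^sub>M lborel)) < \<infinity>"
      using fin mF by (subst lborel.nn_integral_fst[symmetric]) (auto simp: F_def)
    show "AE p in lborel \<Otimes>\<^sub>M lborel. (\<lambda>n. ennreal (D n p)) \<longlonglongrightarrow> 0"
    proof (intro always_eventually allI)
      fix p :: "(real^2) \<times> (real^2)"
      show "(\<lambda>n. ennreal (D n p)) \<longlonglongrightarrow> 0"
      proof (cases "fst p = snd p")
        case True
        then have "F p = 0" by (simp add: F_def gagliardo_density_def osc_at_def)
        then show ?thesis by (simp add: D_def)
      next
        case False
        then have "eventually (\<lambda>n. d n < norm (fst p - snd p)) sequentially"
          using d by (intro order_tendstoD) auto
        then have "eventually (\<lambda>n. ennreal (D n p) = 0) sequentially"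
          by eventually_elim (simp add: D_def)
        then show ?thesis by (rule tendsto_eventually)
      qed
    qed
    show "AE p in lborel \<Otimes>\<^sub>M lborel. ennreal (D n p) \<le> ennreal (F p)" for n
      by (intro always_eventually allI ennreal_leI)
        (auto simp: D_def F_def indicator_def gagliardo_density_nonneg)
  qed (use mF mD in auto)
  moreover have "(\<integral>\<^sup>+p. ennreal (D n p) \<partial>(lborel \<Otimes>\<^sub>M lborel)) = gagliardo_tail (d n)" for n
    using mD by (subst lborel.nn_integral_fst[symmetric]) (auto simp: gagliardo_tail_def D_def F_def)
  ultimately show ?thesis by simp
qed

text \<open>One factor \<epsilon>^(-2) comes from averaging over a square of area \<epsilon>^2, the
  other from the error estimate. Their product is at most |x - y|^(-4), as points of the square lie
  within distance \<epsilon> of \<open>x\<close>.\<close>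

lemma moment_le_tail:
  assumes \<epsilon>: "0 < \<epsilon>" "\<epsilon> < 1/4" and x: "x \<in> square 0 (1/4)"
  shows "ennreal (moment (square x (\<epsilon> / 2)) (osc_at x) 3 / \<epsilon>\<^sup>2)
    \<le> (\<integral>\<^sup>+y. ennreal (indicator {..\<epsilon>} (norm (x - y)) * gagliardo_density x y) \<partial>lborel)"
proof -
  let ?S = "square x (\<epsilon> / 2)"
  have "norm (H1 y) = 1" "norm (H2 y) = 1" for y
    by (simp_all add: norm_eq_sqrt_inner H_frame)
  then have le: "osc_at x y \<le> 4" for y
    using norm_triangle_ineq4[of "H1 y" "H1 x"] norm_triangle_ineq4[of "H2 y" "H2 x"]
    by (simp add: osc_at_def)
  have V: "measure lborel ?S = \<epsilon>\<^sup>2" using measure_square[of "\<epsilon> / 2" x] \<epsilon> by simp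
  interpret bounded_density ?S "osc_at x" 4
    by unfold_locales
      (use square_borel V \<epsilon> osc_at_nonneg le H_meas in \<open>auto simp: osc_at_def[abs_def]\<close>)
  have "moment ?S (osc_at x) 3 / \<epsilon>\<^sup>2 = (LINT y|lborel. (indicator ?S y * osc_at x y ^ 3) / \<epsilon> ^ 4)"
    using \<epsilon> by (simp add: moment_def V power2_eq_square power4_eq_xxxx mult.assoc)
  also have "ennreal \<dots> = (\<integral>\<^sup>+y. ennreal ((indicator ?S y * osc_at x y ^ 3) / \<epsilon> ^ 4) \<partial>lborel)"
    using integrable_power[of 3] osc_at_nonneg \<epsilon>
    by (intro nn_integral_eq_integral[symmetric]) (auto intro!: integrable_divide)
  also have "\<dots> \<le> (\<integral>\<^sup>+y. ennreal (indicator {..\<epsilon>} (norm (x - y)) * gagliardo_density x y) \<partial>lborel)"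
  proof (intro nn_integral_mono ennreal_leI)
    fix y
    show "(indicator ?S y * osc_at x y ^ 3) / \<epsilon> ^ 4 \<le> indicator {..\<epsilon>} (norm (x - y)) * gagliardo_density x y"
    proof (cases "y \<in> ?S \<and> y \<noteq> x")
      case True
      then have n: "norm (x - y) \<le> \<epsilon>" "0 < norm (x - y)" using norm_le_square by auto
      have "osc_at x y ^ 3 / \<epsilon> ^ 4 \<le> osc_at x y ^ 3 / norm (x - y) ^ 4"
        using n \<epsilon> osc_at_nonneg by (intro divide_left_mono power_mono) auto
      moreover have "y \<in> square 0 (1/2)"
        using True x \<epsilon> unfolding mem_square abs_le_iff by auto
      moreover have "x \<in> square 0 (1/2)"
        using x unfolding mem_square by auto
      ultimately show ?thesis using True n by (simp add: gagliardo_density_def)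
    next
      case False
      then show ?thesis
        using gagliardo_density_nonneg[of x y] by (auto simp: osc_at_def)
    qed
  qed
  finally show ?thesis .
qed

lemma r_nonneg: "0 \<le> r"
  using U_le[of 0] norm_ge_zero order_trans by blast

end

section \<open>The estimate at a fixed scale and its limit\<close>

context mollified_frame
begin

text \<open>Three full summands and two halves bound the divergence terms by 4 C r, on a square of
  area 1/4. In C^7 one factor bounds the test function and its first derivatives; six come from the
  frame averages.\<close>

lemma one_le_mollified:
  "1 \<le> ennreal (C * r) + ennreal (300000 * C ^ 7) * (gagliardo_tail \<epsilon> + ennreal \<epsilon>)"
proof -
  let ?Q = "square 0 (1/4)"
  define \<eta>1 where "\<eta>1 = (\<lambda>x. V 0 0 x \<bullet> V 1 0 x)"
  define \<eta>2 where "\<eta>2 = (\<lambda>x. V 0 0 x \<bullet> V 0 1 x)"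
  define B where "B = (\<lambda>x. K 1 0 x * \<eta>1 x + K 0 1 x * \<eta>2 x + K 1 1 x * (\<eta>1 x * \<eta>2 x)
      - K 2 0 x * (\<eta>2 x * \<eta>2 x) / 2 - K 0 2 x * (\<eta>1 x * \<eta>1 x) / 2)"
  define Err where "Err = (\<lambda>x. curvature_error (K 0 0 x) (K 1 0 x) (K 0 1 x)
      (V 0 0 x) (V 1 0 x) (V 0 1 x) (V 2 0 x) (V 1 1 x) (V 0 2 x))"
  define c where "c = 300000 * C ^ 7"
  have c0: "0 \<le> c" using C by (simp add: c_def)
  have V: "has_partial 1 (V a b) (V (Suc a) b)" "has_partial 2 (V a b) (V a (Suc b))"
    "continuous_on UNIV (V a b)" for a b
    unfolding V_def using convolution_has_partial[OF k_smooth U_cont] convolution_continuous[OF k_smooth U_cont]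
    by blast+
  have K0': "K a b x = 0" if "x \<notin> cbox (0 - vec (1/4)) (0 + vec (1/4))" for a b x
    using K0 that by (simp add: square_def)
  note identity = integral_curvature_identity[where V=V and K=K, OF V K]
  have ident: "(LINT x|lborel. K 0 0 x) = (LINT x|lborel. Err x - B x)" "integrable lborel (\<lambda>x. Err x - B x)"
    unfolding Err_def B_def \<eta>1_def \<eta>2_def by (rule identity, erule K0')+
  have ident0: "Err x - B x = 0" if "x \<notin> ?Q" for x
    unfolding Err_def B_def \<eta>1_def \<eta>2_def
    by (rule identity(3), erule K0') (use that in \<open>simp add: square_def\<close>)
  have B_le: "\<bar>B x\<bar> \<le> 4 * (C * r)" if x: "x \<in> ?Q" for x
  proof -
    have e: "\<bar>\<eta>1 x\<bar> \<le> r" "\<bar>\<eta>2 x\<bar> \<le> r"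
      using abs_inner_le[OF norm_V_le[OF x] norm_V_derivative_le(1)[OF x]]
        abs_inner_le[OF norm_V_le[OF x] norm_V_derivative_le(2)[OF x]] by (simp_all add: \<eta>1_def \<eta>2_def)
    have p: "\<bar>s * t\<bar> \<le> r" if "\<bar>s\<bar> \<le> r" "\<bar>t\<bar> \<le> r" for s t
      using abs_mult_le[OF that] mult_left_le[OF r_le r_nonneg] by linarith
    have gen: "\<bar>s1 + s2 + s3 - s4 / 2 - s5 / 2\<bar> \<le> 4 * (C * r)"
      if "\<bar>s1\<bar> \<le> C * r" "\<bar>s2\<bar> \<le> C * r" "\<bar>s3\<bar> \<le> C * r" "\<bar>s4\<bar> \<le> C * r" "\<bar>s5\<bar> \<le> C * r" for s1 s2 s3 s4 s5
      using that by linarith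
    show ?thesis
      unfolding B_def by (intro gen abs_mult_le K_le p e) auto
  qed
  have Err_le: "\<bar>Err x\<bar> \<le> c * (moment (square x (\<epsilon> / 2)) (osc_at x) 3 / \<epsilon>\<^sup>2 + \<epsilon>)" if "x \<in> ?Q" for x
    using curvature_error_at[OF that] by (simp add: Err_def c_def eval_nat_numeral mult_ac)
  \<comment> \<open>\<open>T x\<close> may be infinite at single points, so the pointwise bounds are
    stated in extended nonnegative reals.\<close>
  define T where "T x = (\<integral>\<^sup>+y. ennreal (indicator {..\<epsilon>} (norm (x - y)) * gagliardo_density x y) \<partial>lborel)" for x
  have pt: "ennreal \<bar>Err x - B x\<bar> \<le> indicator ?Q x * (ennreal (4 * (C * r)) + ennreal c * ennreal \<epsilon>) + ennreal c * T x" for x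
  proof (cases "x \<in> ?Q")
    case True
    let ?m = "moment (square x (\<epsilon> / 2)) (osc_at x) 3 / \<epsilon>\<^sup>2"
    have m: "0 \<le> ?m"
      unfolding moment_def using osc_at_nonneg
      by (intro divide_nonneg_nonneg Bochner_Integration.integral_nonneg) auto
    have "\<bar>Err x - B x\<bar> \<le> 4 * (C * r) + (c * ?m + c * \<epsilon>)"
      using B_le[OF True] Err_le[OF True] by (simp add: distrib_left)
    then have "ennreal \<bar>Err x - B x\<bar> \<le> ennreal (4 * (C * r) + (c * ?m + c * \<epsilon>))" by (rule ennreal_leI)
    also have "\<dots> = ennreal (4 * (C * r)) + (ennreal c * ennreal ?m + ennreal c * ennreal \<epsilon>)"
    proof -
      have "ennreal (a + (c * m + c * \<epsilon>)) = ennreal a + (ennreal c * ennreal m + ennreal c * ennreal \<epsilon>)"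
        if "0 \<le> a" "0 \<le> m" for a m
        using that c0 \<epsilon> by (simp add: ennreal_plus ennreal_mult)
      from this[OF _ m, of "4 * (C * r)"] show ?thesis using C r_nonneg by (metis mult_nonneg_nonneg order_trans zero_le_numeral zero_le_one)
    qed
    also have "\<dots> \<le> ennreal (4 * (C * r)) + (ennreal c * T x + ennreal c * ennreal \<epsilon>)"
      unfolding T_def by (intro add_mono mult_left_mono moment_le_tail[OF \<epsilon> True]) auto
    finally show ?thesis using True by (simp add: add_ac)
  next
    case False
    then show ?thesis using ident0[OF False] by simp
  qed
  have T_meas: "T \<in> borel_measurable lborel"
  proof -
    have "(\<lambda>p. ennreal (indicator {..\<epsilon>} (norm (fst p - snd p)) * gagliardo_density (fst p) (snd p)))
        \<in> borel_measurable (lborel \<Otimes>\<^sub>M lborel)"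
      using gagliardo_density_measurable by measurable
    from lborel.borel_measurable_nn_integral_fst[OF this] show ?thesis
      by (simp add: T_def[abs_def])
  qed
  have "1 = ennreal \<bar>LINT x|lborel. Err x - B x\<bar>"
    using ident(1) K_int by simp
  also have "\<dots> \<le> ennreal (LINT x|lborel. \<bar>Err x - B x\<bar>)"
    by (intro ennreal_leI integral_abs_bound)
  also have "\<dots> = (\<integral>\<^sup>+x. ennreal \<bar>Err x - B x\<bar> \<partial>lborel)"
    using ident(2) by (intro nn_integral_eq_integral[symmetric] integrable_abs) auto
  also have "\<dots> \<le> (\<integral>\<^sup>+x. indicator ?Q x * (ennreal (4 * (C * r)) + ennreal c * ennreal \<epsilon>) + ennreal c * T x \<partial>lborel)"
    by (intro nn_integral_mono pt)
  also have "\<dots> = (ennreal (4 * (C * r)) + ennreal c * ennreal \<epsilon>) * emeasure lborel ?Q + ennreal c * gagliardo_tail \<epsilon>"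
    using T_meas square_borel[of 0 "1/4"]
    by (subst nn_integral_add) (auto simp: nn_integral_multc nn_integral_cmult gagliardo_tail_def T_def mult.commute)
  also have "emeasure lborel ?Q = ennreal (1/4)"
    by (simp add: emeasure_square power2_eq_square)
  also have "(ennreal (4 * (C * r)) + ennreal c * ennreal \<epsilon>) * ennreal (1/4) \<le> ennreal (C * r) + ennreal c * ennreal \<epsilon>"
  proof -
    have "(4 * (C * r) + c * \<epsilon>) * (1/4) \<le> C * r + c * \<epsilon>"
      using c0 \<epsilon> by (simp add: algebra_simps)
    then show ?thesis
      using c0 \<epsilon> C r_nonneg by (simp add: ennreal_leI flip: ennreal_mult ennreal_plus)
  qed
  finally show ?thesis
    unfolding c_def[symmetric] by (simp add: algebra_simps)
qed

end

context isometric_frame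
begin

lemma radius_lower_bound:
  assumes fin: "(\<integral>\<^sup>+x. \<integral>\<^sup>+y. ennreal (gagliardo_density x y) \<partial>lborel \<partial>lborel) < \<infinity>"
    and K: "smooth_family K" "\<And>a b x. x \<notin> square 0 (1/4) \<Longrightarrow> K a b x = 0"
     "\<And>x. 0 \<le> K 0 0 x" "(LINT x|lborel. K 0 0 x) = 1"
     "\<And>a b x. a + b \<le> 2 \<Longrightarrow> \<bar>K a b x\<bar> \<le> C" "1 \<le> C"
  shows "1 \<le> C * r"
proof -
  \<comment> \<open>The shift by 4 makes the largest scale 1/5, below the required 1/4.\<close>
  define d where "d n = inverse (real (Suc (n + 4)))" for n
  have d0: "d \<longlonglongrightarrow> 0"
    unfolding d_def using LIMSEQ_inverse_real_of_nat by (rule LIMSEQ_ignore_initial_segment)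
  let ?c = "ennreal (300000 * C ^ 7)"
  have "1 \<le> ennreal (C * r) + ?c * (gagliardo_tail (d n) + ennreal (d n))" for n
  proof -
    interpret mollified_frame U H1 H2 r K C "d n"
    proof
      show "0 < d n" by (simp add: d_def)
      show "d n < 1/4" by (simp add: d_def field_simps)
    qed (use K in auto)
    show ?thesis by (rule one_le_mollified)
  qed
  moreover have "(\<lambda>n. ennreal (C * r) + ?c * (gagliardo_tail (d n) + ennreal (d n))) \<longlonglongrightarrow> ennreal (C * r) + ?c * (0 + ennreal 0)"
    by (intro tendsto_add tendsto_const ennreal_tendsto_cmult gagliardo_tail_tendsto_0[OF fin d0] tendsto_ennrealI d0) simp
  ultimately have "1 \<le> ennreal (C * r) + ?c * (0 + ennreal 0)"
    by (intro LIMSEQ_le_const) auto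
  then show ?thesis by simp
qed

end

subsection \<open>Weak gradients\<close>

lemma integral_lebesgue_on_support:
  fixes g :: "'a::euclidean_space \<Rightarrow> 'b::{banach, second_countable_topology}"
  assumes "\<Omega> \<in> sets lebesgue" "\<And>x. x \<notin> \<Omega> \<Longrightarrow> g x = 0"
  shows "(LINT x|lebesgue_on \<Omega>. g x) = (LINT x|lebesgue. g x)"
proof -
  have "(LINT x|lebesgue_on \<Omega>. g x) = (LINT x|lebesgue. indicator \<Omega> x *\<^sub>R g x)"
    using assms(1) by (intro integral_restrict_space) auto
  also have "(\<lambda>x. indicator \<Omega> x *\<^sub>R g x) = g"
    using assms(2) by (auto simp: indicator_def fun_eq_iff)
  finally show ?thesis .
qed

lemma weak_gradient_smooth_family:
  fixes f :: "real^2 \<Rightarrow> real^'m"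
  assumes f: "has_weak_gradient f G \<Omega>" and \<Omega>: "open \<Omega>" and S: "compact S" "S \<subseteq> \<Omega>"
    and L: "smooth_family L" and L0: "\<And>a b x. x \<notin> S \<Longrightarrow> L a b x = 0"
  shows "(LINT x|lebesgue. f x $ i * L (Suc a) b x) = - (LINT x|lebesgue. G x $ i $ 1 * L a b x)"
    and "(LINT x|lebesgue. f x $ i * L a (Suc b) x) = - (LINT x|lebesgue. G x $ i $ 2 * L a b x)"
proof -
  have \<Omega>': "\<Omega> \<in> sets lebesgue" using \<Omega> by simp
  have L0': "L a b x = 0" if "x \<notin> \<Omega>" for a b x using L0 S that by blast
  have *: "(LINT x|lebesgue. f x $ i * (axis j 1 $ 1 * L (Suc a) b x + axis j 1 $ 2 * L a (Suc b) x))
      = - (LINT x|lebesgue. G x $ i $ j * L a b x)" for j :: 2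
  proof -
    have "L a b \<in> test_functions \<Omega>"
      by (rule smooth_family_test_function[OF L S L0])
    then have "(LINT x|lebesgue_on \<Omega>. f x $ i * frechet_derivative (L a b) (at x) (axis j 1))
        = - (LINT x|lebesgue_on \<Omega>. G x $ i $ j * L a b x)"
      using f by (simp add: has_weak_gradient_def)
    then show ?thesis
      unfolding smooth_family_frechet_derivative[OF L]
      by (subst (asm) (1 2) integral_lebesgue_on_support[OF \<Omega>']) (auto simp: L0')
  qed
  show "(LINT x|lebesgue. f x $ i * L (Suc a) b x) = - (LINT x|lebesgue. G x $ i $ 1 * L a b x)"
    "(LINT x|lebesgue. f x $ i * L a (Suc b) x) = - (LINT x|lebesgue. G x $ i $ 2 * L a b x)"
    using *[of 1] *[of 2] by (simp_all add: axis_def)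
qed

text \<open>Open boxes form an intersection-stable generator of the Borel sets, so a Dynkin argument
  extends the vanishing to all of them; the integral over the whole space enters in the complement
  step.\<close>

lemma AE_zero_if_box_integrals_zero:
  fixes h :: "'a::euclidean_space \<Rightarrow> real"
  assumes h: "integrable lborel h" and 0: "(LINT x|lborel. h x) = 0"
    and box: "\<And>a b. (LINT x:box a b|lborel. h x) = 0"
  shows "AE x in lborel. h x = 0"
proof (rule sigma_finite_measure.density_zero[OF lborel.sigma_finite_measure_axioms h])
  fix A :: "'a set" assume "A \<in> sets lborel"
  then have A: "A \<in> sigma_sets UNIV (range (\<lambda>(a, b). box a b))"
    by (metis borel_eq_box sets_lborel sets_measure_of_conv subset_UNIV Pow_UNIV)
  let ?G = "range (\<lambda>(a, b). box a b :: 'a set)"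
  have sets: "B \<in> sets lborel" if "B \<in> sigma_sets UNIV ?G" for B
    using that by (metis borel_eq_box sets_lborel sets_measure_of_conv subset_UNIV Pow_UNIV)
  have int: "set_integrable lborel B h" if "B \<in> sets lborel" for B
    unfolding set_integrable_def using h that by (intro integrable_mult_indicator) auto
  have "Int_stable ?G" "?G \<subseteq> Pow UNIV"
    by (auto simp: Int_stable_def box_Int_box)
  from this A show "(LINT x:A|lborel. h x) = 0"
  proof (induction rule: sigma_sets_induct_disjoint)
    case (compl B)
    have "(LINT x:UNIV - B|lborel. h x) = (LINT x|lborel. h x) - (LINT x:B|lborel. h x)"
    proof -
      have "(LINT x:UNIV - B|lborel. h x) = (LINT x|lborel. h x - indicator B x *\<^sub>R h x)"
        unfolding set_lebesgue_integral_def
        by (intro Bochner_Integration.integral_cong refl) (auto simp: indicator_def)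
      also have "\<dots> = (LINT x|lborel. h x) - (LINT x:B|lborel. h x)"
        unfolding set_lebesgue_integral_def
        using h int[OF sets[OF compl(1)]] unfolding set_integrable_def
        by (intro Bochner_Integration.integral_diff) auto
      finally show ?thesis .
    qed
    then show ?case using compl 0 by simp
  next
    case (union B)
    have B: "B i \<in> sets lborel" for i
      by (rule sets) (use union in auto)
    have "(LINT x:(\<Union>i. B i)|lborel. h x) = (\<Sum>i. (LINT x:B i|lborel. h x))"
    proof (rule lebesgue_integral_countable_add)
      show "set_integrable lborel (\<Union>i. B i) h" using B by (intro int sets.countable_UN) auto
      show "B i \<inter> B j = {}" if "i \<noteq> j" for i j
        using union that by (auto simp: disjoint_family_on_def)
    qed (rule B)
    then show ?case using union by simp
  qed (use box in \<open>auto simp: set_lebesgue_integral_def\<close>)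
qed

text \<open>The fundamental lemma of the calculus of variations. Products of sharpening bumps
  converge to indicators of boxes, which reduces it to box integrals.\<close>

lemma AE_zero_if_test_integrals_zero:
  fixes f :: "real^2 \<Rightarrow> real"
  assumes f: "integrable lebesgue (\<lambda>x. indicator (box (- vec \<rho>) (vec \<rho>)) x * f x)"
    and test: "\<And>L. smooth_family L \<Longrightarrow> (\<And>a b x. x \<notin> square 0 \<rho> \<Longrightarrow> L a b x = 0) \<Longrightarrow>
      (LINT x|lebesgue. f x * L 0 0 x) = 0"
  shows "AE x in lebesgue. x \<in> box (- vec \<rho>) (vec \<rho>) \<longrightarrow> f x = 0"
proof -
  let ?S = "box (- vec \<rho>) (vec \<rho>) :: (real^2) set"
  define h where "h x = indicator ?S x * f x" for x
  have h: "integrable lebesgue h" using f by (simp add: h_def[abs_def])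
  have box0: "(LINT x|lebesgue. indicator (box p q) x * h x) = 0" for p q
  proof -
    \<comment> \<open>The box is clipped to the square of half-side \<rho>, so that every
      approximating bump is an admissible test function.\<close>
    define a1 where "a1 = max (p $ 1) (- \<rho>)"
    define b1 where "b1 = min (q $ 1) \<rho>"
    define a2 where "a2 = max (p $ 2) (- \<rho>)"
    define b2 where "b2 = min (q $ 2) \<rho>"
    define \<psi> where "\<psi> m x = interval_bump (real (Suc m)) a1 b1 (x $ 1) * interval_bump (real (Suc m)) a2 b2 (x $ 2)"
      for m and x :: "real^2"
    have ind: "indicator {a1<..<b1} (x $ 1) * indicator {a2<..<b2} (x $ 2) = (indicator (box p q) x * indicator ?S x :: real)" for x
      by (auto simp: indicator_def mem_box_cart forall_2 a1_def b1_def a2_def b2_def)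
    have \<psi>0: "\<psi> m x = indicator ?S x * \<psi> m x" for m x
    proof (cases "x \<in> ?S")
      case False
      then have "x $ 1 \<notin> {a1<..<b1} \<or> x $ 2 \<notin> {a2<..<b2}"
        by (auto simp: mem_box_cart forall_2 a1_def b1_def a2_def b2_def)
      then show ?thesis by (auto simp: \<psi>_def interval_bump_eq_0 simp del: of_nat_Suc)
    qed simp
    have "(LINT x|lebesgue. \<psi> m x * h x) = 0" for m
    proof -
      obtain A B where A: "A 0 = interval_bump (real (Suc m)) a1 b1" "derivative_sequence A"
          "\<And>n x. x \<notin> {a1..b1} \<Longrightarrow> A n x = 0"
        and B: "B 0 = interval_bump (real (Suc m)) a2 b2" "derivative_sequence B"
          "\<And>n x. x \<notin> {a2..b2} \<Longrightarrow> B n x = 0"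
        using interval_bump_derivative_sequence[of "real (Suc m)" a1 b1]
          interval_bump_derivative_sequence[of "real (Suc m)" a2 b2] by (metis of_nat_0_less_iff zero_less_Suc)
      have "(LINT x|lebesgue. f x * (A 0 (x $ 1) * B 0 (x $ 2))) = 0"
      proof (rule test[OF smooth_family_tensor[OF A(2) B(2)]])
        fix a b and x :: "real^2" assume "x \<notin> square 0 \<rho>"
        then have "x $ 1 \<notin> {a1..b1} \<or> x $ 2 \<notin> {a2..b2}"
          by (auto simp: mem_square a1_def b1_def a2_def b2_def abs_le_iff)
        then show "A a (x $ 1) * B b (x $ 2) = 0" using A(3) B(3) by auto
      qed
      moreover have "f x * (A 0 (x $ 1) * B 0 (x $ 2)) = \<psi> m x * h x" for x
        using \<psi>0[of m x] by (simp add: A(1) B(1) \<psi>_def h_def mult_ac)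
      ultimately show ?thesis by simp
    qed
    moreover have "(\<lambda>m. LINT x|lebesgue. \<psi> m x * h x) \<longlonglongrightarrow> (LINT x|lebesgue. indicator (box p q) x * h x)"
    proof (rule integral_dominated_convergence[where w="\<lambda>x. \<bar>h x\<bar>"])
      have \<psi>_meas: "\<psi> m \<in> borel_measurable borel" for m
      proof -
        have "continuous_on UNIV (flat_exp 0)"
          using flat_exp_has_real_derivative[of 0] by (meson DERIV_continuous continuous_at_imp_continuous_on)
        then have [measurable]: "flat_exp 0 \<in> borel_measurable borel"
          by (rule borel_measurable_continuous_onI)
        show ?thesis unfolding \<psi>_def interval_bump_def by measurable
      qed
      have "\<psi> m \<in> borel_measurable lebesgue" for m
        using \<psi>_meas[of m] by (intro measurable_completion) simp
      then show "(\<lambda>x. \<psi> m x * h x) \<in> borel_measurable lebesgue" for m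
        using h by (intro borel_measurable_times) auto
      show "(\<lambda>x. indicator (box p q) x * h x) \<in> borel_measurable lebesgue"
        using h by (auto intro!: borel_measurable_times borel_measurable_indicator)
      have "(\<lambda>m. \<psi> m x * h x) \<longlonglongrightarrow> indicator (box p q) x * h x" for x
      proof -
        have "(\<lambda>m. \<psi> m x * h x) \<longlonglongrightarrow> indicator {a1<..<b1} (x $ 1) * indicator {a2<..<b2} (x $ 2) * h x"
          unfolding \<psi>_def by (intro tendsto_mult interval_bump_tendsto tendsto_const)
        moreover have "indicator {a1<..<b1} (x $ 1) * indicator {a2<..<b2} (x $ 2) * h x = indicator (box p q) x * h x"
          unfolding ind by (simp add: h_def indicator_def)
        ultimately show ?thesis by simp
      qed
      then show "AE x in lebesgue. (\<lambda>m. \<psi> m x * h x) \<longlonglongrightarrow> indicator (box p q) x * h x" by simp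
      have "\<bar>\<psi> m x\<bar> \<le> 1" for m x
        unfolding \<psi>_def abs_mult using interval_bump_bounds
        by (intro mult_le_one) (auto simp: abs_of_nonneg)
      then show "AE x in lebesgue. norm (\<psi> m x * h x) \<le> \<bar>h x\<bar>" for m
        by (intro always_eventually allI) (simp add: abs_mult mult_left_le_one_le)
    qed (use h in auto)
    ultimately show ?thesis by (simp add: LIMSEQ_const_iff)
  qed
  \<comment> \<open>A Borel representative transfers the question from the completed measure to
    \<open>lborel\<close>.\<close>
  obtain h' where h': "h' \<in> borel_measurable lborel" "AE x in lborel. h x = h' x"
    using completion_ex_borel_measurable_real[of h lborel] h by auto
  have AE': "AE x in lebesgue. h x = h' x" using h'(2) by (rule AE_completion)
  have eq: "(LINT x|lborel. indicator B x * h' x) = (LINT x|lebesgue. indicator B x * h x)" if "B \<in> sets borel" for B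
  proof -
    have "(LINT x|lborel. indicator B x * h' x) = (LINT x|lebesgue. indicator B x * h' x)"
      using h' that by (intro integral_completion[symmetric]) auto
    also have "\<dots> = (LINT x|lebesgue. indicator B x * h x)"
    proof (rule integral_cong_AE)
      have B: "(indicator B :: _ \<Rightarrow> real) \<in> borel_measurable lebesgue"
        using that by (intro borel_measurable_indicator) (simp add: sets_completionI_sets)
      show "(\<lambda>x. indicator B x * h' x) \<in> borel_measurable lebesgue"
        by (intro borel_measurable_times B measurable_completion h'(1))
      show "(\<lambda>x. indicator B x * h x) \<in> borel_measurable lebesgue"
        using h by (intro borel_measurable_times B) auto
      show "AE x in lebesgue. indicator B x * h' x = indicator B x * h x"
        using AE' by eventually_elim simp
    qed
    finally show ?thesis .
  qed
  have "AE x in lborel. h' x = 0"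
  proof (rule AE_zero_if_box_integrals_zero)
    have "integrable lebesgue h'"
      using h AE' h'(1) by (subst integrable_cong_AE[where g=h]) (auto intro: measurable_completion)
    then show "integrable lborel h'" using h'(1) by (simp add: integrable_completion)
    have "(LINT x|lborel. h' x) = (LINT x|lebesgue. h x)" using eq[of UNIV] by simp
    also have "\<dots> = (LINT x|lebesgue. indicator ?S x * h x)"
      by (intro Bochner_Integration.integral_cong) (auto simp: h_def indicator_def)
    finally show "(LINT x|lborel. h' x) = 0" using box0 by simp
    show "(LINT x:box a b|lborel. h' x) = 0" for a b
      using eq[of "box a b"] box0 by (simp add: set_lebesgue_integral_def)
  qed
  then have "AE x in lebesgue. h' x = 0" by (rule AE_completion)
  with AE' show ?thesis by eventually_elim (auto simp: h_def)
qed

lemma mem_square_0_imp_box: "x \<in> square 0 \<rho> \<Longrightarrow> \<rho> < \<rho>' \<Longrightarrow> x \<in> box (- vec \<rho>') (vec \<rho>')"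
  by (auto simp: mem_square mem_box_cart forall_2 abs_le_iff)

lemma box_imp_mem_square_0: "x \<in> box (- vec \<rho>) (vec \<rho>) \<Longrightarrow> x \<in> square 0 \<rho>"
  by (auto simp: mem_square mem_box_cart forall_2 abs_le_iff)

lemma compact_square: "compact (square x \<rho>)"
  by (simp add: square_def)

lemma square_subset_ball: "square 0 (3/5) \<subseteq> ball (0::real^2) 1"
proof
  fix y :: "real^2" assume y: "y \<in> square 0 (3/5)"
  have "(norm y)\<^sup>2 = (y $ 1)\<^sup>2 + (y $ 2)\<^sup>2"
    unfolding power2_norm_eq_inner by (simp add: inner_vec_def UNIV_2 power2_eq_square)
  moreover have "(y $ i)\<^sup>2 \<le> (3/5)\<^sup>2" if "\<bar>y $ i\<bar> \<le> 3/5" for i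
    using that by (subst power2_abs[symmetric], intro power_mono) auto
  ultimately have "(norm y)\<^sup>2 \<le> (3/5)\<^sup>2 + (3/5)\<^sup>2"
    using y unfolding mem_square by (metis add_mono diff_zero zero_index)
  then have "(norm y)\<^sup>2 < 1\<^sup>2" by (simp add: power2_eq_square)
  then have "norm y < 1" by (rule power2_less_imp_less) simp
  then show "y \<in> ball 0 1" by simp
qed

lemma set_integrable_entry:
  fixes G :: "'a \<Rightarrow> real^'n^'m"
  assumes "set_integrable M S G"
  shows "integrable M (\<lambda>x. indicator S x * G x $ i $ j)"
  using integrable_bounded_linear[OF bounded_linear_vec_nth[of j]
      integrable_bounded_linear[OF bounded_linear_vec_nth[of i] assms[unfolded set_integrable_def]]]
  by simp

text \<open>The isometry condition is given for one weak gradient on the disk, the finite seminorm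
  for possibly another one on a smaller domain. Their difference integrates to zero against every
  test function supported in a common square.\<close>

lemma weak_gradient_unique:
  fixes f :: "real^2 \<Rightarrow> real^'m"
  assumes G: "has_weak_gradient f G \<Omega>" "open \<Omega>" and G': "has_weak_gradient f G' \<Omega>'" "open \<Omega>'"
    and \<rho>: "square 0 \<rho> \<subseteq> \<Omega>" "square 0 \<rho> \<subseteq> \<Omega>'"
  shows "AE x in lebesgue. x \<in> box (- vec \<rho>) (vec \<rho>) \<longrightarrow> G x = G' x"
proof -
  let ?S = "box (- vec \<rho>) (vec \<rho>) :: (real^2) set"
  have int_loc: "integrable lebesgue (\<lambda>x. indicator (square 0 \<rho>) x * G x $ i $ j)"
    if "has_weak_gradient f G \<Omega>" "square 0 \<rho> \<subseteq> \<Omega>" for G \<Omega> i j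
    using that compact_square[of 0 \<rho>]
    by (intro set_integrable_entry) (simp add: has_weak_gradient_def L1_loc_def)
  have "AE x in lebesgue. x \<in> ?S \<longrightarrow> G x $ i $ j - G' x $ i $ j = 0" for i j
  proof (rule AE_zero_if_test_integrals_zero)
    have "integrable lebesgue (\<lambda>x. indicator ?S x *\<^sub>R
       (indicator (square 0 \<rho>) x * G x $ i $ j - indicator (square 0 \<rho>) x * G' x $ i $ j))"
      by (intro integrable_mult_indicator Bochner_Integration.integrable_diff int_loc[OF G(1) \<rho>(1)] int_loc[OF G'(1) \<rho>(2)]) simp
    also have "(\<lambda>x. indicator ?S x *\<^sub>R
       (indicator (square 0 \<rho>) x * G x $ i $ j - indicator (square 0 \<rho>) x * G' x $ i $ j))
       = (\<lambda>x. indicator ?S x * (G x $ i $ j - G' x $ i $ j))"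
      using box_imp_mem_square_0 by (auto simp: fun_eq_iff indicator_def)
    finally show "integrable lebesgue (\<lambda>x. indicator ?S x * (G x $ i $ j - G' x $ i $ j))" .
  next
    fix L assume L: "smooth_family L" and L0: "\<And>a b x. x \<notin> square 0 \<rho> \<Longrightarrow> L a b x = 0"
    note W = weak_gradient_smooth_family[OF G compact_square \<rho>(1) L L0, of i 0 0]
      and W' = weak_gradient_smooth_family[OF G' compact_square \<rho>(2) L L0, of i 0 0]
    have eq: "(LINT x|lebesgue. G x $ i $ j * L 0 0 x) = (LINT x|lebesgue. G' x $ i $ j * L 0 0 x)"
      using W W' exhaust_2[of j] by auto
    have L_meas: "L 0 0 \<in> borel_measurable lebesgue"
      using smooth_family_continuous_on[OF L continuous_on_id]
      by (intro measurable_completion) (simp add: borel_measurable_continuous_onI)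
    obtain B where B: "\<And>x. norm (L 0 0 x) \<le> B"
      using continuous_compact_support_bounded[of "L 0 0" "0 - vec \<rho>" "0 + vec \<rho>"]
        smooth_family_continuous_on[OF L continuous_on_id] L0 unfolding square_def by metis
    have int: "integrable lebesgue (\<lambda>x. G x $ i $ j * L 0 0 x)"
      if "has_weak_gradient f G \<Omega>" "square 0 \<rho> \<subseteq> \<Omega>" for G \<Omega>
    proof -
      have "integrable lebesgue (\<lambda>x. L 0 0 x *\<^sub>R (indicator (square 0 \<rho>) x * G x $ i $ j))"
      proof (rule Bochner_Integration.integrable_bound)
        show "integrable lebesgue (\<lambda>x. B * norm (indicator (square 0 \<rho>) x * G x $ i $ j))"
          by (intro integrable_mult_right integrable_norm int_loc[OF that])
        show "(\<lambda>x. L 0 0 x *\<^sub>R (indicator (square 0 \<rho>) x * G x $ i $ j)) \<in> borel_measurable lebesgue"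
          by (intro borel_measurable_scaleR L_meas borel_measurable_integrable[OF int_loc[OF that]])
        show "AE x in lebesgue. norm (L 0 0 x *\<^sub>R (indicator (square 0 \<rho>) x * G x $ i $ j))
            \<le> norm (B * norm (indicator (square 0 \<rho>) x * G x $ i $ j))"
        proof (intro always_eventually allI)
          fix x
          have "\<bar>L 0 0 x\<bar> \<le> \<bar>B\<bar>" using B[of x] by simp
          then show "norm (L 0 0 x *\<^sub>R (indicator (square 0 \<rho>) x * G x $ i $ j))
            \<le> norm (B * norm (indicator (square 0 \<rho>) x * G x $ i $ j))"
            by (simp add: abs_mult mult_right_mono)
        qed
      qed
      also have "(\<lambda>x. L 0 0 x *\<^sub>R (indicator (square 0 \<rho>) x * G x $ i $ j)) = (\<lambda>x. G x $ i $ j * L 0 0 x)"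
        using L0 by (auto simp: fun_eq_iff indicator_def)
      finally show ?thesis .
    qed
    show "(LINT x|lebesgue. (G x $ i $ j - G' x $ i $ j) * L 0 0 x) = 0"
      unfolding left_diff_distrib
      using eq int[OF G(1) \<rho>(1)] int[OF G'(1) \<rho>(2)] by simp
  qed
  then have "AE x in lebesgue. \<forall>i j. x \<in> ?S \<longrightarrow> G x $ i $ j - G' x $ i $ j = 0"
    by (intro eventually_all_finite)
  then show ?thesis
    by eventually_elim (simp add: vec_eq_iff)
qed

section \<open>Columns of the gradient and orthonormal frames\<close>

lemma norm_column_le:
  fixes A :: "real^'n^'m"
  shows "norm (column j A) \<le> norm A"
  unfolding norm_vec_def[of A] norm_vec_def[of "column j A"]
  by (intro L2_set_mono) (auto simp: column_def component_le_norm_cart)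

lemma norm_le_columns:
  fixes A :: "real^2^'m"
  shows "norm A \<le> norm (column 1 A) + norm (column 2 A)"
proof -
  have "norm A \<le> L2_set (\<lambda>i. norm (column 1 A $ i) + norm (column 2 A $ i)) UNIV"
    unfolding norm_vec_def[of A]
  proof (intro L2_set_mono)
    show "norm (A $ i) \<le> norm (column 1 A $ i) + norm (column 2 A $ i)" for i
      using norm_le_l1_cart[of "A $ i"] by (simp add: UNIV_2 column_def)
  qed auto
  also have "\<dots> \<le> norm (column 1 A) + norm (column 2 A)"
    unfolding norm_vec_def[of "column _ A"] by (rule L2_set_triangle_ineq)
  finally show ?thesis .
qed

lemma column_frame:
  fixes A :: "real^2^'m"
  assumes "transpose A ** A = mat 1"
  shows "column 1 A \<bullet> column 1 A = 1" "column 2 A \<bullet> column 2 A = 1" "column 1 A \<bullet> column 2 A = 0"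
proof -
  have "column i A \<bullet> column j A = (transpose A ** A) $ i $ j" for i j
    by (simp add: matrix_matrix_mult_def transpose_def column_def inner_vec_def)
  then show "column 1 A \<bullet> column 1 A = 1" "column 2 A \<bullet> column 2 A = 1" "column 1 A \<bullet> column 2 A = 0"
    by (simp_all add: assms mat_def)
qed

text \<open>Redefining the frame on a null set makes it Borel and orthonormal everywhere.\<close>

lemma borel_frame_exists:
  fixes G :: "real^2 \<Rightarrow> real^2^3"
  assumes G: "set_integrable lebesgue S G" and S: "S \<in> sets lebesgue"
    and iso: "AE x in lebesgue. x \<in> S \<longrightarrow> transpose (G x) ** G x = mat 1"
  obtains H1 H2 :: "real^2 \<Rightarrow> real^3" where "H1 \<in> borel_measurable borel" "H2 \<in> borel_measurable borel"
    "\<And>y. H1 y \<bullet> H1 y = 1" "\<And>y. H2 y \<bullet> H2 y = 1" "\<And>y. H1 y \<bullet> H2 y = 0"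
    "AE x in lborel. x \<in> S \<longrightarrow> H1 x = column 1 (G x) \<and> H2 x = column 2 (G x)"
proof -
  have "\<exists>g. g \<in> borel_measurable lborel \<and> (AE x in lborel. indicator S x * G x $ i $ j = g x)" for i j
  proof -
    have "(\<lambda>x. indicator S x * G x $ i $ j) \<in> borel_measurable lebesgue"
      using set_integrable_entry[OF G] by (rule borel_measurable_integrable)
    from completion_ex_borel_measurable_real[OF this] show ?thesis by blast
  qed
  then have ex: "\<exists>g. g \<in> borel_measurable lborel \<and> (AE x in lborel. indicator S x * G x $ i $ j = g x)" for i j .
  define g where "g i j = (SOME g. g \<in> borel_measurable lborel \<and> (AE x in lborel. indicator S x * G x $ i $ j = g x))" for i j
  have g: "g i j \<in> borel_measurable lborel" "AE x in lborel. indicator S x * G x $ i $ j = g i j x" for i j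
    unfolding g_def using someI_ex[OF ex[of i j]] by auto
  define E where "E j x = (\<chi> i. g i j x)" for j x
  have E_meas: "E j \<in> borel_measurable borel" for j
    unfolding E_def using g(1)
    by (subst borel_measurable_euclidean_space) (auto simp: Basis_vec_def inner_axis)
  define N where "N = {x. E 1 x \<bullet> E 1 x = 1 \<and> E 2 x \<bullet> E 2 x = 1 \<and> E 1 x \<bullet> E 2 x = 0}"
  have N: "N \<in> sets borel"
    unfolding N_def using E_meas by measurable
  define H where "H j x = (if x \<in> N then E j x else axis (if j = 1 then 1 else 2) 1)" for j :: 2 and x
  have H_meas: "H j \<in> borel_measurable borel" for j
    unfolding H_def using E_meas[of j] N by measurable
  have "AE x in lborel. \<forall>i j. indicator S x * G x $ i $ j = g i j x"
    using g(2) by (intro eventually_all_finite)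
  moreover have "AE x in lborel. x \<in> S \<longrightarrow> transpose (G x) ** G x = mat 1"
    using iso by (simp add: AE_completion_iff)
  ultimately have "AE x in lborel. x \<in> S \<longrightarrow> H 1 x = column 1 (G x) \<and> H 2 x = column 2 (G x)"
  proof eventually_elim
    case (elim x)
    show ?case
    proof
      assume "x \<in> S"
      then have E: "E j x = column j (G x)" for j
        using elim(1) by (simp add: E_def column_def vec_eq_iff)
      have "x \<in> N" using column_frame[of "G x"] elim(2) \<open>x \<in> S\<close> by (simp add: N_def E)
      then show "H 1 x = column 1 (G x) \<and> H 2 x = column 2 (G x)" by (simp add: H_def E)
    qed
  qed
  moreover have "H 1 y \<bullet> H 1 y = 1" "H 2 y \<bullet> H 2 y = 1" "H 1 y \<bullet> H 2 y = 0" for y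
    by (auto simp: H_def N_def inner_axis_axis)
  ultimately show thesis
    using that[of "H 1" "H 2"] H_meas by blast
qed

subsection \<open>The radius of an isometric immersion\<close>

lemma integrable_smooth_family_scaleR:
  fixes W :: "real^2 \<Rightarrow> 'b::euclidean_space"
  assumes L: "smooth_family L" and L0: "\<And>x. x \<notin> square 0 \<rho> \<Longrightarrow> L a b x = 0"
    and W: "W \<in> borel_measurable borel" "\<And>y. norm (W y) \<le> B"
  shows "integrable lborel (\<lambda>y. L a b y *\<^sub>R W y)"
proof -
  have cont: "continuous_on UNIV (L a b)"
    using smooth_family_continuous_on[OF L continuous_on_id] by simp
  show ?thesis
  proof (rule Bochner_Integration.integrable_bound)
    show "integrable lborel (\<lambda>y. L a b y * B)"
      by (intro integrable_mult_left integrable_lborel_compact_support[OF cont L0[unfolded square_def]])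
    show "(\<lambda>y. L a b y *\<^sub>R W y) \<in> borel_measurable lborel"
      using W borel_measurable_continuous_onI[OF cont] by simp
    show "AE y in lborel. norm (L a b y *\<^sub>R W y) \<le> norm (L a b y * B)"
    proof (intro always_eventually allI)
      fix y
      have "norm (W y) \<le> \<bar>B\<bar>" using W(2)[of y] by simp
      then show "norm (L a b y *\<^sub>R W y) \<le> norm (L a b y * B)" by (simp add: abs_mult mult_left_mono)
    qed
  qed
qed

text \<open>On [0, 1] powers decrease in the exponent; dividing by 4 brings the range of
  \<open>t\<close> there, and 64 = 4^3.\<close>

lemma cube_le_powr:
  fixes t p :: real
  assumes "0 \<le> t" "t \<le> 4" "0 \<le> p" "p \<le> 3"
  shows "t ^ 3 \<le> 64 * t powr p"
proof (cases "t = 0")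
  case False
  have "t ^ 3 = 64 * (t / 4) powr 3" using assms False by (simp add: powr_realpow power_divide)
  also have "\<dots> \<le> 64 * (t / 4) powr p"
    using assms False by (intro mult_left_mono powr_mono') auto
  also have "\<dots> \<le> 64 * t powr p"
    using assms by (intro mult_left_mono powr_mono2) auto
  finally show ?thesis .
qed simp

text \<open>Nested squares separate the roles: half-side 1/4 for the test function, 1/2 for the
  frame, 11/20 for the identification of the gradients, 3/5 for the domain with finite
  seminorm.\<close>

lemma isometric_immersion_radius:
  fixes u :: "real^2 \<Rightarrow> real^3"
  assumes s: "2/3 \<le> s" "s < 1" and r: "r \<le> 1"
    and u_W: "u \<in> W1s_loc s (2/s) (ball 0 1)" and u_cont: "continuous_on (ball 0 1) u"
    and G: "has_weak_gradient u G (ball 0 1)"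
    and iso: "AE x in lebesgue_on (ball 0 1). transpose (G x) ** G x = mat 1"
    and image: "u ` ball 0 1 \<subseteq> cball c r"
    and K: "smooth_family K" "\<And>a b x. x \<notin> square 0 (1/4) \<Longrightarrow> K a b x = 0"
     "\<And>x. 0 \<le> K 0 0 x" "(LINT x|lborel. K 0 0 x) = 1"
     "\<And>a b x. a + b \<le> 2 \<Longrightarrow> \<bar>K a b x\<bar> \<le> C" "1 \<le> C"
  shows "1 \<le> C * r"
proof -
  \<comment> \<open>Since 2 (3/5)^2 < 1, the closure is a compact subset of the disk, as the local
    hypothesis demands.\<close>
  define \<Omega> where "\<Omega> = (box (- vec (3/5)) (vec (3/5)) :: (real^2) set)"
  let ?S = "square 0 (1/2)"
  have \<Omega>: "open \<Omega>" "closure \<Omega> \<subseteq> square 0 (3/5)"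
    unfolding \<Omega>_def using box_imp_mem_square_0
    by (auto intro!: closure_minimal compact_imp_closed[OF compact_square] del: subsetI) blast
  have sq_\<Omega>: "square 0 \<rho> \<subseteq> \<Omega>" if "\<rho> < 3/5" for \<rho>
    unfolding \<Omega>_def using mem_square_0_imp_box[OF _ that] by blast
  have \<Omega>_ball: "\<Omega> \<subseteq> ball 0 1"
    using \<Omega>(2) closure_subset square_subset_ball by blast
  have "compact (closure \<Omega>)"
    using \<Omega>(2) compact_Int_closed[OF compact_square closed_closure, of 0 "3/5" \<Omega>]
    by (simp add: Int_absorb1)
  then have "u \<in> W1s s (2/s) \<Omega>"
    using u_W \<Omega> square_subset_ball unfolding W1s_loc_def by blast
  then obtain G' where G': "has_weak_gradient u G' \<Omega>" and gag: "gagliardo_seminorm s (2/s) \<Omega> G' < \<infinity>"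
    unfolding W1s_def by blast
  have S\<Omega>: "?S \<subseteq> \<Omega>" by (rule sq_\<Omega>) simp
  \<comment> \<open>Gradients are identified on an open box only; half-side 11/20 makes it contain
    the closed square of half-side 1/2.\<close>
  have "AE x in lebesgue. x \<in> box (- vec (11/20)) (vec (11/20)) \<longrightarrow> G x = G' x"
    by (rule weak_gradient_unique[OF G open_ball G' \<Omega>(1)])
      (use sq_\<Omega>[of "11/20"] \<Omega>_ball in auto)
  moreover have "AE x in lebesgue. x \<in> ball 0 1 \<longrightarrow> transpose (G x) ** G x = mat 1"
    using iso by (subst (asm) AE_restrict_space_iff) auto
  ultimately have iso': "AE x in lebesgue. x \<in> ?S \<longrightarrow> transpose (G' x) ** G' x = mat 1"
  proof eventually_elim
    case (elim x)
    then show ?case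
      using mem_square_0_imp_box[of x "1/2" "11/20"] S\<Omega> \<Omega>_ball by auto
  qed
  have G'_int: "set_integrable lebesgue ?S G'"
    using G' S\<Omega> compact_square by (simp add: has_weak_gradient_def L1_loc_def)
  have S_sets: "?S \<in> sets lebesgue" by (simp add: square_def)
  obtain H1 H2 :: "real^2 \<Rightarrow> real^3" where H_meas: "H1 \<in> borel_measurable borel" "H2 \<in> borel_measurable borel"
    and H_frame: "\<And>y. H1 y \<bullet> H1 y = 1" "\<And>y. H2 y \<bullet> H2 y = 1" "\<And>y. H1 y \<bullet> H2 y = 0"
    and H_G: "AE x in lborel. x \<in> ?S \<longrightarrow> H1 x = column 1 (G' x) \<and> H2 x = column 2 (G' x)"
    by (rule borel_frame_exists[OF G'_int S_sets iso']) (rule that)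
  \<comment> \<open>Extension by zero makes the translated map Borel and bounded by \<open>r\<close>
    on the whole plane.\<close>
  define U where "U y = indicator (ball 0 1) y *\<^sub>R (u y - c)" for y
  have r0: "0 \<le> r"
    using image by (metis cball_eq_empty empty_subsetI image_is_empty ball_eq_empty linorder_not_less subset_empty not_one_le_zero)
  have U_le: "norm (U y) \<le> r" for y
    using image r0 by (auto simp: U_def indicator_def dist_norm norm_minus_commute image_subset_iff)
  have U_meas: "U \<in> borel_measurable borel"
    unfolding U_def
    by (intro borel_measurable_continuous_on_indicator continuous_intros u_cont) auto
  have U_cont: "continuous_on ?S U"
  proof -
    have "continuous_on ?S (\<lambda>y. u y - c)"
      using S\<Omega> \<Omega>_ball by (intro continuous_intros continuous_on_subset[OF u_cont]) auto
    moreover have "u y - c = U y" if "y \<in> ?S" for y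
      using that S\<Omega> \<Omega>_ball by (auto simp: U_def)
    ultimately show ?thesis by (rule continuous_on_eq)
  qed
  have weak: "(LINT y|lborel. L (Suc a) b y *\<^sub>R U y) = - (LINT y|lborel. L a b y *\<^sub>R H1 y) \<and>
      (LINT y|lborel. L a (Suc b) y *\<^sub>R U y) = - (LINT y|lborel. L a b y *\<^sub>R H2 y)"
    if L: "smooth_family L" and \<rho>: "\<rho> < 1/2" and L0: "\<And>a b y. y \<notin> square 0 \<rho> \<Longrightarrow> L a b y = 0" for L \<rho> a b
  proof -
    have \<rho>S: "square 0 \<rho> \<subseteq> ?S" using \<rho> by (auto simp: mem_square)
    have cont: "continuous_on UNIV (L a b)" for a b
      using smooth_family_continuous_on[OF L continuous_on_id] by simp
    have L_borel: "L a b \<in> borel_measurable borel" for a b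
      using cont by (rule borel_measurable_continuous_onI)
    have int_U: "integrable lborel (\<lambda>y. L a b y *\<^sub>R U y)" for a b
      by (rule integrable_smooth_family_scaleR[OF L L0 U_meas U_le])
    have "norm (H1 y) \<le> 1" "norm (H2 y) \<le> 1" for y by (simp_all add: norm_eq_sqrt_inner H_frame)
    then have int_H: "integrable lborel (\<lambda>y. L a b y *\<^sub>R H1 y)" "integrable lborel (\<lambda>y. L a b y *\<^sub>R H2 y)" for a b
      using integrable_smooth_family_scaleR[OF L L0] H_meas by blast+
    have int_L: "integrable lborel (L a b)" for a b
      by (rule integrable_lborel_compact_support[OF cont L0[unfolded square_def]])
    \<comment> \<open>The translation by \<open>c\<close> is invisible to the weak derivative,
      because a derivative of a compactly supported function has integral zero.\<close>
    have left: "(LINT y|lebesgue. u y $ i * L a' b' y) = (LINT y|lborel. L a' b' y *\<^sub>R U y) $ i"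
      if "(LINT y|lborel. L a' b' y) = 0" for a' b' i
    proof -
      have eq: "u y $ i * L a' b' y = (L a' b' y *\<^sub>R U y) $ i + c $ i * L a' b' y" for y
      proof (cases "y \<in> ball 0 1")
        case False
        then have "L a' b' y = 0" using L0 \<rho>S S\<Omega> \<Omega>_ball by blast
        then show ?thesis by simp
      qed (simp add: U_def algebra_simps)
      have intc: "integrable lborel (\<lambda>y. (L a' b' y *\<^sub>R U y) $ i)"
        by (rule integrable_bounded_linear[OF bounded_linear_vec_nth int_U])
      have "(LINT y|lebesgue. u y $ i * L a' b' y) = (LINT y|lborel. (L a' b' y *\<^sub>R U y) $ i + c $ i * L a' b' y)"
        unfolding eq using borel_measurable_integrable[OF intc] L_borel[of a' b']
        by (intro integral_completion) simp
      also have "\<dots> = (LINT y|lborel. (L a' b' y *\<^sub>R U y) $ i)"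
        using intc int_L[of a' b'] that by simp
      also have "\<dots> = (LINT y|lborel. L a' b' y *\<^sub>R U y) $ i"
        by (rule integral_bounded_linear[OF bounded_linear_vec_nth int_U])
      finally show ?thesis .
    qed
    have right: "(LINT y|lebesgue. G' y $ i $ j * L a b y) = (LINT y|lborel. L a b y *\<^sub>R Hj y) $ i"
      if Hj: "AE x in lborel. x \<in> ?S \<longrightarrow> Hj x = column j (G' x)" "integrable lborel (\<lambda>y. L a b y *\<^sub>R Hj y)" for i j Hj
    proof -
      have intc: "integrable lborel (\<lambda>y. (L a b y *\<^sub>R Hj y) $ i)"
        by (rule integrable_bounded_linear[OF bounded_linear_vec_nth Hj(2)])
      have "(LINT y|lebesgue. G' y $ i $ j * L a b y) = (LINT y|lebesgue. (L a b y *\<^sub>R Hj y) $ i)"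
      proof (rule integral_cong_AE)
        have "(\<lambda>y. (indicator ?S y * G' y $ i $ j) * L a b y) \<in> borel_measurable lebesgue"
          by (intro borel_measurable_times borel_measurable_integrable[OF set_integrable_entry[OF G'_int]]
              measurable_completion) (simp add: L_borel)
        also have "(\<lambda>y. (indicator ?S y * G' y $ i $ j) * L a b y) = (\<lambda>y. G' y $ i $ j * L a b y)"
          using L0 \<rho>S by (auto simp: fun_eq_iff indicator_def)
        finally show "(\<lambda>y. G' y $ i $ j * L a b y) \<in> borel_measurable lebesgue" .
        show "(\<lambda>y. (L a b y *\<^sub>R Hj y) $ i) \<in> borel_measurable lebesgue"
          by (rule measurable_completion[OF borel_measurable_integrable[OF intc]])
        show "AE y in lebesgue. G' y $ i $ j * L a b y = (L a b y *\<^sub>R Hj y) $ i"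
          using AE_completion[OF Hj(1)]
        proof eventually_elim
          case (elim y)
          then show ?case
            using L0[of y a b] \<rho>S by (cases "y \<in> square 0 \<rho>") (auto simp: column_def)
        qed
      qed
      also have "\<dots> = (LINT y|lborel. (L a b y *\<^sub>R Hj y) $ i)"
        by (rule integral_completion[OF borel_measurable_integrable[OF intc]])
      also have "\<dots> = (LINT y|lborel. L a b y *\<^sub>R Hj y) $ i"
        by (rule integral_bounded_linear[OF bounded_linear_vec_nth Hj(2)])
      finally show ?thesis .
    qed
    have zero: "(LINT y|lborel. L (Suc a) b y) = 0" "(LINT y|lborel. L a (Suc b) y) = 0"
      by (rule integral_partial_eq_0[OF smooth_family_has_partial(1)[OF L] cont cont L0[unfolded square_def]], assumption)
        (rule integral_partial_eq_0[OF smooth_family_has_partial(2)[OF L] cont cont L0[unfolded square_def]], assumption)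
    have H1_G: "AE x in lborel. x \<in> ?S \<longrightarrow> H1 x = column 1 (G' x)"
      and H2_G: "AE x in lborel. x \<in> ?S \<longrightarrow> H2 x = column 2 (G' x)"
      using H_G by (auto elim: eventually_mono)
    have \<rho>\<Omega>: "square 0 \<rho> \<subseteq> \<Omega>" using \<rho>S S\<Omega> by blast
    note W = weak_gradient_smooth_family[OF G' \<Omega>(1) compact_square \<rho>\<Omega> L L0]
    show ?thesis
      unfolding vec_eq_iff
      using W left[OF zero(1)] left[OF zero(2)] right[OF H1_G int_H(1)] right[OF H2_G int_H(2)]
      by simp
  qed
  interpret isometric_frame U H1 H2 r
    by unfold_locales (use U_cont U_meas U_le r H_meas H_frame weak in blast)+
  define I where "I = (\<integral>\<^sup>+y. \<integral>\<^sup>+x. ennreal (norm (G' x - G' y) powr (2/s) /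
      norm (x - y) powr (real DIM(real^2) + s * (2/s))) \<partial>lebesgue_on \<Omega> \<partial>lebesgue_on \<Omega>)"
  have I: "I < \<infinity>"
    using gag unfolding gagliardo_seminorm_def I_def[symmetric] Let_def
    by (auto split: if_splits simp: less_top)
  have \<Omega>_sets: "\<Omega> \<inter> space lebesgue \<in> sets lebesgue" using \<Omega>(1) by simp
  define F where "F x y = ennreal (norm (G' x - G' y) powr (2/s) /
      norm (x - y) powr (real DIM(real^2) + s * (2/s)))" for x y
  have I_eq: "I = (\<integral>\<^sup>+y. (\<integral>\<^sup>+x. F x y * indicator \<Omega> x \<partial>lborel) * indicator \<Omega> y \<partial>lborel)"
    unfolding I_def F_def
    by (simp add: nn_integral_restrict_space[OF \<Omega>_sets] nn_integral_completion)
  \<comment> \<open>The constant is 512 = 2^3 * 4^3: the oscillation is at most twice the gradient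
    difference t, and t^3 <= 64 t^(2/s) since t <= 4. The arguments are swapped because
    \<open>y\<close> is the outer variable in the seminorm.\<close>
  have dens: "gagliardo_density y x / 512 \<le> norm (G' x - G' y) powr (2/s) /
      norm (x - y) powr (real DIM(real^2) + s * (2/s))"
    if xy: "x \<in> ?S" "y \<in> ?S" and Hx: "H1 x = column 1 (G' x)" "H2 x = column 2 (G' x)"
      and Hy: "H1 y = column 1 (G' y)" "H2 y = column 2 (G' y)" for x y
  proof (cases "x = y")
    case True
    then show ?thesis by (simp add: gagliardo_density_def osc_at_def)
  next
    case False
    define t where "t = norm (G' x - G' y)"
    have o: "osc_at y x = norm (column 1 (G' x - G' y)) + norm (column 2 (G' x - G' y))"
      unfolding osc_at_def Hx Hy by (simp add: column_def vec_eq_iff minus_vec_def)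
    have "norm (H1 z) = 1" "norm (H2 z) = 1" for z by (simp_all add: norm_eq_sqrt_inner H_frame)
    then have "osc_at y x \<le> 4"
      using norm_triangle_ineq4[of "H1 x" "H1 y"] norm_triangle_ineq4[of "H2 x" "H2 y"] by (simp add: osc_at_def)
    then have t4: "t \<le> 4" using norm_le_columns[of "G' x - G' y"] by (simp add: t_def o)
    have o2: "osc_at y x \<le> 2 * t"
      using norm_column_le[of 1 "G' x - G' y"] norm_column_le[of 2 "G' x - G' y"] by (simp add: t_def o)
    have "osc_at y x ^ 3 \<le> (2 * t) ^ 3" by (intro power_mono o2 osc_at_nonneg)
    also have "\<dots> \<le> 8 * (64 * t powr (2/s))"
      using cube_le_powr[of t "2/s"] t4 s by (simp add: t_def power_mult_distrib divide_le_eq)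
    finally have o3: "osc_at y x ^ 3 / 512 \<le> t powr (2/s)" by simp
    have "norm (x - y) powr (real DIM(real^2) + s * (2/s)) = norm (x - y) ^ 4"
    proof -
      have e: "real DIM(real^2) + s * (2/s) = real 4" using s by simp
      show ?thesis unfolding e using False by (intro powr_realpow) simp
    qed
    then show ?thesis
      using divide_right_mono[OF o3, of "norm (x - y) ^ 4"] xy
      by (simp add: gagliardo_density_def t_def norm_minus_commute)
  qed
  have "(\<integral>\<^sup>+y. \<integral>\<^sup>+x. ennreal (gagliardo_density y x / 512) \<partial>lborel \<partial>lborel) \<le> I"
    unfolding I_eq
  proof (rule nn_integral_mono_AE)
    show "AE y in lborel. (\<integral>\<^sup>+x. ennreal (gagliardo_density y x / 512) \<partial>lborel)
        \<le> (\<integral>\<^sup>+x. F x y * indicator \<Omega> x \<partial>lborel) * indicator \<Omega> y"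
      using H_G
    proof eventually_elim
      case (elim y)
      show ?case
      proof (cases "y \<in> ?S")
        case True
        have "(\<integral>\<^sup>+x. ennreal (gagliardo_density y x / 512) \<partial>lborel) \<le> (\<integral>\<^sup>+x. F x y * indicator \<Omega> x \<partial>lborel)"
        proof (rule nn_integral_mono_AE)
          show "AE x in lborel. ennreal (gagliardo_density y x / 512) \<le> F x y * indicator \<Omega> x"
            using H_G
          proof eventually_elim
            case (elim x)
            show ?case
            proof (cases "x \<in> ?S")
              case xS: True
              then have "x \<in> \<Omega>" using S\<Omega> by blast
              then show ?thesis
                using dens[OF xS True] elim xS \<open>y \<in> ?S \<longrightarrow> _\<close> True unfolding F_def
                by (auto intro!: ennreal_leI)
            qed (simp add: gagliardo_density_def)
          qed
        qed
        then show ?thesis using True S\<Omega> by auto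
      qed (simp add: gagliardo_density_def)
    qed
  qed
  also have "(\<integral>\<^sup>+y. \<integral>\<^sup>+x. ennreal (gagliardo_density y x / 512) \<partial>lborel \<partial>lborel)
      = ennreal (1/512) * (\<integral>\<^sup>+y. \<integral>\<^sup>+x. ennreal (gagliardo_density y x) \<partial>lborel \<partial>lborel)"
  proof -
    have m: "(\<lambda>p. ennreal (gagliardo_density (fst p) (snd p))) \<in> borel_measurable (lborel \<Otimes>\<^sub>M lborel)"
      using gagliardo_density_measurable by simp
    have m1: "(\<lambda>x. ennreal (gagliardo_density y x)) \<in> borel_measurable lborel" for y
      using measurable_compose[OF measurable_Pair1' m, of y] by simp
    have m2: "(\<lambda>y. \<integral>\<^sup>+x. ennreal (gagliardo_density y x) \<partial>lborel) \<in> borel_measurable lborel"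
      using lborel.borel_measurable_nn_integral_fst[OF m] by simp
    have e: "ennreal (gagliardo_density y x / 512) = ennreal (1/512) * ennreal (gagliardo_density y x)" for x y
      using ennreal_mult[of "1/512" "gagliardo_density y x"] gagliardo_density_nonneg by simp
    show ?thesis unfolding e nn_integral_cmult[OF m1] nn_integral_cmult[OF m2] ..
  qed
  finally have "ennreal (1/512) * (\<integral>\<^sup>+y. \<integral>\<^sup>+x. ennreal (gagliardo_density y x) \<partial>lborel \<partial>lborel) < \<infinity>"
    using I by (rule le_less_trans)
  then have "(\<integral>\<^sup>+y. \<integral>\<^sup>+x. ennreal (gagliardo_density y x) \<partial>lborel \<partial>lborel) < \<infinity>"
    by (auto simp: ennreal_mult_less_top)
  then show ?thesis
    by (rule radius_lower_bound[where K=K]) (use K in auto)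
qed

theorem corollary1p2:
  shows "\<exists>\<rho>\<^sub>0::real. \<rho>\<^sub>0 > 0 \<and>
    (\<forall>(s::real) (r::real). 2/3 \<le> s \<and> s < 1 \<and> r < \<rho>\<^sub>0 \<longrightarrow>
      \<not> (\<exists>u :: real^2 \<Rightarrow> real^3.
            u \<in> W1s_loc s (2/s) (ball 0 1) \<and>
            continuous_on (ball 0 1) u \<and>
            (\<exists>G. has_weak_gradient u G (ball 0 1) \<and>
                 (AE x in lebesgue_on (ball 0 1). transpose (G x) ** G x = mat 1)) \<and>
            (\<exists>c. u ` ball 0 1 \<subseteq> cball c r)))"
proof -
  \<comment> \<open>The kernel, and with it the threshold, is fixed before s, r and \<open>u\<close>
    are introduced.\<close>
  obtain K where K: "smooth_family K" "\<And>a b x. x \<notin> square 0 (1/4) \<Longrightarrow> K a b x = 0"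
    "\<And>x. 0 \<le> K 0 0 x" "(LINT x|lborel. K 0 0 x) = 1"
    using smooth_kernel_exists by metis
  have "\<exists>B. \<forall>x. \<bar>K a b x\<bar> \<le> B" for a b
    using continuous_compact_support_bounded[of "K a b" "0 - vec (1/4)" "0 + vec (1/4)"]
      smooth_family_continuous_on[OF K(1) continuous_on_id] K(2) unfolding square_def real_norm_def by metis
  then obtain B where B: "\<And>a b x. \<bar>K a b x\<bar> \<le> B a b" by metis
  \<comment> \<open>The index set is a finite square containing all (a, b) with a + b <= 2;
    inserting 1 secures C >= 1, hence r <= 1 below the threshold 1/C.\<close>
  define C where "C = Max (insert 1 ((\<lambda>(a, b). B a b) ` ({..2} \<times> {..2})))"
  have "B a b \<le> C" if "a + b \<le> 2" for a b
    unfolding C_def by (rule Max_ge) (use that in force)+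
  then have K_le: "\<bar>K a b x\<bar> \<le> C" if "a + b \<le> 2" for a b x
    using B that order_trans by blast
  have C: "1 \<le> C" unfolding C_def by (intro Max_ge) auto
  show ?thesis
  proof (intro exI[of _ "1 / C"] conjI allI impI notI)
    show "1 / C > 0" using C by simp
    fix s r :: real
    assume sr: "2/3 \<le> s \<and> s < 1 \<and> r < 1 / C"
      and "\<exists>u :: real^2 \<Rightarrow> real^3. u \<in> W1s_loc s (2/s) (ball 0 1) \<and> continuous_on (ball 0 1) u \<and>
        (\<exists>G. has_weak_gradient u G (ball 0 1) \<and>
           (AE x in lebesgue_on (ball 0 1). transpose (G x) ** G x = mat 1)) \<and>
        (\<exists>c. u ` ball 0 1 \<subseteq> cball c r)"
    then obtain u :: "real^2 \<Rightarrow> real^3" and G c where u: "u \<in> W1s_loc s (2/s) (ball 0 1)" "continuous_on (ball 0 1) u"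
      "has_weak_gradient u G (ball 0 1)"
      "AE x in lebesgue_on (ball 0 1). transpose (G x) ** G x = mat 1" "u ` ball 0 1 \<subseteq> cball c r"
      by blast
    have r: "r * C < 1" using sr C by (simp add: less_divide_eq)
    have "r \<le> 1" using sr C by (smt (verit) divide_le_eq_1)
    from isometric_immersion_radius[OF _ _ this u K K_le C] sr have "1 \<le> C * r" by blast
    with r show False by (simp add: mult.commute)
  qed
qed

end
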